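(* Let $p$ be an odd prime, let $\zeta_p\in\overline{\mathbb{Q}}$ be a primitive $p$-th root of unity, and let \[\varphi_p(z)=(z-1)^p+2-\zeta_p\in\mathbb{Q}(\zeta_p)[z].\] If $p$ is not a Wieferich prime, i.e. $2^{p-1}\not\equiv 1 \pmod{p^2}$, then for every $n\geq 1$ the Galois group over $\mathbb{Q}(\zeta_p)$ of the splitting field of the $n$-th iterate $\varphi_p^n$ is isomorphic to $[C_p]^n$.
   Context: $\varphi_p^n$ denotes the $n$-fold composition $\varphi_p\circ\cdots\circ\varphi_p$. $\mathrm{Gal}_{\mathbb{Q}(\zeta_p)}(\varphi_p^n)$ denotes the Galois group of the splitting field of $\varphi_p^n(z)$ over $\mathbb{Q}(\zeta_p)$. $C_p$ is the cyclic group of order $p$, and $[C_p]^n$ is the $n$-fold iterated wreath product of $C_p$ (defined by $[C_p]^1=C_p$ and $[C_p]^{n}=[C_p]^{n-1}\wr C_p$ acting on $p^n$ points), i.e. the automorphism group of the complete rooted $p$-ary tree of depth $n$ generated by cyclic permutations of the children of each vertex; its order is $p^{(p^n-1)/(p-1)}$. The Galois group of $\varphi_p^n$ naturally embeds in $[C_p]^n$, and the claim is that this embedding is onto. *)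

theory Defs
  imports Complex_Main "HOL-Number_Theory.Cong" "HOL-Algebra.Algebra"
    "HOL-Algebra.Algebraic_Closure_Type"
begin

text \<open>
  The algebraic closure of \<open>\<rat>\<close> is taken inside \<open>\<complex>\<close>, so that all fields below are subfields
  of the complex numbers, given by their carrier sets.
\<close>

abbreviation complex_field :: "complex ring" where
  "complex_field \<equiv> ring_of_type_algebra"

definition primitive_root_of_unity :: "nat \<Rightarrow> complex \<Rightarrow> bool" where
  "primitive_root_of_unity n z \<longleftrightarrow> n > 0 \<and> z ^ n = 1 \<and> (\<forall>k. 0 < k \<and> k < n \<longrightarrow> z ^ k \<noteq> 1)"

text \<open>The subfield generated by a set contains \<open>1\<close>, hence \<open>\<rat>\<close>.\<close>

definition rat_adjoin :: "complex \<Rightarrow> complex set" where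
  "rat_adjoin z = generate_field complex_field {z}"

text \<open>Every nonzero polynomial splits over \<open>\<complex>\<close>, so adjoining all complex roots gives a
  splitting field.\<close>

definition splitting_field :: "complex set \<Rightarrow> complex poly \<Rightarrow> complex set" where
  "splitting_field K f = generate_field complex_field (K \<union> {z. poly f z = 0})"

definition galois_group :: "complex set \<Rightarrow> complex set \<Rightarrow> (complex \<Rightarrow> complex) monoid" where
  "galois_group L K = BijGroup L
     \<lparr>carrier := {\<sigma> \<in> Bij L. \<sigma> \<in> ring_hom (complex_field\<lparr>carrier := L\<rparr>) (complex_field\<lparr>carrier := L\<rparr>)
                          \<and> (\<forall>x\<in>K. \<sigma> x = x)}\<rparr>"

definition phi :: "nat \<Rightarrow> complex \<Rightarrow> complex poly" where
  "phi p \<zeta> = [:-1, 1:] ^ p + [:2 - \<zeta>:]"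

definition poly_iterate :: "nat \<Rightarrow> complex poly \<Rightarrow> complex poly" where
  "poly_iterate n f = (pcompose f ^^ n) [:0, 1:]"

text \<open>
  Permutation groups on a set \<open>S\<close> are subgroups of \<^term>\<open>BijGroup S\<close>. The points on which an
  iterated wreath product acts are words, so a pair \<open>(y, x)\<close> of a letter and a word is
  encoded as \<open>y # x\<close>.
\<close>

definition cons_set :: "'a set \<Rightarrow> 'a list set \<Rightarrow> 'a list set" where
  "cons_set B A = {y # x | y x. y \<in> B \<and> x \<in> A}"

text \<open>
  The permutation wreath product \<open>G \<wr> H\<close> for \<open>G\<close> acting on \<open>A\<close> and \<open>H\<close> acting on \<open>B\<close>: a
  permutation \<open>h \<in> H\<close> of the blocks \<open>{y} \<times> A\<close> together with an independently chosen
  element \<open>g y \<in> G\<close> for each block.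
\<close>

definition wreath ::
  "'a list set \<Rightarrow> ('a list \<Rightarrow> 'a list) set \<Rightarrow> 'a set \<Rightarrow> ('a \<Rightarrow> 'a) set \<Rightarrow> ('a list \<Rightarrow> 'a list) set"
where
  "wreath A G B H =
     {(\<lambda>w\<in>cons_set B A. h (hd w) # g (hd w) (tl w)) | h g. h \<in> H \<and> g \<in> B \<rightarrow> G}"

definition cyclic_perms :: "nat \<Rightarrow> (nat \<Rightarrow> nat) set" where
  "cyclic_perms p = {(\<lambda>i\<in>{..<p}. (i + k) mod p) | k. True}"

definition words :: "nat \<Rightarrow> nat \<Rightarrow> nat list set" where
  "words p n = {w. length w = n \<and> set w \<subseteq> {..<p}}"

text \<open>
  The recursion starts with the trivial group on the empty word; at level one this is
  \<open>C\<^sub>p\<close> acting on words of length one, see \<open>iterated_wreath_1\<close> below.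
\<close>

fun iterated_wreath :: "nat \<Rightarrow> nat \<Rightarrow> (nat list \<Rightarrow> nat list) set" where
  "iterated_wreath p 0 = Bij (words p 0)"
| "iterated_wreath p (Suc n) =
     wreath (words p n) (iterated_wreath p n) {..<p} (cyclic_perms p)"

definition iterated_wreath_group :: "nat \<Rightarrow> nat \<Rightarrow> (nat list \<Rightarrow> nat list) monoid" where
  "iterated_wreath_group p n = BijGroup (words p n)\<lparr>carrier := iterated_wreath p n\<rparr>"

lemma poly_poly_iterate: "poly (poly_iterate n f) x = (poly f ^^ n) x"
  by (induction n) (auto simp: poly_iterate_def poly_pcompose)

lemma words_0: "words p 0 = {[]}"
  by (auto simp: words_def)

lemma words_Suc: "words p (Suc n) = cons_set {..<p} (words p n)"
  by (auto simp: words_def cons_set_def length_Suc_conv)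

lemma card_words: "card (words p n) = p ^ n"
  using card_lists_length_eq[of "{..<p}" n] by (simp add: words_def conj_commute)

lemma BijI: "f \<in> extensional S \<Longrightarrow> (\<And>x. x \<in> S \<Longrightarrow> f x \<in> S) \<Longrightarrow> (\<And>x. x \<in> S \<Longrightarrow> g x \<in> S)
   \<Longrightarrow> (\<And>x. x \<in> S \<Longrightarrow> g (f x) = x) \<Longrightarrow> (\<And>x. x \<in> S \<Longrightarrow> f (g x) = x) \<Longrightarrow> f \<in> Bij S"
  unfolding Bij_def by (auto intro: bij_betw_byWitness[where f' = g])

lemma subgroup_BijGroup_iff:
  "subgroup G (BijGroup S) \<longleftrightarrow>
     G \<subseteq> Bij S \<and> (\<lambda>x\<in>S. x) \<in> G \<and> (\<forall>f\<in>G. \<forall>g\<in>G. compose S f g \<in> G)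
     \<and> (\<forall>f\<in>G. (\<lambda>x\<in>S. inv_into S f x) \<in> G)" (is "?L \<longleftrightarrow> ?R")
proof
  assume L: ?L
  then have sub: "G \<subseteq> Bij S" using subgroup.subset[OF L] by (simp add: BijGroup_def)
  have "compose S f g \<in> G" if "f \<in> G" "g \<in> G" for f g
  proof -
    have "f \<otimes>\<^bsub>BijGroup S\<^esub> g \<in> G" using subgroup.m_closed[OF L that] .
    moreover have "f \<in> Bij S" "g \<in> Bij S" using sub that by auto
    ultimately show ?thesis by (simp add: BijGroup_def)
  qed
  moreover have "(\<lambda>x\<in>S. inv_into S f x) \<in> G" if "f \<in> G" for f
    using subgroup.m_inv_closed[OF L that] inv_BijGroup[of f S] sub that by auto
  moreover have "(\<lambda>x\<in>S. x) \<in> G" using subgroup.one_closed[OF L] by (simp add: BijGroup_def)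
  ultimately show ?R using sub by blast
next
  assume R: ?R
  show ?L
  proof (rule subgroup.intro)
    show "G \<subseteq> carrier (BijGroup S)" using R by (simp add: BijGroup_def)
    show "x \<otimes>\<^bsub>BijGroup S\<^esub> y \<in> G" if "x \<in> G" "y \<in> G" for x y
    proof -
      have "x \<in> Bij S" "y \<in> Bij S" using R that by auto
      then show ?thesis using R that by (simp add: BijGroup_def)
    qed
    show "\<one>\<^bsub>BijGroup S\<^esub> \<in> G" using R by (simp add: BijGroup_def)
    show "inv\<^bsub>BijGroup S\<^esub> x \<in> G" if "x \<in> G" for x
      using R that inv_BijGroup[of x S] by auto
  qed
qed

lemma cyclic_perms_subgroup:
  assumes "p > 0"
  shows "subgroup (cyclic_perms p) (BijGroup {..<p})"
proof -
  let ?c = "\<lambda>k. \<lambda>i\<in>{..<p}. (i + k) mod p"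
  have bwd: "((i + k) mod p + (p - k mod p)) mod p = i" if "i < p" for i k
  proof -
    have "((i + k) mod p + (p - k mod p)) mod p = (i + (k mod p + (p - k mod p))) mod p"
      by (metis add.assoc mod_add_left_eq mod_add_right_eq)
    also have "k mod p + (p - k mod p) = p"
      using assms by (simp add: less_imp_le_nat)
    finally show ?thesis using that by simp
  qed
  have fwd: "((i + (p - k mod p)) mod p + k) mod p = i" if "i < p" for i k
  proof -
    have "((i + (p - k mod p)) mod p + k) mod p = (i + ((p - k mod p) + k mod p)) mod p"
      by (metis add.assoc mod_add_left_eq mod_add_right_eq)
    also have "(p - k mod p) + k mod p = p"
      using assms by (simp add: less_imp_le_nat)
    finally show ?thesis using that by simp
  qed
  have Bij: "?c k \<in> Bij {..<p}" for k
    by (rule BijI[where g = "?c (p - k mod p)"]) (use assms bwd fwd in auto)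
  have inv: "(\<lambda>i\<in>{..<p}. inv_into {..<p} (?c k) i) = ?c (p - k mod p)" for k
  proof (rule restrict_ext)
    fix i assume i: "i \<in> {..<p}"
    have inj: "inj_on (?c k) {..<p}" using Bij[of k] by (simp add: Bij_def bij_betw_def)
    show "inv_into {..<p} (?c k) i = (i + (p - k mod p)) mod p"
      by (rule inv_into_f_eq[OF inj]) (use i assms fwd in auto)
  qed
  have comp: "compose {..<p} (?c k) (?c l) = ?c (l + k)" for k l
    using assms by (auto simp: compose_def restrict_def fun_eq_iff mod_add_left_eq add.assoc)
  have one: "(\<lambda>i\<in>{..<p}. i) = ?c 0"
    by (auto simp: restrict_def fun_eq_iff)
  have mem: "?c k \<in> cyclic_perms p" for k unfolding cyclic_perms_def by blast
  have ex: "\<exists>k. f = ?c k" if "f \<in> cyclic_perms p" for f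
    using that unfolding cyclic_perms_def by blast
  show ?thesis
    unfolding subgroup_BijGroup_iff
  proof (intro conjI ballI subsetI)
    show "f \<in> Bij {..<p}" if "f \<in> cyclic_perms p" for f
      using ex[OF that] Bij by (elim exE) (simp only:)
    show "(\<lambda>i\<in>{..<p}. i) \<in> cyclic_perms p" unfolding one by (rule mem)
    show "compose {..<p} f g \<in> cyclic_perms p"
      if "f \<in> cyclic_perms p" "g \<in> cyclic_perms p" for f g
      using ex[OF that(1)] ex[OF that(2)] by (elim exE) (simp only: comp mem)
    show "(\<lambda>i\<in>{..<p}. inv_into {..<p} f i) \<in> cyclic_perms p" if "f \<in> cyclic_perms p" for f
      using ex[OF that] by (elim exE) (simp only: inv mem)
  qed
qed

lemma card_cyclic_perms:
  assumes "p > 0"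
  shows "card (cyclic_perms p) = p"
proof -
  let ?c = "\<lambda>k. \<lambda>i\<in>{..<p}. (i + k) mod p"
  have "cyclic_perms p = ?c ` {..<p}"
  proof -
    have "?c k = ?c (k mod p)" for k by (auto simp: restrict_def fun_eq_iff mod_add_right_eq)
    then show ?thesis unfolding cyclic_perms_def using assms
      by (auto simp: image_iff Bex_def) (metis mod_less_divisor)
  qed
  moreover have "inj_on ?c {..<p}"
  proof (rule inj_onI)
    fix k l assume kl: "k \<in> {..<p}" "l \<in> {..<p}" and eq: "?c k = ?c l"
    have "?c k 0 = ?c l 0" by (simp only: eq)
    then show "k = l" using kl assms by simp
  qed
  ultimately show ?thesis by (simp add: card_image)
qed

lemma wreath_subgroup:
  assumes G: "subgroup G (BijGroup A)" and H: "subgroup H (BijGroup B)"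
  shows "subgroup (wreath A G B H) (BijGroup (cons_set B A))"
proof -
  let ?S = "cons_set B A"
  let ?w = "\<lambda>h g. \<lambda>w\<in>?S. h (hd w) # g (hd w) (tl w)"
  note G' = G[unfolded subgroup_BijGroup_iff] and H' = H[unfolded subgroup_BijGroup_iff]
  have Gb: "bij_betw g A A" if "g \<in> G" for g using G' that by (auto simp: Bij_def)
  have Hb: "bij_betw h B B" if "h \<in> H" for h using H' that by (auto simp: Bij_def)
  have GX: "g x \<in> A" if "g \<in> G" "x \<in> A" for g x using Gb[OF that(1)] that by (auto simp: bij_betw_def)
  have HY: "h y \<in> B" if "h \<in> H" "y \<in> B" for h y using Hb[OF that(1)] that by (auto simp: bij_betw_def)
  define hi where "hi h = (\<lambda>y\<in>B. inv_into B h y)" for h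
  define gi where "gi h g y = (\<lambda>x\<in>A. inv_into A (g (hi h y)) x)" for h g y
  have hiH: "hi h \<in> H" if "h \<in> H" for h using H' that unfolding hi_def by blast
  have giG: "gi h g y \<in> G" if "h \<in> H" "g \<in> B \<rightarrow> G" "y \<in> B" for h g y
    using G' HY[OF hiH[OF that(1)] that(3)] that(2) unfolding gi_def by blast
  have in_S: "?w h g w \<in> ?S" if "h \<in> H" "g \<in> B \<rightarrow> G" and wS: "w \<in> ?S" for h g w
  proof -
    obtain y x where w: "w = y # x" "y \<in> B" "x \<in> A" using wS by (auto simp: cons_set_def)
    have "g y \<in> G" using that w by auto
    then have "h y \<in> B" "g y x \<in> A" using HY GX that(1) w by auto
    then have "h y # g y x \<in> ?S" by (auto simp: cons_set_def)
    then show ?thesis using wS w(1) by simp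
  qed
  have hi1: "hi h (h y) = y" "h (hi h y) = y" if "h \<in> H" "y \<in> B" for h y
    using Hb[OF that(1)] that HY[OF that] unfolding hi_def
    by (auto simp: bij_betw_def f_inv_into_f)
  have gi0: "inv_into A g (g x) = x" "g (inv_into A g x) = x" "inv_into A g x \<in> A"
    if "g \<in> G" "x \<in> A" for g x
    using Gb[OF that(1)] that by (auto simp: bij_betw_def f_inv_into_f intro: inv_into_into)
  have inv1: "?w (hi h) (gi h g) (?w h g w) = w"
    and inv2: "?w h g (?w (hi h) (gi h g) w) = w"
    if h: "h \<in> H" and g: "g \<in> B \<rightarrow> G" and w: "w \<in> ?S" for h g w
  proof -
    obtain y x where yx: "w = y # x" "y \<in> B" "x \<in> A" using w by (auto simp: cons_set_def)
    have gy: "g y \<in> G" using g yx by auto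
    have 1: "h y # g y x \<in> ?S" using yx HY[OF h] GX[OF gy] by (auto simp: cons_set_def)
    show "?w (hi h) (gi h g) (?w h g w) = w"
      using w 1 yx hi1[OF h] gi0[OF gy] GX[OF gy] by (simp add: gi_def)
    have y': "hi h y \<in> B" using HY[OF hiH[OF h]] yx by simp
    have gy': "g (hi h y) \<in> G" using g y' by auto
    have 2: "hi h y # inv_into A (g (hi h y)) x \<in> ?S"
      using y' gi0[OF gy'] yx by (auto simp: cons_set_def)
    show "?w h g (?w (hi h) (gi h g) w) = w"
      using w 2 yx hi1[OF h] gi0[OF gy'] by (simp add: gi_def)
  qed
  have gi': "gi h g \<in> B \<rightarrow> G" if "h \<in> H" "g \<in> B \<rightarrow> G" for h g using giG that by auto
  have Bij: "?w h g \<in> Bij ?S" if "h \<in> H" "g \<in> B \<rightarrow> G" for h g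
  proof (rule BijI[where g = "?w (hi h) (gi h g)"])
    show "?w h g \<in> extensional ?S" by (rule restrict_extensional)
  qed (fact in_S[OF that] in_S[OF hiH[OF that(1)] gi'[OF that]] inv1[OF that] inv2[OF that])+
  have inv: "(\<lambda>w\<in>?S. inv_into ?S (?w h g) w) = ?w (hi h) (gi h g)"
    if "h \<in> H" "g \<in> B \<rightarrow> G" for h g
  proof (rule ext)
    fix w
    have inj: "inj_on (?w h g) ?S" using Bij[OF that] by (simp add: Bij_def bij_betw_def)
    show "(\<lambda>w\<in>?S. inv_into ?S (?w h g) w) w = ?w (hi h) (gi h g) w"
    proof (cases "w \<in> ?S")
      case True
      have "inv_into ?S (?w h g) w = ?w (hi h) (gi h g) w"
        by (rule inv_into_f_eq[OF inj in_S[OF hiH[OF that(1)] gi'[OF that] True] inv2[OF that True]])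
      then show ?thesis using True by simp
    qed simp
  qed
  have comp: "compose ?S (?w h g) (?w h' g')
      = ?w (compose B h h') (\<lambda>y. compose A (g (h' y)) (g' y))"
    if "h \<in> H" "g \<in> B \<rightarrow> G" "h' \<in> H" "g' \<in> B \<rightarrow> G" for h g h' g'
  proof (rule ext)
    fix w
    show "compose ?S (?w h g) (?w h' g') w
      = ?w (compose B h h') (\<lambda>y. compose A (g (h' y)) (g' y)) w"
      using in_S[OF that(3,4), of w]
      by (cases "w \<in> ?S") (auto simp: compose_def cons_set_def)
  qed
  have one: "(\<lambda>w\<in>?S. w) = ?w (\<lambda>y\<in>B. y) (\<lambda>_. \<lambda>x\<in>A. x)"
    by (auto simp: fun_eq_iff restrict_def cons_set_def)
  have mem: "?w h g \<in> wreath A G B H" if "h \<in> H" "g \<in> B \<rightarrow> G" for h g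
    unfolding wreath_def using that by blast
  have ex: "\<exists>h g. f = ?w h g \<and> h \<in> H \<and> g \<in> B \<rightarrow> G" if "f \<in> wreath A G B H" for f
    using that unfolding wreath_def by blast
  show ?thesis
    unfolding subgroup_BijGroup_iff
  proof (intro conjI ballI subsetI)
    fix f assume "f \<in> wreath A G B H"
    then obtain h g where f: "f = ?w h g" "h \<in> H" "g \<in> B \<rightarrow> G" using ex by blast
    show "f \<in> Bij ?S" unfolding f(1) by (rule Bij[OF f(2,3)])
  next
    show "(\<lambda>x\<in>?S. x) \<in> wreath A G B H" unfolding one
      by (rule mem) (use G' H' in blast)+
  next
    fix f f' assume "f \<in> wreath A G B H" "f' \<in> wreath A G B H"
    then obtain h g h' g' where f: "f = ?w h g" "h \<in> H" "g \<in> B \<rightarrow> G"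
      and f': "f' = ?w h' g'" "h' \<in> H" "g' \<in> B \<rightarrow> G"
      using ex[of f] ex[of f'] by blast
    have 1: "compose B h h' \<in> H" using H' f f' by blast
    have 2: "(\<lambda>y. compose A (g (h' y)) (g' y)) \<in> B \<rightarrow> G"
    proof
      fix y assume "y \<in> B"
      then have "g (h' y) \<in> G" "g' y \<in> G" using f f' HY by auto
      then show "compose A (g (h' y)) (g' y) \<in> G" using G' by blast
    qed
    show "compose ?S f f' \<in> wreath A G B H"
      unfolding f(1) f'(1) comp[OF f(2,3) f'(2,3)] by (rule mem[OF 1 2])
  next
    fix f assume "f \<in> wreath A G B H"
    then obtain h g where f: "f = ?w h g" "h \<in> H" "g \<in> B \<rightarrow> G" using ex by blast
    show "(\<lambda>x\<in>?S. inv_into ?S f x) \<in> wreath A G B H"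
      unfolding f(1) inv[OF f(2,3)] by (rule mem[OF hiH[OF f(2)] gi'[OF f(2,3)]])
  qed
qed

lemma iterated_wreath_subgroup:
  assumes "p > 0"
  shows "subgroup (iterated_wreath p n) (BijGroup (words p n))"
proof (induction n)
  case 0
  show ?case
    using group.subgroup_self[OF group_BijGroup[of "words p 0"]] by (simp add: BijGroup_def)
next
  case (Suc n)
  then show ?case using wreath_subgroup[OF Suc cyclic_perms_subgroup[OF assms]]
    by (simp add: words_Suc)
qed

lemma group_iterated_wreath_group:
  "p > 0 \<Longrightarrow> group (iterated_wreath_group p n)"
  unfolding iterated_wreath_group_def
  by (rule subgroup.subgroup_is_group[OF iterated_wreath_subgroup group_BijGroup])

lemma iterated_wreath_1:
  "iterated_wreath p 1 = {(\<lambda>w\<in>words p 1. map c w) | c. c \<in> cyclic_perms p}"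
proof -
  have B: "Bij {[]} = {\<lambda>w\<in>{[] :: nat list}. w}"
    by (auto simp: Bij_def extensional_def fun_eq_iff restrict_def bij_betw_def)
  have eq: "(\<lambda>w\<in>cons_set {..<p} {[]}. h (hd w) # g (hd w) (tl w))
      = (\<lambda>w\<in>cons_set {..<p} {[]}. map h w)" if "g \<in> {..<p} \<rightarrow> Bij {[]}"
    for h and g :: "nat \<Rightarrow> nat list \<Rightarrow> nat list"
    using that unfolding B by (auto simp: fun_eq_iff restrict_def cons_set_def Pi_iff)
  have triv: "(\<lambda>_. \<lambda>w\<in>{[]}. w) \<in> {..<p} \<rightarrow> Bij {[] :: nat list}" unfolding B by auto
  have 1: "iterated_wreath p 1 =
      {(\<lambda>w\<in>cons_set {..<p} {[]}. h (hd w) # g (hd w) (tl w)) | h g.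
         h \<in> cyclic_perms p \<and> g \<in> {..<p} \<rightarrow> Bij {[]}}"
    by (simp add: wreath_def words_0)
  have 2: "words p 1 = cons_set {..<p} {[]}"
    using words_Suc[of p 0] by (simp add: words_0)
  show ?thesis
    unfolding 1 2
  proof (intro subset_antisym subsetI)
    fix f assume "f \<in> {(\<lambda>w\<in>cons_set {..<p} {[]}. h (hd w) # g (hd w) (tl w)) | h g.
         h \<in> cyclic_perms p \<and> g \<in> {..<p} \<rightarrow> Bij {[]}}"
    then obtain h g where f: "f = (\<lambda>w\<in>cons_set {..<p} {[]}. h (hd w) # g (hd w) (tl w))"
      "h \<in> cyclic_perms p" "g \<in> {..<p} \<rightarrow> Bij {[]}" by blast
    show "f \<in> {(\<lambda>w\<in>cons_set {..<p} {[]}. map c w) | c. c \<in> cyclic_perms p}"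
      using f(2) unfolding f(1) eq[OF f(3)] by blast
  next
    fix f assume "f \<in> {(\<lambda>w\<in>cons_set {..<p} {[]}. map c w) | c. c \<in> cyclic_perms p}"
    then obtain c where f: "f = (\<lambda>w\<in>cons_set {..<p} {[]}. map c w)" "c \<in> cyclic_perms p"
      by blast
    show "f \<in> {(\<lambda>w\<in>cons_set {..<p} {[]}. h (hd w) # g (hd w) (tl w)) | h g.
         h \<in> cyclic_perms p \<and> g \<in> {..<p} \<rightarrow> Bij {[]}}"
      unfolding f(1) eq[OF triv, symmetric]
      by (intro CollectI exI[of _ c] exI[of _ "\<lambda>_. \<lambda>w\<in>{[]}. w"] conjI refl f(2) triv)
  qed
qed

lemma card_wreath:
  assumes G: "G \<subseteq> Bij A" and H: "H \<subseteq> Bij B" and "finite B" "A \<noteq> {}"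
  shows "card (wreath A G B H) = card H * card G ^ card B"
proof -
  let ?w = "\<lambda>(h, g). \<lambda>w\<in>cons_set B A. h (hd w) # g (hd w) (tl w)"
  have "wreath A G B H = ?w ` (H \<times> (B \<rightarrow>\<^sub>E G))"
  proof (intro subset_antisym subsetI)
    fix f assume "f \<in> wreath A G B H"
    then obtain h g where f: "f = ?w (h, g)" "h \<in> H" "g \<in> B \<rightarrow> G"
      unfolding wreath_def by auto
    have "f = ?w (h, restrict g B)"
      unfolding f by (auto simp: fun_eq_iff restrict_def cons_set_def)
    moreover have "(h, restrict g B) \<in> H \<times> (B \<rightarrow>\<^sub>E G)" using f by auto
    ultimately show "f \<in> ?w ` (H \<times> (B \<rightarrow>\<^sub>E G))" by (rule image_eqI)
  qed (auto simp: wreath_def)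
  moreover have "inj_on ?w (H \<times> (B \<rightarrow>\<^sub>E G))"
  proof (rule inj_onI)
    fix a b assume ab: "a \<in> H \<times> (B \<rightarrow>\<^sub>E G)" "b \<in> H \<times> (B \<rightarrow>\<^sub>E G)" "?w a = ?w b"
    obtain h g h' g' where hg: "a = (h, g)" "b = (h', g')" by (cases a, cases b) blast
    have h: "h \<in> H" "h' \<in> H" and g: "g \<in> B \<rightarrow>\<^sub>E G" "g' \<in> B \<rightarrow>\<^sub>E G"
      using ab(1,2) unfolding hg by auto
    have eq: "?w (h, g) = ?w (h', g')" using ab(3) unfolding hg .
    have *: "h y = h' y \<and> g y x = g' y x" if "y \<in> B" "x \<in> A" for y x
      using fun_cong[OF eq, of "y # x"] that by (auto simp: cons_set_def)
    have "h = h'"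
      by (rule extensionalityI[of _ B]) (use h H * assms(4) in \<open>auto simp: Bij_def\<close>)
    moreover have "g = g'"
    proof (rule extensionalityI[of _ B])
      fix y assume y: "y \<in> B"
      show "g y = g' y"
        by (rule extensionalityI[of _ A]) (use y g G * in \<open>auto simp: Bij_def\<close>)
    qed (use g in \<open>auto simp: PiE_def\<close>)
    ultimately show "a = b" by (simp add: hg)
  qed
  ultimately show ?thesis
    using assms(3) by (simp add: card_image card_cartesian_product card_PiE)
qed

lemma order_iterated_wreath_group:
  assumes "p > 0"
  shows "Coset.order (iterated_wreath_group p n) = p ^ (\<Sum>i<n. p ^ i)"
proof -
  have "card (iterated_wreath p n) = p ^ (\<Sum>i<n. p ^ i)"
  proof (induction n)
    case 0
    have "Bij {[]} = {\<lambda>w\<in>{[] :: nat list}. w}"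
      by (auto simp: Bij_def extensional_def fun_eq_iff restrict_def bij_betw_def)
    then show ?case by (simp add: words_0)
  next
    case (Suc n)
    have ne: "words p n \<noteq> {}" using card_words[of p n] assms by auto
    have "card (iterated_wreath p (Suc n)) = p * (p ^ (\<Sum>i<n. p ^ i)) ^ p"
      using iterated_wreath_subgroup[OF assms, of n] cyclic_perms_subgroup[OF assms] ne
      by (simp add: card_wreath subgroup_BijGroup_iff card_cyclic_perms[OF assms] Suc)
    also have "\<dots> = p ^ (1 + (\<Sum>i<n. p ^ Suc i))"
      by (simp add: power_mult[symmetric] sum_distrib_left mult.commute)
    also have "1 + (\<Sum>i<n. p ^ Suc i) = (\<Sum>i<Suc n. p ^ i)"
      by (subst sum.lessThan_Suc_shift) simp
    finally show ?case .
  qed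
  then show ?thesis by (simp add: Coset.order_def iterated_wreath_group_def)
qed

end

theory Submission
  imports Defs
begin

text \<open>
  Put \<open>\<pi> = 1 - \<zeta>\<close> and \<open>\<psi>(x) = x\<^sup>p + \<pi>\<close>, which is conjugate to \<open>\<phi>\<close> by \<open>x = z - 1\<close>. The \<open>n\<close>-th
  splitting field \<open>L\<^sub>n\<close> over \<open>K = \<rat>(\<zeta>)\<close> is a Kummer tower: \<open>L\<^sub>n\<^sub>+\<^sub>1\<close> arises from \<open>L\<^sub>n\<close> by adjoining
  \<open>p\<close>-th roots of the elements \<open>\<alpha> + \<pi>\<close>, one for each root \<open>1 - \<alpha>\<close> of \<open>\<phi>\<^sup>n\<close>, and their product is the
  critical value \<open>c\<^sub>n = 1 + \<psi>\<^sup>n(\<pi>)\<close>. The Galois group is the full iterated wreath product if these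
  elements are independent modulo \<open>p\<close>-th powers at every level. Let \<open>t\<close> be an automorphism that
  permutes the roots in one cycle. As \<open>t\<close> is unipotent over \<open>\<int> / p\<close>, applying a power of \<open>t - 1\<close> turns
  a nontrivial relation into one with constant exponents; then \<open>c\<^sub>n\<close> is a \<open>p\<close>-th power in \<open>L\<^sub>n\<close>, and by descent
  along the tower \<open>c\<^sub>n\<close> is a product of powers of \<open>c\<^sub>0, \<dots>, c\<^sub>n\<^sub>-\<^sub>1\<close> and a \<open>p\<close>-th power in \<open>K\<close>.
  As \<open>0 \<mapsto> \<pi> \<mapsto> \<pi>\<close> under \<open>\<phi>\<close> and \<open>c\<^sub>n \<equiv> 1\<close> modulo \<open>\<pi>\<close>, the \<open>c\<^sub>i\<close> are pairwise coprime, so \<open>c\<^sub>n\<close> would generate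
  the \<open>p\<close>-th power of an ideal and its norm would be a \<open>p\<close>-th power. But this norm is congruent to
  \<open>2\<^sup>p - 1\<close> modulo \<open>p\<^sup>2\<close>, which is a \<open>p\<close>-th power modulo \<open>p\<^sup>2\<close> only if \<open>p\<close> is a Wieferich prime.
\<close>

text \<open>The cycle \<open>t\<close> at level n exists only once every labelling is realized
  there, and the descent of \<open>p\<close>-th roots from \<open>L\<^sub>n\<^sub>+\<^sub>1\<close>
  to \<open>K\<close> needs \<open>t\<close> at level n + 1. So independence, realization and
  descent form one induction on the level instead of three successive theorems. Unipotence comes
  from the order of \<open>t\<close>, which is \<open>p ^ n\<close>: modulo \<open>p\<close>,
  \<open>(t - 1) ^ (p ^ n)\<close> is \<open>t ^ (p ^ n) - 1 = 0\<close>, and the last nonzero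
  exponent vector before the powers of \<open>t - 1\<close> kill it is fixed by \<open>t\<close>,
  hence constant.

  The number \<open>2 ^ p - 1\<close> is the norm of \<open>2 - \<zeta>\<close>. As
  \<open>\<pi> ^ p\<close> generates the same ideal as \<open>p \<pi>\<close>, all
  \<open>c\<^sub>n\<close> are congruent to \<open>2 - \<zeta>\<close> modulo
  \<open>p \<pi>\<close>, and a rational integer divisible by \<open>p \<pi>\<close> is divisible by
  \<open>p ^ 2\<close>.

  Unique factorization may fail in \<open>\<int>[\<zeta>]\<close>, and no factorization of ideals is
  used. The ideal whose \<open>p\<close>-th power is generated by \<open>c\<^sub>n\<close> is
  represented by products of its generators over all conjugates, and the primes above a rational
  prime \<open>q\<close> other than \<open>p\<close> by the single fact that
  \<open>\<int>[\<zeta>] / q\<close> has no nilpotent elements.\<close>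

section \<open>Integer polynomials\<close>

lemma freshman:
  fixes x y :: "'a :: comm_ring_1"
  assumes "Factorial_Ring.prime (q :: nat)"
  shows "\<exists>s. (x + y) ^ q = x ^ q + y ^ q + of_nat q * s"
proof -
  have q: "q > 1" using assms prime_gt_1_nat by blast
  have "(x + y) ^ q = (\<Sum>k\<le>q. of_nat (q choose k) * x ^ k * y ^ (q - k))"
    by (rule binomial_ring)
  also have "{..q} = insert 0 (insert q {0<..<q})" using q by auto
  also have "(\<Sum>k\<in>\<dots>. of_nat (q choose k) * x ^ k * y ^ (q - k))
      = y ^ q + (x ^ q + (\<Sum>k\<in>{0<..<q}. of_nat (q choose k) * x ^ k * y ^ (q - k)))"
    using q by (subst sum.insert; (subst sum.insert)?) auto
  also have "(\<Sum>k\<in>{0<..<q}. of_nat (q choose k) * x ^ k * y ^ (q - k))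
     = of_nat q * (\<Sum>k\<in>{0<..<q}. of_nat ((q choose k) div q) * x ^ k * y ^ (q - k))"
    unfolding sum_distrib_left
  proof (rule sum.cong[OF refl])
    fix k assume "k \<in> {0<..<q}"
    then have "q dvd (q choose k)" using assms by (intro dvd_choose_prime) auto
    then have "q choose k = q * ((q choose k) div q)" by simp
    then have "(of_nat (q choose k) :: 'a) = of_nat q * of_nat ((q choose k) div q)"
      by (metis of_nat_mult)
    then show "of_nat (q choose k) * x ^ k * y ^ (q - k)
       = of_nat q * (of_nat ((q choose k) div q) * x ^ k * y ^ (q - k))"
      by (simp add: mult.assoc)
  qed
  finally have "(x + y) ^ q = x ^ q + y ^ q
      + of_nat q * (\<Sum>k\<in>{0<..<q}. of_nat ((q choose k) div q) * x ^ k * y ^ (q - k))"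
    by (simp only: add.assoc add.left_commute)
  then show ?thesis ..
qed

lemma fermat_little_int:
  assumes "Factorial_Ring.prime (q :: nat)"
  shows "int q dvd a ^ q - a"
proof -
  have nat: "int q dvd int n ^ q - int n" for n
  proof (induction n)
    case 0 then show ?case using prime_gt_0_nat[OF assms] by (simp add: zero_power)
  next
    case (Suc n)
    obtain s where "(int n + 1) ^ q = int n ^ q + 1 ^ q + of_nat q * s"
      using freshman[OF assms] by blast
    then have "int (Suc n) ^ q - int (Suc n) = (int n ^ q - int n) + int q * s"
      by (simp add: add.commute)
    then show ?case using Suc by (metis dvd_add dvd_triv_left)
  qed
  have "[a ^ q = (a mod int q) ^ q] (mod int q)" by (simp add: cong_def power_mod)
  moreover have "[(a mod int q) ^ q = a mod int q] (mod int q)"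
    using nat[of "nat (a mod int q)"] assms prime_gt_0_nat[OF assms] by (simp add: cong_iff_dvd_diff)
  ultimately have "[a ^ q = a] (mod int q)" by (meson cong_trans cong_mod_right cong_refl)
  then show ?thesis by (simp add: cong_iff_dvd_diff)
qed

text \<open>Modulo a prime \<open>q\<close>, raising to the \<open>q\<close>-th power is a ring
  homomorphism that fixes the constants by Fermat and sends \<open>X\<close> to
  \<open>X ^ q\<close>. This serves twice: for the irreducibility of the cyclotomic polynomial and
  for the Frobenius map on \<open>\<int>[\<zeta>]\<close>.\<close>

lemma pcompose_monom_frobenius:
  fixes f :: "int poly"
  assumes "Factorial_Ring.prime (q :: nat)"
  shows "\<exists>s. pcompose f (monom 1 q) = f ^ q + of_nat q * s"
proof (induction f)
  case 0 then show ?case using prime_gt_0_nat[OF assms] by (auto intro: exI[of _ 0])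
next
  case (pCons a f)
  have X: "monom (1::int) q = [:0, 1:] ^ q" by (simp add: monom_altdef)
  obtain s where s: "pcompose f ([:0, 1:] ^ q) = f ^ q + of_nat q * s" using pCons X by auto
  have eq: "pCons a f = [:a:] + [:0, 1:] * f" by simp
  obtain t where t: "([:a:] + [:0, 1:] * f) ^ q = [:a:] ^ q + ([:0, 1:] * f) ^ q + of_nat q * t"
    using freshman[OF assms] by blast
  obtain w where w: "a ^ q - a = int q * w" using fermat_little_int[OF assms] by (auto elim: dvdE)
  have a: "[:a:] ^ q = [:a:] + of_nat q * [:w:]"
    using w by (simp add: poly_const_pow of_nat_poly algebra_simps)
  have "pcompose (pCons a f) (monom 1 q) = [:a:] + [:0,1:] ^ q * (f ^ q + of_nat q * s)"
    by (simp add: pcompose_pCons s X)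
  also have "\<dots> = (pCons a f) ^ q + of_nat q * ([:0,1:] ^ q * s - [:w:] - t)"
    unfolding eq t a power_mult_distrib by (simp add: algebra_simps)
  finally show ?case by blast
qed

lemma pcompose_diff_dvd:
  fixes f y z :: "'a :: comm_ring_1 poly"
  shows "(y - z) dvd pcompose f y - pcompose f z"
proof (induction f)
  case (pCons a f)
  have "pcompose (pCons a f) y - pcompose (pCons a f) z
      = (y - z) * pcompose f y + z * (pcompose f y - pcompose f z)"
    by (simp add: pcompose_pCons algebra_simps)
  then show ?case using pCons by auto
qed auto

lemma pcompose_1: "pcompose f 1 = [:poly f 1:]"
  by (induction f) (simp_all add: pcompose_pCons one_pCons)

text \<open>Fields are carrier sets inside the complex numbers, so the coefficients have to be
  tracked through the division. With \<open>E = UNIV\<close> it also covers integer polynomials,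
  where monicity of the divisor replaces inverses.\<close>

lemma monic_division:
  fixes f g :: "'a :: comm_ring_1 poly"
  assumes E: "0 \<in> E" "\<And>x y. x \<in> E \<Longrightarrow> y \<in> E \<Longrightarrow> x - y \<in> E" "\<And>x y. x \<in> E \<Longrightarrow> y \<in> E \<Longrightarrow> x * y \<in> E"
    and g: "lead_coeff g = 1" "\<And>i. coeff g i \<in> E" and f: "\<And>i. coeff f i \<in> E"
  shows "\<exists>q r. f = g * q + r \<and> (\<forall>i. coeff q i \<in> E) \<and> (\<forall>i. coeff r i \<in> E)
      \<and> (r = 0 \<or> degree r < degree g)"
  using f
proof (induction "degree f" arbitrary: f rule: less_induct)
  case less
  have Eadd: "x + y \<in> E" if "x \<in> E" "y \<in> E" for x y
    using E(2)[OF that(1) E(2)[OF E(1) that(2)]] by simp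
  show ?case
  proof (cases "f = 0 \<or> degree f < degree g")
    case True
    then show ?thesis using less.prems E(1) by (intro exI[of _ 0] exI[of _ f]) auto
  next
    case False
    define m where "m = monom (lead_coeff f) (degree f - degree g)"
    have mE: "coeff m i \<in> E" for i using less.prems E(1) by (simp add: m_def)
    define f' where "f' = f - g * m"
    have gm: "coeff (g * m) i = (if i < degree f - degree g then 0
        else coeff g (i - (degree f - degree g)) * lead_coeff f)" for i
      using coeff_monom_mult[of "lead_coeff f" "degree f - degree g" g i]
      unfolding m_def by (simp add: mult.commute)
    have f'E: "coeff f' i \<in> E" for i
      unfolding f'_def using gm less.prems g E by auto
    have "coeff f' i = 0" if "i \<ge> degree f" for i
    proof (cases "i = degree f")
      case True
      then show ?thesis using gm[of i] False g(1) by (simp add: f'_def)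
    next
      case i: False
      then have "coeff f i = 0" using that by (simp add: coeff_eq_0)
      moreover have "coeff g (i - (degree f - degree g)) = 0"
        using i that False by (intro coeff_eq_0) auto
      ultimately show ?thesis using gm[of i] by (simp add: f'_def)
    qed
    then have deg: "f' = 0 \<or> degree f' < degree f"
      by (metis leading_coeff_0_iff not_less)
    have "\<exists>q r. f' = g * q + r \<and> (\<forall>i. coeff q i \<in> E) \<and> (\<forall>i. coeff r i \<in> E)
      \<and> (r = 0 \<or> degree r < degree g)"
    proof (cases "f' = 0")
      case True then show ?thesis using E(1) by (intro exI[of _ 0]) auto
    next
      case f'0: False then show ?thesis using less.hyps[of f'] deg f'E by auto
    qed
    then obtain q r where qr: "f' = g * q + r" "\<forall>i. coeff q i \<in> E" "\<forall>i. coeff r i \<in> E"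
      "r = 0 \<or> degree r < degree g" by blast
    have "f = g * (q + m) + r" using qr(1) by (simp add: f'_def algebra_simps)
    moreover have "\<forall>i. coeff (q + m) i \<in> E" using qr(2) mE Eadd by auto
    ultimately show ?thesis using qr(3,4) by blast
  qed
qed

text \<open>Degrees add over the field with \<open>q\<close> elements, so a polynomial of positive
  degree is not a unit there. The argument compares one coefficient instead of passing to a quotient
  ring; \<open>k\<close> is the degree of \<open>t\<close> modulo \<open>q\<close>.\<close>

lemma not_unit_mod_prime_poly:
  fixes g t s :: "int poly"
  assumes q: "Factorial_Ring.prime (q :: int)" and eq: "1 = g * t + smult q s"
    and lc: "\<not> q dvd lead_coeff g" and deg: "degree g > 0"
  shows False
proof -
  have ex: "\<exists>i. \<not> q dvd coeff t i"
  proof (rule ccontr)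
    assume "\<nexists>i. \<not> q dvd coeff t i"
    then have "q dvd coeff (g * t + smult q s) 0" by (simp add: coeff_mult)
    then have "q dvd 1" unfolding eq[symmetric] by simp
    then show False using q by auto
  qed
  define k where "k = (GREATEST i. \<not> q dvd coeff t i)"
  have bound: "i \<le> degree t" if "\<not> q dvd coeff t i" for i
    using that by (metis coeff_eq_0 dvd_0_right not_less)
  have k: "\<not> q dvd coeff t k"
    unfolding k_def using ex bound by (metis (mono_tags, lifting) GreatestI_nat)
  have gr: "q dvd coeff t i" if "i > k" for i
    using Greatest_le_nat[of "\<lambda>i. \<not> q dvd coeff t i" i "degree t"] bound that
    unfolding k_def by (meson not_less)
  let ?d = "degree g"
  have "coeff (g * t) (?d + k) = (\<Sum>i\<le>?d + k. coeff g i * coeff t (?d + k - i))"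
    by (simp add: coeff_mult)
  also have "\<dots> = coeff g ?d * coeff t k
      + (\<Sum>i\<in>{..?d + k} - {?d}. coeff g i * coeff t (?d + k - i))"
    by (subst sum.remove[of _ ?d]) auto
  finally have 1: "coeff (g * t) (?d + k) = \<dots>" .
  have 2: "q dvd (\<Sum>i\<in>{..?d + k} - {?d}. coeff g i * coeff t (?d + k - i))"
  proof (rule dvd_sum)
    fix i assume "i \<in> {..?d + k} - {?d}"
    then consider "i < ?d" | "i > ?d" by fastforce
    then show "q dvd coeff g i * coeff t (?d + k - i)"
      by cases (auto intro!: dvd_mult gr simp: coeff_eq_0)
  qed
  have "coeff (g * t + smult q s) (?d + k) = 0" unfolding eq[symmetric] using deg by simp
  then have "coeff (g * t) (?d + k) = - (q * coeff s (?d + k))" by simp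
  then have "q dvd coeff (g * t) (?d + k)" by simp
  then have "q dvd coeff g ?d * coeff t k" using 1 2 by (simp add: dvd_add_left_iff)
  then show False using q lc k by (simp add: prime_dvd_mult_iff)
qed

section \<open>Evaluation of integer polynomials at complex numbers\<close>

definition ev :: "int poly \<Rightarrow> complex \<Rightarrow> complex" where
  "ev f z = poly (map_poly of_int f) z"

lemma ev_pCons [simp]: "ev (pCons a f) z = of_int a + z * ev f z"
  by (simp add: ev_def map_poly_pCons)

lemma ev_0 [simp]: "ev 0 z = 0"
  by (simp add: ev_def)

lemma ev_1 [simp]: "ev 1 z = 1"
  by (simp add: one_pCons)

lemma ev_add [simp]: "ev (f + g) z = ev f z + ev g z"
  by (induction f g rule: poly_induct2) (simp_all add: algebra_simps)

lemma ev_uminus [simp]: "ev (- f) z = - ev f z"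
  by (induction f) (simp_all add: algebra_simps)

lemma ev_diff [simp]: "ev (f - g) z = ev f z - ev g z"
  using ev_add[of f "- g" z] by simp

lemma ev_smult [simp]: "ev (smult a f) z = of_int a * ev f z"
  by (induction f) (simp_all add: algebra_simps)

lemma ev_mult [simp]: "ev (f * g) z = ev f z * ev g z"
  by (induction f) (simp_all add: algebra_simps)

lemma ev_of_int [simp]: "ev (of_int n) z = of_int n"
  by (simp add: of_int_poly)

lemma ev_of_nat [simp]: "ev (of_nat n) z = of_nat n"
  by (simp add: of_nat_poly)

lemma ev_numeral [simp]: "ev (numeral n) z = numeral n"
  using ev_of_nat[of "numeral n" z] by simp

lemma ev_power [simp]: "ev (f ^ n) z = ev f z ^ n"
  by (induction n) simp_all

lemma ev_sum [simp]: "ev (sum f A) z = (\<Sum>i\<in>A. ev (f i) z)"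
  by (induction A rule: infinite_finite_induct) simp_all

lemma ev_prod [simp]: "ev (prod f A) z = (\<Prod>i\<in>A. ev (f i) z)"
  by (induction A rule: infinite_finite_induct) simp_all

lemma ev_monom [simp]: "ev (monom a n) z = of_int a * z ^ n"
  by (simp add: monom_altdef)

lemma ev_pcompose [simp]: "ev (pcompose f g) z = ev f (ev g z)"
  by (induction f) (simp_all add: pcompose_pCons)

section \<open>The ring of integers of a prime cyclotomic field\<close>

locale cyclotomic =
  fixes p :: nat and \<zeta> :: complex
  assumes prime_p: "Factorial_Ring.prime p" and odd_p: "odd p"
    and primitive: "primitive_root_of_unity p \<zeta>"
begin

lemma p_gt_1: "p > 1" using prime_gt_1_nat[OF prime_p] .

lemma zeta_power_p [simp]: "\<zeta> ^ p = 1"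
  using primitive by (simp add: primitive_root_of_unity_def)

lemma zeta_nz [simp]: "\<zeta> \<noteq> 0"
  using zeta_power_p p_gt_1 by (metis not_gr_zero not_one_less_zero zero_neq_one zero_power)

lemma zeta_power_mod: "\<zeta> ^ (i mod p) = \<zeta> ^ i"
proof -
  have "\<zeta> ^ i = \<zeta> ^ (p * (i div p) + i mod p)" by simp
  also have "\<dots> = \<zeta> ^ (i mod p)" by (simp only: power_add power_mult) simp
  finally show ?thesis ..
qed

lemma zeta_power_eq_1_iff: "\<zeta> ^ i = 1 \<longleftrightarrow> p dvd i"
proof
  assume "\<zeta> ^ i = 1"
  then have "\<zeta> ^ (i mod p) = 1" by (simp add: zeta_power_mod)
  then show "p dvd i"
    using primitive p_gt_1 by (metis dvd_eq_mod_eq_0 gr0I mod_less_divisor primitive_root_of_unity_def)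
next
  assume "p dvd i" then show "\<zeta> ^ i = 1" by (auto elim!: dvdE simp: power_mult)
qed

lemma zeta_power_inj: "inj_on (\<lambda>i. \<zeta> ^ i) {..<p}"
proof -
  have "i = j" if "i \<le> j" "j < p" "\<zeta> ^ i = \<zeta> ^ j" for i j
  proof -
    have "\<zeta> ^ j = \<zeta> ^ i * \<zeta> ^ (j - i)" using that(1) by (metis le_add_diff_inverse power_add)
    then have "\<zeta> ^ (j - i) = 1" using that by simp
    then have "p dvd j - i" by (simp add: zeta_power_eq_1_iff)
    then show ?thesis using that by (metis dvd_imp_le diff_le_self le_antisym le_trans not_less zero_less_diff)
  qed
  then show ?thesis by (intro inj_onI) (metis lessThan_iff linear)
qed

lemma prod_zeta_poly: "(\<Prod>j<p. [:- (\<zeta> ^ j), 1:]) = monom 1 p - 1"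
proof (rule poly_eqI_degree_lead_coeff[where n = p and A = "(\<lambda>i. \<zeta> ^ i) ` {..<p}"])
  have deg: "degree (\<Prod>j<p. [:- (\<zeta> ^ j), 1:]) = p"
    by (subst degree_prod_eq_sum_degree) auto
  have "lead_coeff (\<Prod>j<p. [:- (\<zeta> ^ j), 1:]) = 1"
    by (simp add: lead_coeff_prod)
  then show "coeff (\<Prod>j<p. [:- (\<zeta> ^ j), 1:]) p = coeff (monom 1 p - 1) p"
    using deg p_gt_1 by (simp add: one_pCons coeff_pCons split: nat.split)
  show "degree (\<Prod>j<p. [:- (\<zeta> ^ j), 1:]) \<le> p" using deg by simp
  show "degree (monom (1::complex) p - 1) \<le> p"
    by (rule degree_diff_le) (auto simp: degree_monom_le)
  show "card ((\<lambda>i. \<zeta> ^ i) ` {..<p}) \<ge> p"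
    using card_image[OF zeta_power_inj] by simp
next
  fix z assume "z \<in> (\<lambda>i. \<zeta> ^ i) ` {..<p}"
  then obtain i where "i < p" "z = \<zeta> ^ i" by auto
  moreover have "(\<zeta> ^ i) ^ p = 1" by (metis mult.commute power_mult power_one zeta_power_p)
  ultimately show "poly (\<Prod>j<p. [:- (\<zeta> ^ j), 1:]) z = poly (monom 1 p - 1) z"
    by (auto simp: poly_prod poly_monom prod_zero_iff)
qed

lemma prod_diff_zeta: "(\<Prod>j<p. x - \<zeta> ^ j * y) = x ^ p - y ^ p"
proof (cases "y = 0")
  case True then show ?thesis using p_gt_1 by (simp add: zero_power)
next
  case False
  have "(\<Prod>j<p. x - \<zeta> ^ j * y) = (\<Prod>j<p. y * (x / y - \<zeta> ^ j))"
    using False by (simp add: field_simps)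
  also have "\<dots> = y ^ p * poly (\<Prod>j<p. [:- (\<zeta> ^ j), 1:]) (x / y)"
    by (simp add: prod.distrib poly_prod)
  also have "\<dots> = x ^ p - y ^ p"
    unfolding prod_zeta_poly using False by (simp add: poly_monom power_divide field_simps)
  finally show ?thesis .
qed

lemma prod_add_zeta: "(\<Prod>j<p. x + y * \<zeta> ^ j) = x ^ p + y ^ p"
  using prod_diff_zeta[of x "- y"] odd_p by (simp add: power_minus_odd mult.commute)

text \<open>Mainly used where an embedding is known on \<open>p\<close>-th powers only: the image of
  the root is then fixed up to a power of \<open>\<zeta>\<close>.\<close>

lemma eq_zeta_mult:
  assumes "x ^ p = y ^ p"
  shows "\<exists>i<p. x = \<zeta> ^ i * y"
proof -
  have "(\<Prod>j<p. x - \<zeta> ^ j * y) = 0" using assms by (simp add: prod_diff_zeta)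
  then show ?thesis by auto
qed

lemma prod_conj_diff: "(\<Prod>j\<in>{1..<p}. x - \<zeta> ^ j) = (\<Sum>i<p. x ^ i)"
proof -
  have "[:-1, 1:] * (\<Prod>j\<in>{1..<p}. [:- (\<zeta> ^ j), 1:]) = (\<Prod>j<p. [:- (\<zeta> ^ j), 1:])"
  proof -
    have "{..<p} = insert 0 {1..<p}" using p_gt_1 by auto
    then show ?thesis by simp
  qed
  also have "\<dots> = [:-1, 1:] * (\<Sum>i<p. [:0, 1:] ^ i)"
    unfolding prod_zeta_poly using power_diff_1_eq[of "[:0, 1:] :: complex poly" p]
    by (simp add: monom_altdef one_pCons)
  finally have "(\<Prod>j\<in>{1..<p}. [:- (\<zeta> ^ j), 1:]) = (\<Sum>i<p. [:0, 1:] ^ i)"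
    by (subst (asm) mult_cancel_left) auto
  then have "poly (\<Prod>j\<in>{1..<p}. [:- (\<zeta> ^ j), 1:]) x = poly (\<Sum>i<p. [:0, 1:] ^ i) x" by simp
  then show ?thesis by (simp add: poly_prod poly_sum)
qed

section \<open>Irreducibility of the cyclotomic polynomial\<close>

definition cyc :: "int poly" where "cyc = (\<Sum>i<p. monom 1 i)"

lemma ev_cyc: "ev cyc z = (\<Sum>i<p. z ^ i)"
  by (simp add: cyc_def)

lemma ev_cyc_zeta: "\<not> p dvd j \<Longrightarrow> ev cyc (\<zeta> ^ j) = 0"
proof -
  assume j: "\<not> p dvd j"
  have "(\<zeta> ^ j) ^ p - 1 = (\<zeta> ^ j - 1) * (\<Sum>i<p. (\<zeta> ^ j) ^ i)" by (rule power_diff_1_eq)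
  moreover have "(\<zeta> ^ j) ^ p = 1" by (metis mult.commute power_mult power_one zeta_power_p)
  moreover have "\<zeta> ^ j \<noteq> 1" using j by (simp add: zeta_power_eq_1_iff)
  ultimately show ?thesis by (simp add: ev_cyc)
qed

lemma coeff_cyc: "coeff cyc i = (if i < p then 1 else 0)"
  by (simp add: cyc_def coeff_sum)

lemma degree_cyc: "degree cyc = p - 1"
proof (rule antisym)
  show "degree cyc \<le> p - 1" by (rule degree_le) (auto simp: coeff_cyc)
  show "p - 1 \<le> degree cyc" using p_gt_1 by (intro le_degree) (auto simp: coeff_cyc)
qed

lemma lead_coeff_cyc: "lead_coeff cyc = 1"
  using p_gt_1 by (simp add: degree_cyc coeff_cyc)

lemma poly_cyc_1: "poly cyc 1 = int p"
  by (simp add: cyc_def poly_sum poly_monom)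

text \<open>The factor \<open>g\<close> divides \<open>X ^ p - 1\<close>, hence
  \<open>g(X ^ p) - g(1)\<close>, and modulo \<open>p\<close> it also divides
  \<open>g(X ^ p)\<close>, which is congruent to \<open>g ^ p\<close>. So modulo \<open>p\<close> it
  divides the constant \<open>g(1)\<close>; if this were \<open>1\<close> or \<open>-1\<close>,
  \<open>g\<close> would be a unit modulo \<open>p\<close>.\<close>

lemma cyc_factor_not_unit_at_1:
  assumes gh: "cyc = g * h" and deg: "degree g > 0"
  shows "\<bar>poly g 1\<bar> \<noteq> 1"
proof
  assume g1: "\<bar>poly g 1\<bar> = 1"
  obtain s where s: "pcompose g (monom 1 p) = g ^ p + of_nat p * s"
    using pcompose_monom_frobenius[OF prime_p] by blast
  have "monom 1 p - 1 = [:-1, 1:] * cyc"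
    using power_diff_1_eq[of "[:0, 1:] :: int poly" p]
    by (simp add: monom_altdef one_pCons cyc_def)
  then have "g dvd monom 1 p - 1" using gh by (metis dvd_mult dvd_triv_left)
  then have "g dvd pcompose g (monom 1 p) - [:poly g 1:]"
    using pcompose_diff_dvd[of "monom 1 p" 1 g] by (metis dvd_trans pcompose_1)
  moreover have "g dvd g ^ p" using p_gt_1 by (simp add: dvd_power)
  ultimately have "g dvd pcompose g (monom 1 p) - [:poly g 1:] - g ^ p" by (rule dvd_diff)
  then have "g dvd of_nat p * s - [:poly g 1:]" unfolding s by (simp add: algebra_simps)
  then obtain t where t: "of_nat p * s - [:poly g 1:] = g * t" by (elim dvdE)
  have "[:poly g 1:] = of_nat p * s - g * t" unfolding t[symmetric] by simp
  moreover have "[:poly g 1:] * [:poly g 1:] = 1"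
    using g1 by (auto simp: abs_if one_pCons split: if_splits)
  ultimately have "1 = (of_nat p * s - g * t) * [:poly g 1:]" by metis
  also have "\<dots> = g * (- t * [:poly g 1:]) + smult (int p) (s * [:poly g 1:])"
    by (simp add: of_nat_poly algebra_simps smult_diff_right)
  finally have eq: "1 = \<dots>" .
  have "lead_coeff g * lead_coeff h = 1"
    using lead_coeff_cyc unfolding gh lead_coeff_mult .
  then have "\<not> int p dvd lead_coeff g" using p_gt_1
    by (metis dvd_mult2 int_one_le_iff_zero_less nat_dvd_1_iff_1 of_nat_1 int_dvd_int_iff less_irrefl)
  then show False using not_unit_mod_prime_poly[OF _ eq _ deg] prime_p by simp
qed

text \<open>This is the irreducibility of \<open>cyc\<close>. A relation of smaller degree yields a
  proper factor by Gauss's lemma, and as \<open>cyc\<close> has the prime value \<open>p\<close> at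
  \<open>1\<close>, one of the two factors would have the value \<open>1\<close> or
  \<open>-1\<close> there.\<close>

lemma ev_zeta_eq_0_imp:
  assumes "ev f \<zeta> = 0" and "degree f < p - 1"
  shows "f = 0"
proof (rule ccontr)
  assume f: "f \<noteq> 0"
  define P where "P = (\<lambda>d. \<exists>g. g \<noteq> 0 \<and> ev g \<zeta> = 0 \<and> degree g = d)"
  define d where "d = (LEAST d. P d)"
  have "P (degree f)" using f assms by (auto simp: P_def)
  then have Pd: "P d" and dle: "d \<le> degree f" unfolding d_def by (auto intro: LeastI Least_le)
  have min: "d \<le> degree g" if "g \<noteq> 0" "ev g \<zeta> = 0" for g
    unfolding d_def by (rule Least_le) (use that in \<open>auto simp: P_def\<close>)
  obtain g0 where g0: "g0 \<noteq> 0" "ev g0 \<zeta> = 0" "degree g0 = d" using Pd by (auto simp: P_def)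
  define g where "g = primitive_part g0"
  have "g0 = smult (content g0) g" by (simp add: g_def)
  then have "of_int (content g0) * ev g \<zeta> = 0" using g0(2) by (metis ev_smult)
  then have g: "ev g \<zeta> = 0" "g \<noteq> 0" "degree g = d" "content g = 1"
    using g0 by (auto simp: g_def content_primitive_part)
  obtain a q where aq: "a \<noteq> 0" "smult a cyc = g * q + pseudo_mod cyc g"
    using pseudo_mod(1)[OF g(2)] by blast
  have "ev (smult a cyc) \<zeta> = 0" using ev_cyc_zeta[of 1] p_gt_1 by simp
  then have "ev (pseudo_mod cyc g) \<zeta> = 0" using g(1) unfolding aq(2) by simp
  then have "pseudo_mod cyc g = 0" using pseudo_mod(2)[OF g(2), of cyc] min g(3) by fastforce
  then have "g dvd smult a cyc" using aq(2) by simp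
  then have "fract_poly g dvd fract_poly (smult a cyc)" by (rule fract_poly_dvd)
  then have "fract_poly g dvd fract_poly cyc"
    using aq(1) by (simp add: dvd_smult_iff)
  then have "g dvd cyc" using g(4) by (rule fract_poly_dvdD)
  then obtain h where gh: "cyc = g * h" by (elim dvdE)
  have degg: "degree g > 0"
  proof (rule ccontr)
    assume "\<not> degree g > 0"
    then obtain c where "g = [:c:]" by (metis degree_eq_zeroE gr0I)
    then show False using g(1,2) by simp
  qed
  have h0: "h \<noteq> 0" using gh lead_coeff_cyc by auto
  have "degree cyc = degree g + degree h" unfolding gh by (rule degree_mult_eq[OF g(2) h0])
  then have degh: "degree h > 0" using degree_cyc dle assms(2) g(3) by linarith
  have "\<bar>poly g 1\<bar> * \<bar>poly h 1\<bar> = int p"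
    using poly_cyc_1 unfolding gh by (simp flip: abs_mult)
  then have "nat \<bar>poly g 1\<bar> * nat \<bar>poly h 1\<bar> = p"
    by (metis nat_int nat_mult_distrib abs_ge_zero)
  then have "nat \<bar>poly g 1\<bar> = 1 \<or> nat \<bar>poly h 1\<bar> = 1"
    using prime_p by (metis prime_product)
  then show False
    using cyc_factor_not_unit_at_1[OF gh degg] cyc_factor_not_unit_at_1[of h g] gh degh
    by (auto simp: mult.commute)
qed

lemma cyc_dvd:
  assumes "ev f \<zeta> = 0"
  shows "cyc dvd f"
proof -
  obtain q r where qr: "f = cyc * q + r" "r = 0 \<or> degree r < degree cyc"
    using monic_division[of UNIV cyc f] lead_coeff_cyc by auto
  have "ev r \<zeta> = 0" using assms ev_cyc_zeta[of 1] p_gt_1 unfolding qr(1) by simp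
  then have "r = 0" using qr(2) ev_zeta_eq_0_imp degree_cyc by metis
  then show ?thesis using qr(1) by simp
qed

text \<open>The conjugation \<open>\<zeta> \<mapsto> \<zeta> ^ j\<close> is well defined on
  \<open>\<int>[\<zeta>]\<close>. It is never made a map: identities are written with
  \<open>ev\<close> at \<open>\<zeta>\<close> and transported by this lemma.\<close>

lemma ev_conj_eq:
  assumes "ev f \<zeta> = ev g \<zeta>" "\<not> p dvd j"
  shows "ev f (\<zeta> ^ j) = ev g (\<zeta> ^ j)"
proof -
  have "cyc dvd f - g" using assms by (intro cyc_dvd) simp
  then obtain h where "f - g = cyc * h" by (elim dvdE)
  then have "ev (f - g) (\<zeta> ^ j) = ev (cyc * h) (\<zeta> ^ j)" by simp
  then show ?thesis using ev_cyc_zeta[OF assms(2)] by simp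
qed

section \<open>The ring of integers as a set, and congruences in it\<close>

definition zring :: "complex set" where "zring = range (\<lambda>f. ev f \<zeta>)"

lemma ev_in_zring [intro, simp]: "ev f \<zeta> \<in> zring" by (simp add: zring_def)

lemma ev_conj_in_zring [intro, simp]: "ev f (\<zeta> ^ j) \<in> zring"
  using ev_in_zring[of "pcompose f (monom 1 j)"] by simp

lemma zringE: assumes "x \<in> zring" obtains f where "x = ev f \<zeta>"
  using assms by (auto simp: zring_def)

lemma zring_of_int [intro, simp]: "of_int n \<in> zring"
  using ev_in_zring[of "of_int n"] by simp

lemma zring_of_nat [intro, simp]: "of_nat n \<in> zring"
  using ev_in_zring[of "of_nat n"] by simp

lemma zring_0 [intro, simp]: "0 \<in> zring" using zring_of_int[of 0] by simp
lemma zring_1 [intro, simp]: "1 \<in> zring" using zring_of_int[of 1] by simp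

lemma zring_zeta [intro, simp]: "\<zeta> \<in> zring"
  using ev_in_zring[of "monom 1 1"] by (simp del: ev_in_zring)

lemma zring_add [intro, simp]: "x \<in> zring \<Longrightarrow> y \<in> zring \<Longrightarrow> x + y \<in> zring"
  by (elim zringE) (simp flip: ev_add)

lemma zring_uminus [intro, simp]: "x \<in> zring \<Longrightarrow> - x \<in> zring"
  by (elim zringE) (simp flip: ev_uminus)

lemma zring_diff [intro, simp]: "x \<in> zring \<Longrightarrow> y \<in> zring \<Longrightarrow> x - y \<in> zring"
  by (elim zringE) (simp flip: ev_diff)

lemma zring_mult [intro, simp]: "x \<in> zring \<Longrightarrow> y \<in> zring \<Longrightarrow> x * y \<in> zring"
  by (elim zringE) (simp flip: ev_mult)

lemma zring_power [intro, simp]: "x \<in> zring \<Longrightarrow> x ^ n \<in> zring"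
  by (induction n) auto

lemma zring_sum [intro]: "(\<And>i. i \<in> A \<Longrightarrow> f i \<in> zring) \<Longrightarrow> sum f A \<in> zring"
  by (induction A rule: infinite_finite_induct) auto

lemma zring_prod [intro]: "(\<And>i. i \<in> A \<Longrightarrow> f i \<in> zring) \<Longrightarrow> prod f A \<in> zring"
  by (induction A rule: infinite_finite_induct) auto

text \<open>Congruence modulo the principal ideal of \<open>m\<close> in
  \<open>\<int>[\<zeta>]\<close>. Membership of \<open>x\<close> and \<open>y\<close> in
  \<open>zring\<close> is not part of the relation, hence the side conditions of the product
  rules.\<close>

definition ocong :: "complex \<Rightarrow> complex \<Rightarrow> complex \<Rightarrow> bool" where
  "ocong m x y \<longleftrightarrow> (\<exists>z\<in>zring. x - y = m * z)"

lemma ocong_refl [simp]: "ocong m x x"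
  unfolding ocong_def by (intro bexI[of _ 0]) auto

lemma ocong_sym: "ocong m x y \<Longrightarrow> ocong m y x"
  unfolding ocong_def by (elim bexE, rule_tac x = "- z" in bexI) (auto simp: algebra_simps)

lemma ocong_trans: "ocong m x y \<Longrightarrow> ocong m y z \<Longrightarrow> ocong m x z"
  unfolding ocong_def by (elim bexE, rename_tac u v, rule_tac x = "u + v" in bexI) (auto simp: algebra_simps)

lemma ocong_add: "ocong m x y \<Longrightarrow> ocong m x' y' \<Longrightarrow> ocong m (x + x') (y + y')"
  unfolding ocong_def by (elim bexE, rule_tac x = "z + za" in bexI) (auto simp: algebra_simps)

lemma ocong_mult:
  assumes "ocong m x y" "ocong m x' y'" "x' \<in> zring" "y \<in> zring"
  shows "ocong m (x * x') (y * y')"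
proof -
  obtain z z' where z: "z \<in> zring" "x - y = m * z" "z' \<in> zring" "x' - y' = m * z'"
    using assms unfolding ocong_def by auto
  have "x * x' - y * y' = (x - y) * x' + y * (x' - y')" by (simp add: algebra_simps)
  also have "\<dots> = m * (z * x' + y * z')" unfolding z by (simp add: algebra_simps)
  finally show ?thesis using z assms unfolding ocong_def by (intro bexI[of _ "z * x' + y * z'"]) auto
qed

lemma ocong_power:
  assumes "ocong m x y" "x \<in> zring" "y \<in> zring"
  shows "ocong m (x ^ n) (y ^ n)"
  by (induction n) (use assms in \<open>auto intro!: ocong_mult\<close>)

lemma ocong_prod:
  assumes "\<And>i. i \<in> A \<Longrightarrow> ocong m (f i) (g i)" "\<And>i. i \<in> A \<Longrightarrow> f i \<in> zring"
    "\<And>i. i \<in> A \<Longrightarrow> g i \<in> zring"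
  shows "ocong m (prod f A) (prod g A)"
  using assms by (induction A rule: infinite_finite_induct) (auto intro!: ocong_mult)

lemma ocong_sum:
  assumes "\<And>i. i \<in> A \<Longrightarrow> ocong m (f i) (g i)"
  shows "ocong m (sum f A) (sum g A)"
  using assms by (induction A rule: infinite_finite_induct) (auto intro!: ocong_add)

lemma ocong_mult_0: "ocong m x 0 \<Longrightarrow> y \<in> zring \<Longrightarrow> ocong m (x * y) 0"
  unfolding ocong_def by (elim bexE, rule_tac x = "z * y" in bexI) auto

section \<open>Norms and the Frobenius map\<close>

lemma not_p_dvd: "j \<in> {1..<p} \<Longrightarrow> \<not> p dvd j"
  by (auto dest: dvd_imp_le)

text \<open>The polynomial \<open>F\<close> takes the value \<open>N\<close> at every
  \<open>\<zeta> ^ i\<close>, because multiplication by \<open>i\<close> permutes the nonzero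
  residues modulo \<open>p\<close>. Its remainder modulo \<open>cyc\<close> has degree below
  \<open>p - 1\<close> and agrees with a constant at \<open>p - 1\<close> points, so
  \<open>N\<close> is a coefficient of an integer polynomial.\<close>

lemma prod_conj_int:
  "\<exists>m. of_int m = (\<Prod>j\<in>{1..<p}. ev f (\<zeta> ^ j))"
proof -
  define N where "N = (\<Prod>j\<in>{1..<p}. ev f (\<zeta> ^ j))"
  define F where "F = (\<Prod>j\<in>{1..<p}. pcompose f (monom 1 j))"
  have evF: "ev F (\<zeta> ^ i) = N" if i: "i \<in> {1..<p}" for i
  proof -
    let ?h = "\<lambda>j. (i * j) mod p"
    have cop: "coprime i p" using i prime_p
      by (metis atLeastLessThan_iff coprime_commute not_p_dvd prime_imp_coprime)
    have inj: "inj_on ?h {1..<p}"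
    proof (rule inj_onI)
      fix x y assume xy: "x \<in> {1..<p}" "y \<in> {1..<p}" "?h x = ?h y"
      then have "[i * x = i * y] (mod p)" by (simp add: cong_def)
      then have "[x = y] (mod p)" using cop by (simp add: cong_mult_lcancel_nat)
      then show "x = y" using xy by (simp add: cong_def)
    qed
    have sub: "?h ` {1..<p} \<subseteq> {1..<p}"
    proof
      fix y assume "y \<in> ?h ` {1..<p}"
      then obtain x where x: "x \<in> {1..<p}" "y = ?h x" by auto
      have "\<not> p dvd i * x" using i x(1) not_p_dvd prime_p by (simp add: prime_dvd_mult_iff)
      then show "y \<in> {1..<p}" using x(2) p_gt_1 by (auto simp: dvd_eq_mod_eq_0)
    qed
    have bij: "?h ` {1..<p} = {1..<p}"
      using endo_inj_surj[OF _ sub inj] by simp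
    have "ev F (\<zeta> ^ i) = (\<Prod>j\<in>{1..<p}. ev f (\<zeta> ^ ?h j))"
      by (simp add: F_def zeta_power_mod power_mult)
    also have "\<dots> = N"
      unfolding N_def by (subst bij[symmetric], subst prod.reindex[OF inj]) simp
    finally show ?thesis .
  qed
  obtain q r where qr: "F = cyc * q + r" "r = 0 \<or> degree r < degree cyc"
    using monic_division[of UNIV cyc F] lead_coeff_cyc by auto
  have evr: "ev r (\<zeta> ^ i) = N" if i: "i \<in> {1..<p}" for i
    using evF[OF i] ev_cyc_zeta[OF not_p_dvd[OF i]] unfolding qr(1) by simp
  have degr: "degree r < p - 1" using qr(2) degree_cyc p_gt_1 by auto
  have "map_poly of_int r = [:N:]"
  proof (rule poly_eqI_degree[where A = "(\<lambda>i. \<zeta> ^ i) ` {1..<p}"])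
    have "inj_on (\<lambda>i. \<zeta> ^ i) {1..<p}" by (rule inj_on_subset[OF zeta_power_inj]) auto
    then have card: "card ((\<lambda>i. \<zeta> ^ i) ` {1..<p}) = p - 1" by (simp add: card_image)
    have "degree (map_poly of_int r :: complex poly) \<le> degree r" by (intro degree_le) (simp add: coeff_map_poly coeff_eq_0)
    then show "degree (map_poly of_int r :: complex poly) < card ((\<lambda>i. \<zeta> ^ i) ` {1..<p})"
      unfolding card using degr by linarith
    show "degree [:N:] < card ((\<lambda>i. \<zeta> ^ i) ` {1..<p})" unfolding card using p_gt_1 by simp
  next
    fix x assume "x \<in> (\<lambda>i. \<zeta> ^ i) ` {1..<p}"
    then show "poly (map_poly of_int r) x = poly [:N:] x" using evr by (auto simp: ev_def)
  qed
  then have "coeff (map_poly of_int r) 0 = N" by simp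
  then have "of_int (coeff r 0) = N" by (simp add: coeff_map_poly)
  then show ?thesis unfolding N_def by blast
qed

definition cnorm :: "int poly \<Rightarrow> int" where
  "cnorm f = (SOME m. of_int m = (\<Prod>j\<in>{1..<p}. ev f (\<zeta> ^ j)))"

lemma of_int_cnorm: "of_int (cnorm f) = (\<Prod>j\<in>{1..<p}. ev f (\<zeta> ^ j))"
  unfolding cnorm_def by (rule someI_ex[OF prod_conj_int])

text \<open>Taking norms gives \<open>n ^ (p - 1) = q ^ (p - 1) * cnorm f\<close>. This is how a
  divisibility in \<open>\<int>[\<zeta>]\<close> returns to the integers.\<close>

lemma of_int_eq_mult_imp_dvd:
  assumes "of_int n = of_int q * x" "x \<in> zring"
  shows "q dvd n"
proof -
  obtain f where f: "x = ev f \<zeta>" using assms(2) by (elim zringE)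
  have "ev (of_int n) \<zeta> = ev (of_int q * f) \<zeta>" using assms(1) f by simp
  then have *: "of_int n = of_int q * ev f (\<zeta> ^ j)" if "j \<in> {1..<p}" for j
    using ev_conj_eq[of "of_int n" "of_int q * f" j] not_p_dvd[OF that] by simp
  have "(of_int n :: complex) ^ (p - 1) = (\<Prod>j\<in>{1..<p}. of_int n)" by simp
  also have "\<dots> = (\<Prod>j\<in>{1..<p}. of_int q * ev f (\<zeta> ^ j))" using * by (intro prod.cong) auto
  also have "\<dots> = of_int q ^ (p - 1) * of_int (cnorm f)"
    by (simp add: prod.distrib of_int_cnorm)
  finally have "(of_int (n ^ (p - 1)) :: complex) = of_int (q ^ (p - 1) * cnorm f)" by simp
  then have "n ^ (p - 1) = q ^ (p - 1) * cnorm f" by (simp only: of_int_eq_iff)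
  then have "q ^ (p - 1) dvd n ^ (p - 1)" by simp
  then show ?thesis using p_gt_1 by (simp add: pow_divides_pow_iff)
qed

lemma ocong_of_int_0_iff: "ocong (of_int q) (of_int n) 0 \<longleftrightarrow> q dvd n"
  using of_int_eq_mult_imp_dvd unfolding ocong_def
  by (auto elim!: dvdE intro!: bexI[of _ "of_int _"])

lemma ocong_frobenius_iterate:
  assumes "Factorial_Ring.prime q"
  shows "ocong (of_nat q) (ev f \<zeta> ^ (q ^ k)) (ev f (\<zeta> ^ (q ^ k)))"
proof (induction k)
  case (Suc k)
  obtain s where s: "pcompose f (monom 1 q) = f ^ q + of_nat q * s"
    using pcompose_monom_frobenius[OF assms] by blast
  have "ev f ((\<zeta> ^ (q ^ k)) ^ q) = ev (pcompose f (monom 1 q)) (\<zeta> ^ (q ^ k))" by simp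
  also have "\<dots> = ev f (\<zeta> ^ (q ^ k)) ^ q + of_nat q * ev s (\<zeta> ^ (q ^ k))" unfolding s by simp
  finally have "ocong (of_nat q) (ev f ((\<zeta> ^ (q ^ k)) ^ q)) (ev f (\<zeta> ^ (q ^ k)) ^ q)"
    unfolding ocong_def by (intro bexI[of _ "ev s (\<zeta> ^ (q ^ k))"]) auto
  then have 1: "ocong (of_nat q) (ev f (\<zeta> ^ (q ^ k)) ^ q) (ev f (\<zeta> ^ (q ^ Suc k)))"
    by (simp add: power_mult[symmetric] mult.commute ocong_sym)
  have "ocong (of_nat q) ((ev f \<zeta> ^ (q ^ k)) ^ q) (ev f (\<zeta> ^ (q ^ k)) ^ q)"
    by (rule ocong_power[OF Suc]) auto
  then show ?case using ocong_trans[OF _ 1] by (simp add: power_mult[symmetric] mult.commute)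
qed simp

text \<open>For a prime \<open>q \<noteq> p\<close>, a power of the Frobenius map is the identity on \<open>\<int>[\<zeta>] / q\<close>.\<close>

lemma ocong_power_0_imp:
  assumes q: "Factorial_Ring.prime q" "q \<noteq> p" and x: "x \<in> zring" "ocong (of_nat q) (x ^ p) 0"
  shows "ocong (of_nat q) x 0"
proof -
  obtain f where f: "x = ev f \<zeta>" using x(1) by (elim zringE)
  have "\<not> p dvd q" using q prime_p by (metis primes_dvd_imp_eq)
  have "int p dvd int q ^ p - int q" by (rule fermat_little_int[OF prime_p])
  moreover have "int q ^ p - int q = int q * (int q ^ (p - 1) - 1)"
    using p_gt_1 by (simp add: algebra_simps flip: power_Suc)
  ultimately have "int p dvd int q ^ (p - 1) - 1"
    using \<open>\<not> p dvd q\<close> prime_p by (simp add: prime_dvd_mult_iff)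
  then have "int p dvd int (q ^ (p - 1) - 1)"
    using prime_gt_0_nat[OF q(1)] by (simp add: of_nat_diff)
  then have "p dvd q ^ (p - 1) - 1" by (simp only: int_dvd_int_iff)
  then have "\<zeta> ^ (q ^ (p - 1) - 1) = 1" by (simp add: zeta_power_eq_1_iff)
  then have z: "\<zeta> ^ (q ^ (p - 1)) = \<zeta>"
    using prime_gt_0_nat[OF q(1)] by (metis One_nat_def Suc_pred mult_1_right power_Suc zero_less_power)
  have c: "ocong (of_nat q) (x ^ (q ^ (p - 1))) x"
    using ocong_frobenius_iterate[OF q(1), of f "p - 1"] unfolding z f .
  \<comment> \<open>So \<open>p \<le> q ^ (p - 1)\<close>, and the power of \<open>x\<close> that is
    congruent to \<open>x\<close> is a multiple of \<open>x ^ p\<close>.\<close>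
  have "p - 1 < q ^ (p - 1)"
    by (rule power_gt_expt) (use prime_gt_1_nat[OF q(1)] in auto)
  then have "x ^ (q ^ (p - 1)) = x ^ p * x ^ (q ^ (p - 1) - p)"
    by (simp flip: power_add)
  moreover have "ocong (of_nat q) (x ^ p * x ^ (q ^ (p - 1) - p)) 0"
    using x by (intro ocong_mult_0) auto
  ultimately show ?thesis using c ocong_sym ocong_trans by metis
qed

text \<open>The ideal of \<open>q\<close> need not be prime, so there is no single valuation to
  compare. But by \<open>ocong_power_0_imp\<close>, \<open>k > 0\<close> forces \<open>q\<close> to
  divide \<open>g\<close>; cancelling \<open>q ^ p\<close> lowers \<open>k\<close> by
  \<open>p\<close>, and \<open>0 < k < p\<close> would make \<open>q\<close> divide
  \<open>x\<close>.\<close>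

lemma dvd_exponent:
  assumes q: "Factorial_Ring.prime q" "q \<noteq> p"
    and "g \<in> zring" "x \<in> zring" "g ^ p = of_nat q ^ k * x" "\<not> ocong (of_nat q) x 0"
  shows "p dvd k"
  using assms(3,5)
proof (induction k arbitrary: g rule: less_induct)
  case (less k)
  have q0: "(of_nat q :: complex) \<noteq> 0" using prime_gt_0_nat[OF q(1)] by simp
  show ?case
  proof (cases "k = 0")
    case False
    have "g ^ p - 0 = of_nat q * (of_nat q ^ (k - 1) * x)"
      using less.prems(2) False by (simp add: mult.assoc[symmetric] flip: power_Suc)
    then have "ocong (of_nat q) (g ^ p) 0"
      unfolding ocong_def using assms(4) by (intro bexI[of _ "of_nat q ^ (k - 1) * x"]) auto
    then have "ocong (of_nat q) g 0" using ocong_power_0_imp[OF q less.prems(1)] by simp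
    then obtain g' where g': "g' \<in> zring" "g = of_nat q * g'" unfolding ocong_def by auto
    have eq: "of_nat q ^ p * g' ^ p = of_nat q ^ k * x"
      using less.prems(2) unfolding g'(2) by (simp add: power_mult_distrib)
    show ?thesis
    proof (cases "k < p")
      case True
      then have "of_nat q ^ p = (of_nat q :: complex) ^ k * of_nat q ^ (p - k)"
        by (simp flip: power_add)
      then have "x = of_nat q ^ (p - k) * g' ^ p" using eq q0 by simp
      also have "p - k = Suc (p - k - 1)" using True by simp
      finally have "x - 0 = of_nat q * (of_nat q ^ (p - k - 1) * g' ^ p)" by simp
      then have "ocong (of_nat q) x 0"
        unfolding ocong_def using g'(1) by (intro bexI[of _ "of_nat q ^ (p - k - 1) * g' ^ p"]) auto
      then show ?thesis using assms(6) by simp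
    next
      case kp: False
      then have "of_nat q ^ k = (of_nat q :: complex) ^ p * of_nat q ^ (k - p)"
        by (simp flip: power_add)
      then have "g' ^ p = of_nat q ^ (k - p) * x" using eq q0 by simp
      then have "p dvd k - p" using less.IH[of "k - p" g'] g'(1) kp p_gt_1 by simp
      then show ?thesis using kp by (metis dvd_diffD dvd_refl not_less)
    qed
  qed simp
qed

text \<open>The ideal \<open>I = (c, u / v)\<close> satisfies \<open>I\<^sup>p = (c)\<close>. The elements \<open>g S\<close> below generate, up to a power of
  \<open>v\<close>, the product of the conjugates of \<open>I\<close>.\<close>

lemma p_dvd_multiplicity_cnorm:
  assumes q: "Factorial_Ring.prime q" "q \<noteq> p" and N: "cnorm c \<noteq> 0" and v: "v \<noteq> 0"
    and eq: "ev c \<zeta> * ev b \<zeta> * of_int v ^ p = ev u \<zeta> ^ p"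
    and cop: "ev r \<zeta> * ev c \<zeta> ^ (p - 1) + ev s \<zeta> * ev b \<zeta> = 1"
  shows "p dvd multiplicity (int q) (cnorm c)"
proof -
  let ?J = "{1..<p}"
  have eq': "ev c (\<zeta> ^ j) * ev b (\<zeta> ^ j) * of_int v ^ p = ev u (\<zeta> ^ j) ^ p" if "j \<in> ?J" for j
    using ev_conj_eq[of "c * b * of_int v ^ p" "u ^ p" j] eq not_p_dvd[OF that] by simp
  have cop': "ev r (\<zeta> ^ j) * ev c (\<zeta> ^ j) ^ (p - 1) + ev s (\<zeta> ^ j) * ev b (\<zeta> ^ j) = 1"
    if "j \<in> ?J" for j
    using ev_conj_eq[of "r * c ^ (p - 1) + s * b" 1 j] cop not_p_dvd[OF that] by simp
  \<comment> \<open>For each conjugate, \<open>(c v) ^ p = (c v ^ p) c ^ (p - 1)\<close> and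
    \<open>u ^ p = (c v ^ p) b\<close>. The common factors multiply to \<open>M\<close>, and
    \<open>T S\<close> collects the cofactors that belong to the choice \<open>S\<close>.\<close>
  define T :: "nat set \<Rightarrow> complex" where "T S = (\<Prod>j\<in>S. ev c (\<zeta> ^ j) ^ (p - 1)) * (\<Prod>j\<in>?J - S. ev b (\<zeta> ^ j))" for S
  define g :: "nat set \<Rightarrow> complex" where "g S = (\<Prod>j\<in>S. ev c (\<zeta> ^ j) * of_int v) * (\<Prod>j\<in>?J - S. ev u (\<zeta> ^ j))" for S
  define M where "M = cnorm c * v ^ (p * (p - 1))"
  have M0: "M \<noteq> 0" using N v by (simp add: M_def)
  have T_in: "T S \<in> zring" and g_in: "g S \<in> zring" for S
    unfolding T_def g_def by (auto intro!: zring_prod zring_mult)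
  have gX: "g S ^ p = of_int M * T S" if S: "S \<subseteq> ?J" for S
  proof -
    have fin: "finite S" using S finite_subset by blast
    have card: "card S + card (?J - S) = p - 1"
      using card_Diff_subset[OF fin S] card_mono[OF _ S] by simp
    have "g S ^ p = (\<Prod>j\<in>S. ev c (\<zeta> ^ j) ^ p * of_int v ^ p) * (\<Prod>j\<in>?J - S. ev u (\<zeta> ^ j) ^ p)"
      by (simp only: g_def power_mult_distrib prod_power_distrib)
    also have "(\<Prod>j\<in>?J - S. ev u (\<zeta> ^ j) ^ p)
        = (\<Prod>j\<in>?J - S. ev c (\<zeta> ^ j) * ev b (\<zeta> ^ j) * of_int v ^ p)"
      using eq' by (intro prod.cong) auto
    also have "(\<Prod>j\<in>S. ev c (\<zeta> ^ j) ^ p * of_int v ^ p)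
        = (\<Prod>j\<in>S. ev c (\<zeta> ^ j) * ev c (\<zeta> ^ j) ^ (p - 1) * of_int v ^ p)"
      using p_gt_1 by (intro prod.cong) (auto simp flip: power_Suc)
    also have "\<dots> * (\<Prod>j\<in>?J - S. ev c (\<zeta> ^ j) * ev b (\<zeta> ^ j) * of_int v ^ p)
       = ((\<Prod>j\<in>S. ev c (\<zeta> ^ j)) * (\<Prod>j\<in>?J - S. ev c (\<zeta> ^ j))) * T S
         * ((of_int v ^ p) ^ card S * (of_int v ^ p) ^ card (?J - S))"
      by (simp add: prod.distrib T_def mult_ac)
    also have "(\<Prod>j\<in>S. ev c (\<zeta> ^ j)) * (\<Prod>j\<in>?J - S. ev c (\<zeta> ^ j)) = of_int (cnorm c)"
      unfolding of_int_cnorm using prod.subset_diff[OF S, of "\<lambda>j. ev c (\<zeta> ^ j)"]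
      by (simp add: mult.commute)
    also have "(of_int v ^ p) ^ card S * (of_int v ^ p) ^ card (?J - S)
       = (of_int (v ^ (p * (p - 1))) :: complex)"
      by (simp only: power_add[symmetric] card) (simp add: power_mult)
    finally show ?thesis by (simp add: M_def mult_ac)
  qed
  \<comment> \<open>Expanding the product of the conjugates of \<open>cop\<close> writes
    \<open>1\<close> as a combination of all \<open>T S\<close>, so \<open>q\<close> cannot divide
    every one of them.\<close>
  have "\<exists>S\<subseteq>?J. \<not> ocong (of_int (int q)) (T S) 0"
  proof (rule ccontr)
    assume "\<not> (\<exists>S\<subseteq>?J. \<not> ocong (of_int (int q)) (T S) 0)"
    then have all: "ocong (of_int (int q)) (T S) 0" if "S \<subseteq> ?J" for S using that by blast
    have "1 = (\<Prod>j\<in>?J. ev r (\<zeta> ^ j) * ev c (\<zeta> ^ j) ^ (p - 1) + ev s (\<zeta> ^ j) * ev b (\<zeta> ^ j))"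
      using cop' by (subst prod.cong[OF refl, where h = "\<lambda>_. 1"]) auto
    also have "\<dots> = (\<Sum>S\<in>Pow ?J. (\<Prod>j\<in>S. ev r (\<zeta> ^ j) * ev c (\<zeta> ^ j) ^ (p - 1))
        * (\<Prod>j\<in>?J - S. ev s (\<zeta> ^ j) * ev b (\<zeta> ^ j)))"
      by (rule prod_add) simp
    also have "\<dots> = (\<Sum>S\<in>Pow ?J. T S * ((\<Prod>j\<in>S. ev r (\<zeta> ^ j)) * (\<Prod>j\<in>?J - S. ev s (\<zeta> ^ j))))"
      by (intro sum.cong) (auto simp: prod.distrib T_def mult_ac)
    finally have one: "1 = \<dots>" .
    have "ocong (of_int (int q)) \<dots> (\<Sum>S\<in>Pow ?J. 0)"
      by (rule ocong_sum, rule ocong_mult_0, rule all) (auto intro!: zring_mult zring_prod)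
    then have "ocong (of_int (int q)) (of_int 1) 0" unfolding one[symmetric] by simp
    then have "int q dvd 1" by (simp only: ocong_of_int_0_iff)
    then show False using prime_gt_1_nat[OF q(1)] by simp
  qed
  then obtain S where S: "S \<subseteq> ?J" "\<not> ocong (of_int (int q)) (T S) 0" by blast
  define k where "k = multiplicity (int q) M"
  have qp: "Factorial_Ring.prime (int q)" using q(1) by simp
  obtain M' where M': "M = int q ^ k * M'" "\<not> int q dvd M'"
    using multiplicity_decompose'[OF M0, of "int q"] prime_gt_1_nat[OF q(1)] unfolding k_def by auto
  have "\<not> ocong (of_nat q) (of_int M' * T S) 0"
  proof
    assume a: "ocong (of_nat q) (of_int M' * T S) 0"
    have "coprime (int q) M'" using M'(2) qp prime_imp_coprime by blast
    then obtain x y where xy: "x * int q + y * M' = 1"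
      using bezout_int[of "int q" M'] by auto
    have "ocong (of_nat q) (of_int M' * T S * of_int y + (of_nat q * (of_int x * T S))) (0 + 0)"
    proof (rule ocong_add)
      show "ocong (of_nat q) (of_int M' * T S * of_int y) 0" using a by (rule ocong_mult_0) simp
      show "ocong (of_nat q) (of_nat q * (of_int x * T S)) 0"
        unfolding ocong_def using T_in by (intro bexI[of _ "of_int x * T S"]) auto
    qed
    also have "of_int M' * T S * of_int y + (of_nat q * (of_int x * T S))
        = of_int (x * int q + y * M') * T S" by (simp add: algebra_simps)
    finally show False using S(2) unfolding xy by simp
  qed
  moreover have "g S ^ p = of_nat q ^ k * (of_int M' * T S)"
    using gX[OF S(1)] by (simp add: M'(1))
  ultimately have "p dvd k"
    by (intro dvd_exponent[OF q g_in[of S], of "of_int M' * T S"]) (auto intro: T_in)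
  \<comment> \<open>The denominator \<open>v\<close> contributes a multiple of \<open>p\<close>, so
    clearing it does no harm.\<close>
  moreover have "k = multiplicity (int q) (cnorm c) + (p * (p - 1)) * multiplicity (int q) v"
    unfolding k_def M_def using N v qp
    by (simp add: prime_elem_multiplicity_mult_distrib prime_elem_multiplicity_power_distrib)
  ultimately show ?thesis by (simp add: dvd_add_left_iff)
qed

section \<open>The norm modulo the square of the prime\<close>

lemma prime_p_int: "Factorial_Ring.prime (int p)"
  using prime_p by simp

lemma fermat_p: "[a ^ p = a] (mod int p)"
  using fermat_little_int[OF prime_p, of a] by (simp add: cong_iff_dvd_diff)

text \<open>Both factors of \<open>a ^ p - b ^ p\<close> are divisible by \<open>p\<close>: the
  second is a sum of \<open>p\<close> terms that agree modulo \<open>p\<close>.\<close>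

lemma cong_power_p:
  assumes "[a = b] (mod int p)"
  shows "[a ^ p = b ^ p] (mod int p ^ 2)"
proof -
  have 1: "int p dvd a - b" using assms by (simp add: cong_iff_dvd_diff)
  have "[(\<Sum>i<p. b ^ (p - Suc i) * a ^ i) = (\<Sum>i<p. b ^ (p - Suc i) * b ^ i)] (mod int p)"
    using assms by (intro cong_sum cong_mult cong_pow cong_refl)
  also have "(\<Sum>i<p. b ^ (p - Suc i) * b ^ i) = (\<Sum>i<p. b ^ (p - 1))"
    by (intro sum.cong) (auto simp flip: power_add)
  also have "[\<dots> = 0] (mod int p)" by (simp add: cong_def)
  finally have 2: "int p dvd (\<Sum>i<p. b ^ (p - Suc i) * a ^ i)" by (simp add: cong_0_iff)
  have "a ^ p - b ^ p = (a - b) * (\<Sum>i<p. b ^ (p - Suc i) * a ^ i)"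
    by (rule power_diff_sumr2)
  then show ?thesis using mult_dvd_mono[OF 1 2] by (simp add: cong_iff_dvd_diff power2_eq_square)
qed

lemma prod_conj_1: "(\<Prod>j\<in>{1..<p}. 1 - \<zeta> ^ j) = of_nat p"
  using prod_conj_diff[of 1] by simp

lemma one_minus_conj: "ocong (1 - \<zeta>) (1 - \<zeta> ^ j) 0"
proof -
  have "1 - \<zeta> ^ j = (1 - \<zeta>) * (\<Sum>i<j. \<zeta> ^ i)" by (simp add: one_diff_power_eq)
  then show ?thesis unfolding ocong_def by (intro bexI[of _ "\<Sum>i<j. \<zeta> ^ i"]) (auto intro!: zring_sum)
qed

text \<open>All \<open>1 - \<zeta> ^ j\<close> are associates, because \<open>\<zeta>\<close> is in
  turn a power of \<open>\<zeta> ^ j\<close>, and their product is \<open>p\<close>.\<close>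

lemma pi_power: "\<exists>y\<in>zring. (1 - \<zeta>) ^ (p - 1) = of_nat p * y"
proof -
  have "\<exists>e\<in>zring. 1 - \<zeta> = (1 - \<zeta> ^ j) * e" if j: "j \<in> {1..<p}" for j
  proof -
    have "coprime j p"
      using prime_imp_coprime[OF prime_p not_p_dvd[OF j]] by (simp add: coprime_commute)
    then obtain i where "[j * i = 1] (mod p)" using cong_solve_coprime_nat[of j p] by auto
    then have "\<zeta> ^ (j * i) = \<zeta>"
      using zeta_power_mod[of "j * i"] zeta_power_mod[of 1] by (simp add: cong_def)
    then have "1 - \<zeta> = 1 - (\<zeta> ^ j) ^ i" by (simp add: power_mult)
    also have "\<dots> = (1 - \<zeta> ^ j) * (\<Sum>k<i. (\<zeta> ^ j) ^ k)" by (rule one_diff_power_eq)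
    finally show ?thesis by (intro bexI[of _ "\<Sum>k<i. (\<zeta> ^ j) ^ k"]) (auto intro!: zring_sum)
  qed
  then obtain e where e: "\<And>j. j \<in> {1..<p} \<Longrightarrow> e j \<in> zring \<and> 1 - \<zeta> = (1 - \<zeta> ^ j) * e j" by metis
  have "(1 - \<zeta>) ^ (p - 1) = (\<Prod>j\<in>{1..<p}. 1 - \<zeta>)" by simp
  also have "\<dots> = (\<Prod>j\<in>{1..<p}. (1 - \<zeta> ^ j) * e j)" by (intro prod.cong) (use e in auto)
  also have "\<dots> = of_nat p * (\<Prod>j\<in>{1..<p}. e j)" by (simp only: prod.distrib prod_conj_1)
  finally show ?thesis using e by (intro bexI[of _ "\<Prod>j\<in>{1..<p}. e j"]) (auto intro!: zring_prod)
qed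

text \<open>The conjugates of \<open>2 - \<zeta>\<close> multiply to
  \<open>1 + 2 + ... + 2 ^ (p - 1) = 2 ^ p - 1\<close>. The modulus is only
  \<open>p (1 - \<zeta>)\<close>, but the difference \<open>n\<close> of the norms is a rational
  integer: its own norm \<open>n ^ (p - 1)\<close> is divisible by \<open>p ^ p\<close>, so a
  nonzero \<open>n\<close> contains \<open>p\<close> more than once.\<close>

lemma cnorm_cong:
  assumes "ocong (of_nat p * (1 - \<zeta>)) (ev c \<zeta>) (2 - \<zeta>)"
  shows "[cnorm c = 2 ^ p - 1] (mod int p ^ 2)"
proof -
  let ?J = "{1..<p}" and ?m = "of_nat p * (1 - \<zeta>)"
  obtain f where "ev c \<zeta> - (2 - \<zeta>) = of_nat p * (1 - \<zeta>) * ev f \<zeta>"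
    using assms unfolding ocong_def zring_def by auto
  then have f: "ev c \<zeta> = ev ([:2, -1:] + of_nat p * [:1, -1:] * f) \<zeta>" by (simp add: algebra_simps)
  \<comment> \<open>The same modulus works for all conjugates, since \<open>1 - \<zeta> ^ j\<close>
    is a multiple of \<open>1 - \<zeta>\<close>.\<close>
  have *: "ocong ?m (ev c (\<zeta> ^ j)) (2 - \<zeta> ^ j)" if j: "j \<in> ?J" for j
  proof -
    obtain e where e: "e \<in> zring" "1 - \<zeta> ^ j = (1 - \<zeta>) * e"
      using one_minus_conj[of j] by (auto simp: ocong_def)
    have "ev c (\<zeta> ^ j) = ev ([:2, -1:] + of_nat p * [:1, -1:] * f) (\<zeta> ^ j)"
      using f not_p_dvd[OF j] by (rule ev_conj_eq)
    then have "ev c (\<zeta> ^ j) - (2 - \<zeta> ^ j) = of_nat p * (1 - \<zeta> ^ j) * ev f (\<zeta> ^ j)"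
      by (simp add: algebra_simps)
    also have "\<dots> = ?m * (e * ev f (\<zeta> ^ j))" unfolding e(2) by simp
    finally show ?thesis unfolding ocong_def using e(1) by (intro bexI[of _ "e * ev f (\<zeta> ^ j)"]) auto
  qed
  have "(\<Sum>i<p. 2 ^ i) = (2 ^ p - 1 :: complex)" using power_diff_1_eq[of "2 :: complex" p] by simp
  then have "(\<Prod>j\<in>?J. 2 - \<zeta> ^ j) = of_int (2 ^ p - 1)"
    unfolding prod_conj_diff by (simp flip: of_int_power)
  moreover have "ocong ?m (\<Prod>j\<in>?J. ev c (\<zeta> ^ j)) (\<Prod>j\<in>?J. 2 - \<zeta> ^ j)"
    using * by (intro ocong_prod) (auto intro!: zring_diff zring_of_int[of 2, simplified])
  ultimately have "ocong ?m (of_int (cnorm c)) (of_int (2 ^ p - 1))" by (simp only: of_int_cnorm)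
  then obtain w where w: "of_int (cnorm c) - of_int (2 ^ p - 1) = ?m * ev w \<zeta>"
    unfolding ocong_def zring_def by auto
  define n where "n = cnorm c - (2 ^ p - 1)"
  have "ev (of_int n) \<zeta> = ev (of_nat p * [:1, -1:] * w) \<zeta>" using w by (simp add: n_def right_diff_distrib mult.commute)
  then have n: "of_int n = of_nat p * (1 - \<zeta> ^ j) * ev w (\<zeta> ^ j)" if "j \<in> ?J" for j
    using ev_conj_eq[of "of_int n" "of_nat p * [:1, -1:] * w" j] not_p_dvd[OF that]
    by (simp add: right_diff_distrib mult.commute)
  have "(of_int n :: complex) ^ (p - 1) = (\<Prod>j\<in>?J. of_int n)" by simp
  also have "\<dots> = (\<Prod>j\<in>?J. of_nat p * (1 - \<zeta> ^ j) * ev w (\<zeta> ^ j))" using n by (intro prod.cong) auto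
  also have "\<dots> = of_nat p ^ (p - 1) * of_nat p * of_int (cnorm w)"
    by (simp only: prod.distrib prod_conj_1 of_int_cnorm) simp
  also have "\<dots> = of_int (int p ^ p * cnorm w)"
    using p_gt_1 by (subst power_minus_mult) auto
  finally have "of_int (n ^ (p - 1)) = (of_int (int p ^ p * cnorm w) :: complex)" by simp
  then have eq: "n ^ (p - 1) = int p ^ p * cnorm w" by (simp only: of_int_eq_iff)
  have "int p ^ 2 dvd n"
  proof (cases "n = 0")
    case False
    have "p \<le> multiplicity (int p) (n ^ (p - 1))"
      using eq False p_gt_1 by (intro multiplicity_geI) auto
    also have "\<dots> = (p - 1) * multiplicity (int p) n"
      using prime_p_int False by (simp add: prime_elem_multiplicity_power_distrib)
    finally have "multiplicity (int p) n \<ge> 2"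
      using p_gt_1 by (cases "multiplicity (int p) n" rule: nat.exhaust) (auto simp: Suc_le_eq intro!: Nat.gr0I)
    then show ?thesis by (rule multiplicity_dvd')
  qed simp
  then show ?thesis by (simp add: cong_iff_dvd_diff n_def)
qed

text \<open>Multiplicities determine \<open>m\<close> up to sign, and for odd \<open>p\<close> the
  sign is itself a \<open>p\<close>-th power.\<close>

lemma is_pth_power_int:
  assumes "m \<noteq> 0" "\<And>q. Factorial_Ring.prime q \<Longrightarrow> p dvd multiplicity (int q) m"
  shows "\<exists>a. m = a ^ p"
proof -
  have "p dvd multiplicity q m" if "Factorial_Ring.prime q" for q :: int
    using assms(2)[of "nat q"] prime_gt_0_int[OF that] that by simp
  then have "is_nth_power p (normalize m)"
    using p_gt_1 by (subst is_nth_power_conv_multiplicity) auto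
  then obtain a where a: "\<bar>m\<bar> = a ^ p" by (auto elim: is_nth_powerE)
  show ?thesis
  proof (cases "m \<ge> 0")
    case True then show ?thesis using a by auto
  next
    case False
    then have "m = (- a) ^ p" using a odd_p by (simp add: power_minus_odd)
    then show ?thesis by blast
  qed
qed

text \<open>Every use of the Wieferich condition ends here. The norm of \<open>c\<close> is
  \<open>1\<close> modulo \<open>p\<close>, so \<open>p\<close> does not divide it; at all other
  primes its multiplicity is divisible by \<open>p\<close>. So it is some \<open>a ^ p\<close>,
  where \<open>a\<close> is \<open>1\<close> modulo \<open>p\<close> by Fermat and therefore
  \<open>a ^ p\<close> is \<open>1\<close> modulo \<open>p ^ 2\<close>.\<close>

lemma not_pth_power_if_comaximal:
  assumes nw: "\<not> [2 ^ (p - 1) = 1] (mod p ^ 2)"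
    and c: "c \<in> zring" "ocong (of_nat p * (1 - \<zeta>)) c (2 - \<zeta>)"
    and b: "b \<in> zring" and u: "u \<in> zring" and v: "v \<noteq> 0"
    and eq: "c * b * of_int v ^ p = u ^ p"
    and cop: "r \<in> zring" "s \<in> zring" "r * c + s * b = 1"
  shows False
proof -
  obtain c' where c': "c = ev c' \<zeta>" using c by (elim zringE)
  obtain b' where b': "b = ev b' \<zeta>" using b by (elim zringE)
  obtain u' where u': "u = ev u' \<zeta>" using u by (elim zringE)
  \<comment> \<open>\<open>p_dvd_multiplicity_cnorm\<close> asks for a relation between
    \<open>c ^ (p - 1)\<close> and \<open>b\<close>; it is obtained from the
    \<open>(p - 1)\<close>-st power of this equation.\<close>
  have "1 - s * b = r * c" using cop(3) by (simp add: algebra_simps)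
  then have "(1 - s * b) ^ (p - 1) = (r * c) ^ (p - 1)" by simp
  moreover have "(1 - s * b) ^ (p - 1) - 1 = (1 - s * b - 1) * (\<Sum>i<p - 1. (1 - s * b) ^ i)"
    by (rule power_diff_1_eq)
  ultimately have 1: "r ^ (p - 1) * c ^ (p - 1) + (s * (\<Sum>i<p - 1. (1 - s * b) ^ i)) * b = 1"
    by (simp add: power_mult_distrib algebra_simps)
  have "s * (\<Sum>i<p - 1. (1 - s * b) ^ i) \<in> zring"
    using cop b by (intro zring_mult zring_sum zring_power zring_diff) auto
  then obtain s' where s': "s * (\<Sum>i<p - 1. (1 - s * b) ^ i) = ev s' \<zeta>" by (elim zringE)
  have "r ^ (p - 1) \<in> zring" using cop by auto
  then obtain r' where r': "r ^ (p - 1) = ev r' \<zeta>" by (elim zringE)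
  have cop': "ev r' \<zeta> * ev c' \<zeta> ^ (p - 1) + ev s' \<zeta> * ev b' \<zeta> = 1"
    using 1[unfolded s' r'] unfolding c' b' .
  have N: "[cnorm c' = 2 ^ p - 1] (mod int p ^ 2)" using c(2) unfolding c' by (rule cnorm_cong)
  have Np: "[2 ^ p - 1 = (1::int)] (mod int p)"
    using cong_diff[OF fermat_p[of 2] cong_refl[of 1]] by simp
  have "int p dvd int p ^ 2" by simp
  then have N1: "[cnorm c' = 1] (mod int p)"
    by (rule cong_trans[OF cong_dvd_modulus[OF N] Np])
  have np: "\<not> int p dvd cnorm c'"
  proof
    assume "int p dvd cnorm c'"
    then have "int p dvd 1" using cong_dvd_iff[OF N1] by simp
    then show False using p_gt_1 by simp
  qed
  then have N0: "cnorm c' \<noteq> 0" by auto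
  have "p dvd multiplicity (int q) (cnorm c')" if "Factorial_Ring.prime q" for q
  proof (cases "q = p")
    case True then show ?thesis using np by (simp add: not_dvd_imp_multiplicity_0)
  next
    case False
    show ?thesis
      by (rule p_dvd_multiplicity_cnorm[OF that False N0 v _ cop']) (use eq in \<open>simp add: c' b' u'\<close>)
  qed
  then obtain a where a: "cnorm c' = a ^ p" using is_pth_power_int[OF N0] by blast
  have "[a = 1] (mod int p)" by (rule cong_trans[OF cong_sym[OF fermat_p[of a]] N1[unfolded a]])
  then have "[a ^ p = 1] (mod int p ^ 2)" using cong_power_p[of a 1] by simp
  then have "[2 ^ p - 1 = (1::int)] (mod int p ^ 2)" by (rule cong_trans[OF cong_sym[OF N[unfolded a]]])
  then have "int p ^ 2 dvd 2 ^ p - 2" by (simp add: cong_iff_dvd_diff)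
  also have "(2::int) ^ p - 2 = 2 * (2 ^ (p - 1) - 1)"
    using p_gt_1 by (simp add: power_eq_if)
  finally have "int p ^ 2 dvd 2 * (2 ^ (p - 1) - 1)" .
  moreover have "coprime (int p ^ 2) 2" using odd_p by (simp add: coprime_right_2_iff_odd)
  ultimately have "int p ^ 2 dvd 2 ^ (p - 1) - 1" by (simp only: coprime_dvd_mult_right_iff)
  then have "[int (2 ^ (p - 1)) = int 1] (mod int (p ^ 2))" by (simp add: cong_iff_dvd_diff)
  then have "[2 ^ (p - 1) = 1] (mod p ^ 2)" by (simp only: cong_int_iff)
  then show False using nw by simp
qed

end

section \<open>Subfields of the complex numbers\<close>

lemma field_complex_field: "field complex_field"
  by (rule field_from_type_algebra)

lemma complex_field_simps [simp]:
  "carrier complex_field = UNIV" "x \<otimes>\<^bsub>complex_field\<^esub> y = x * y" "x \<oplus>\<^bsub>complex_field\<^esub> y = x + y"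
  "\<one>\<^bsub>complex_field\<^esub> = 1" "\<zero>\<^bsub>complex_field\<^esub> = 0"
  by (simp_all add: ring_of_type_algebra_def)

lemma complex_field_a_inv [simp]: "\<ominus>\<^bsub>complex_field\<^esub> x = - x"
proof -
  interpret field complex_field by (rule field_complex_field)
  show ?thesis by (rule minus_equality) simp_all
qed

lemma complex_field_m_inv [simp]: "x \<noteq> 0 \<Longrightarrow> inv\<^bsub>complex_field\<^esub> x = inverse x"
proof -
  interpret field complex_field by (rule field_complex_field)
  show "x \<noteq> 0 \<Longrightarrow> inv\<^bsub>complex_field\<^esub> x = inverse x" by (rule inv_char) simp_all
qed

lemma subfield_complexI:
  assumes "1 \<in> E" "\<And>x y. x \<in> E \<Longrightarrow> y \<in> E \<Longrightarrow> x + y \<in> E" "\<And>x y. x \<in> E \<Longrightarrow> y \<in> E \<Longrightarrow> x * y \<in> E"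
    "\<And>x. x \<in> E \<Longrightarrow> - x \<in> E" "\<And>x. x \<in> E \<Longrightarrow> inverse x \<in> E"
  shows "subfield E complex_field"
proof -
  interpret field complex_field by (rule field_complex_field)
  show ?thesis by (intro subfieldI' subringI) (use assms in auto)
qed

lemma
  assumes "subfield E complex_field"
  shows subfield_0: "0 \<in> E" and subfield_1: "1 \<in> E"
    and subfield_add: "x \<in> E \<Longrightarrow> y \<in> E \<Longrightarrow> x + y \<in> E"
    and subfield_mult: "x \<in> E \<Longrightarrow> y \<in> E \<Longrightarrow> x * y \<in> E"
    and subfield_uminus: "x \<in> E \<Longrightarrow> - x \<in> E"
  using subringE[OF subfieldE(1)[OF assms]] by auto

lemma subfield_diff: "subfield E complex_field \<Longrightarrow> x \<in> E \<Longrightarrow> y \<in> E \<Longrightarrow> x - y \<in> E"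
  using subfield_add[of E x "- y"] subfield_uminus by simp

lemma subfield_inverse:
  assumes "subfield E complex_field" "x \<in> E"
  shows "inverse x \<in> E"
proof (cases "x = 0")
  case False
  interpret field complex_field by (rule field_complex_field)
  show ?thesis using subfield_m_inv(1)[OF assms(1), of x] assms(2) False by simp
qed (use subfield_0[OF assms(1)] in simp)

lemma subfield_divide: "subfield E complex_field \<Longrightarrow> x \<in> E \<Longrightarrow> y \<in> E \<Longrightarrow> x / y \<in> E"
  by (simp add: divide_inverse subfield_mult subfield_inverse)

lemma subfield_power: "subfield E complex_field \<Longrightarrow> x \<in> E \<Longrightarrow> x ^ n \<in> E"
  by (induction n) (auto intro: subfield_1 subfield_mult)

lemma subfield_power_int: "subfield E complex_field \<Longrightarrow> x \<in> E \<Longrightarrow> x powi k \<in> E"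
  by (auto simp: power_int_def intro: subfield_power subfield_inverse)

lemma subfield_sum:
  "subfield E complex_field \<Longrightarrow> (\<And>i. i \<in> A \<Longrightarrow> f i \<in> E) \<Longrightarrow> sum f A \<in> E"
  by (induction A rule: infinite_finite_induct) (auto intro: subfield_0 subfield_add)

lemma subfield_prod:
  "subfield E complex_field \<Longrightarrow> (\<And>i. i \<in> A \<Longrightarrow> f i \<in> E) \<Longrightarrow> prod f A \<in> E"
  by (induction A rule: infinite_finite_induct) (auto intro: subfield_1 subfield_mult)

lemmas subfield_closed = subfield_0 subfield_1 subfield_add subfield_mult subfield_uminus
  subfield_diff subfield_inverse subfield_divide subfield_power subfield_power_int

abbreviation gen :: "complex set \<Rightarrow> complex set" where
  "gen S \<equiv> generate_field complex_field S"

lemma subfield_gen: "subfield (gen S) complex_field"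
  using field.generate_field_is_subfield[OF field_complex_field] by simp

lemma gen_incl: "x \<in> S \<Longrightarrow> x \<in> gen S"
  by (rule generate_field.incl)

lemma gen_least: "subfield E complex_field \<Longrightarrow> S \<subseteq> E \<Longrightarrow> gen S \<subseteq> E"
  using field.generate_field_min_subfield1[OF field_complex_field] by simp

lemma gen_mono: "S \<subseteq> T \<Longrightarrow> gen S \<subseteq> gen T"
  by (rule gen_least[OF subfield_gen]) (auto intro: gen_incl)

lemma gen_subfield: "subfield E complex_field \<Longrightarrow> gen E = E"
  by (intro antisym gen_least) (auto intro: gen_incl)

lemma gen_gen_Un: "gen (gen S \<union> T) = gen (S \<union> T)"
proof (intro antisym gen_least[OF subfield_gen])
  show "gen S \<union> T \<subseteq> gen (S \<union> T)" using gen_mono[of S "S \<union> T"] by (auto intro: gen_incl)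
  show "S \<union> T \<subseteq> gen (gen S \<union> T)" by (auto intro: gen_incl)
qed

lemma gen_adjoin_radical:
  assumes E: "subfield E complex_field" and b: "b ^ n \<in> E" and n: "n > 0"
    and x: "x \<in> gen (insert b E)"
  shows "\<exists>f. (\<forall>i. coeff f i \<in> E) \<and> x = poly f b"
proof -
  interpret field complex_field by (rule field_complex_field)
  \<comment> \<open>The polynomial \<open>X ^ n - b ^ n\<close>, with the leading coefficient first
    as in HOL-Algebra. It shows that \<open>b\<close> is algebraic over \<open>E\<close>, so that
    \<open>E[b]\<close> is already a field.\<close>
  let ?l = "1 # replicate (n - 1) 0 @ [- (b ^ n)]"
  have pow: "b [^]\<^bsub>complex_field\<^esub> k = b ^ k" for k :: nat by (induction k) simp_all
  have "eval (replicate m 0 @ [c]) b = c" for m c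
    by (induction m) simp_all
  then have "eval ?l b = 0" using n by (simp add: pow)
  moreover have "?l \<in> carrier (E[X]\<^bsub>complex_field\<^esub>)"
    using E b unfolding univ_poly_carrier[symmetric] polynomial_def
    by (auto intro: subfield_closed)
  ultimately have "(algebraic over E) b" by (intro algebraicI[of ?l]) auto
  then have "subfield (simple_extension E b) complex_field"
    using simple_extension_is_subfield[OF E, of b] by simp
  moreover have "insert b E \<subseteq> simple_extension E b"
    using simple_extension_incl[of E b] simple_extension_mem[OF subfieldE(1)[OF E], of b] by simp
  ultimately have "x \<in> simple_extension E b" using gen_least x by blast
  then show ?thesis
  proof (induction rule: simple_extension.induct)
    case zero
    then show ?case using E by (intro exI[of _ 0]) (auto intro: subfield_closed)
  next
    case (lin k1 k2)
    then obtain f where f: "\<forall>i. poly.coeff f i \<in> E" "k1 = poly f b" by blast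
    have "\<forall>i. poly.coeff (pCons k2 f) i \<in> E" using f lin by (auto simp: coeff_pCons split: nat.split)
    then show ?case using f by (intro exI[of _ "pCons k2 f"]) (simp add: algebra_simps)
  qed
qed

text \<open>A ring homomorphism from \<open>E\<close> to the complex numbers. Values outside
  \<open>E\<close> are left open, so one function serves for all smaller fields;
  \<open>\<sigma> 1 = 1\<close> excludes the zero map.\<close>

definition embeds :: "complex set \<Rightarrow> (complex \<Rightarrow> complex) \<Rightarrow> bool" where
  "embeds E \<sigma> \<longleftrightarrow> \<sigma> 1 = 1 \<and> (\<forall>x\<in>E. \<forall>y\<in>E. \<sigma> (x + y) = \<sigma> x + \<sigma> y \<and> \<sigma> (x * y) = \<sigma> x * \<sigma> y)"

lemma embeds_mono: "embeds E \<sigma> \<Longrightarrow> F \<subseteq> E \<Longrightarrow> embeds F \<sigma>"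
  unfolding embeds_def by blast

lemma embeds_id: "embeds E (\<lambda>x. x)"
  by (simp add: embeds_def)

context
  fixes E \<sigma> assumes E: "subfield E complex_field" and \<sigma>: "embeds E \<sigma>"
begin

lemma embeds_1: "\<sigma> 1 = 1" using \<sigma> by (simp add: embeds_def)
lemma embeds_add: "x \<in> E \<Longrightarrow> y \<in> E \<Longrightarrow> \<sigma> (x + y) = \<sigma> x + \<sigma> y" using \<sigma> by (simp add: embeds_def)
lemma embeds_mult: "x \<in> E \<Longrightarrow> y \<in> E \<Longrightarrow> \<sigma> (x * y) = \<sigma> x * \<sigma> y" using \<sigma> by (simp add: embeds_def)

lemma embeds_0: "\<sigma> 0 = 0"
  using embeds_add[of 0 0] subfield_0[OF E] by simp

lemma embeds_uminus: "x \<in> E \<Longrightarrow> \<sigma> (- x) = - \<sigma> x"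
  using embeds_add[of x "- x"] subfield_uminus[OF E] embeds_0 by (simp add: eq_neg_iff_add_eq_0 add.commute)

lemma embeds_diff: "x \<in> E \<Longrightarrow> y \<in> E \<Longrightarrow> \<sigma> (x - y) = \<sigma> x - \<sigma> y"
  using embeds_add[of x "- y"] embeds_uminus[of y] subfield_uminus[OF E] by simp

lemma embeds_eq_0_iff: "x \<in> E \<Longrightarrow> \<sigma> x = 0 \<longleftrightarrow> x = 0"
  using embeds_mult[of x "inverse x"] subfield_inverse[OF E, of x] embeds_1 embeds_0
  by (cases "x = 0") auto

lemma embeds_inj: "inj_on \<sigma> E"
  using embeds_diff embeds_eq_0_iff subfield_diff[OF E] by (intro inj_onI) (metis eq_iff_diff_eq_0)

lemma embeds_inverse: "x \<in> E \<Longrightarrow> \<sigma> (inverse x) = inverse (\<sigma> x)"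
  using embeds_mult[of x "inverse x"] subfield_inverse[OF E, of x] embeds_1 embeds_0 embeds_eq_0_iff[of x]
  by (cases "x = 0") (auto intro: inverse_unique[symmetric])

lemma embeds_power: "x \<in> E \<Longrightarrow> \<sigma> (x ^ n) = \<sigma> x ^ n"
  by (induction n) (simp_all add: embeds_1 embeds_mult subfield_power[OF E])

lemma embeds_power_int: "x \<in> E \<Longrightarrow> \<sigma> (x powi k) = \<sigma> x powi k"
  by (simp add: power_int_def embeds_power embeds_inverse subfield_inverse[OF E])

lemma embeds_sum: "(\<And>i. i \<in> A \<Longrightarrow> f i \<in> E) \<Longrightarrow> \<sigma> (sum f A) = (\<Sum>i\<in>A. \<sigma> (f i))"
  by (induction A rule: infinite_finite_induct) (simp_all add: embeds_0 embeds_add subfield_sum[OF E])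

lemma embeds_prod: "(\<And>i. i \<in> A \<Longrightarrow> f i \<in> E) \<Longrightarrow> \<sigma> (prod f A) = (\<Prod>i\<in>A. \<sigma> (f i))"
  by (induction A rule: infinite_finite_induct) (simp_all add: embeds_1 embeds_mult subfield_prod[OF E])

text \<open>To be combined with \<open>gen_least\<close>: a property that cuts out a subfield need
  only be checked on generators. The equalizer of two embeddings is used below in the same
  way.\<close>

lemma subfield_vimage:
  assumes "subfield F complex_field"
  shows "subfield {x \<in> E. \<sigma> x \<in> F} complex_field"
  by (rule subfield_complexI)
     (auto simp: embeds_1 embeds_add embeds_mult embeds_uminus embeds_inverse
       intro: subfield_closed E assms)

lemma subfield_image: "subfield (\<sigma> ` E) complex_field"
proof (rule subfield_complexI)
  show "1 \<in> \<sigma> ` E" using subfield_1[OF E] embeds_1 by (metis image_eqI)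
  show "x + y \<in> \<sigma> ` E" if "x \<in> \<sigma> ` E" "y \<in> \<sigma> ` E" for x y
    using that subfield_add[OF E] by (auto simp flip: embeds_add)
  show "x * y \<in> \<sigma> ` E" if "x \<in> \<sigma> ` E" "y \<in> \<sigma> ` E" for x y
    using that subfield_mult[OF E] by (auto simp flip: embeds_mult)
  show "- x \<in> \<sigma> ` E" if "x \<in> \<sigma> ` E" for x
    using that subfield_uminus[OF E] by (auto simp flip: embeds_uminus)
  show "inverse x \<in> \<sigma> ` E" if "x \<in> \<sigma> ` E" for x
    using that subfield_inverse[OF E] by (auto simp flip: embeds_inverse)
qed

end

lemma embeds_gen_image_subset:
  assumes "embeds (gen S) \<sigma>" "subfield F complex_field" "\<And>x. x \<in> S \<Longrightarrow> \<sigma> x \<in> F" "x \<in> gen S"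
  shows "\<sigma> x \<in> F"
  using gen_least[OF subfield_vimage[OF subfield_gen assms(1,2)], of S] assms(3,4)
  by (auto intro: gen_incl)

lemma subfield_equalizer:
  assumes E: "subfield E complex_field" "embeds E \<sigma>" "embeds E \<tau>"
  shows "subfield {x \<in> E. \<sigma> x = \<tau> x} complex_field"
  by (rule subfield_complexI)
     (auto simp: embeds_1[OF E(1,2)] embeds_1[OF E(1,3)] embeds_add[OF E(1,2)] embeds_add[OF E(1,3)]
      embeds_mult[OF E(1,2)] embeds_mult[OF E(1,3)] embeds_uminus[OF E(1,2)] embeds_uminus[OF E(1,3)]
      embeds_inverse[OF E(1,2)] embeds_inverse[OF E(1,3)] intro: subfield_closed E)

lemma embeds_gen_eqI:
  assumes "embeds (gen S) \<sigma>" "embeds (gen S) \<tau>" "\<And>x. x \<in> S \<Longrightarrow> \<sigma> x = \<tau> x" "x \<in> gen S"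
  shows "\<sigma> x = \<tau> x"
  using gen_least[OF subfield_equalizer[OF subfield_gen assms(1,2)], of S] assms(3,4)
  by (auto intro: gen_incl)

section \<open>The critical values\<close>

context cyclotomic
begin

lemma subfield_rat_adjoin: "subfield (rat_adjoin \<zeta>) complex_field"
  unfolding rat_adjoin_def by (rule subfield_gen)

lemma zeta_in_rat_adjoin: "\<zeta> \<in> rat_adjoin \<zeta>"
  unfolding rat_adjoin_def by (rule gen_incl) simp

text \<open>The multiplier is the product of the other conjugates. The norm is not zero, since a
  zero at \<open>\<zeta> ^ j\<close> would be carried back to \<open>\<zeta>\<close> by the
  conjugation with exponent \<open>i\<close>, where \<open>j * i\<close> is \<open>1\<close> modulo
  \<open>p\<close>.\<close>

lemma cnorm_multiple:
  assumes "u \<in> zring" "u \<noteq> 0"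
  shows "\<exists>w\<in>zring. \<exists>n. n \<noteq> 0 \<and> u * w = of_int n"
proof -
  obtain f where f: "u = ev f \<zeta>" using assms(1) by (elim zringE)
  have "{1..<p} = insert 1 {2..<p}" using p_gt_1 by auto
  then have "(\<Prod>j\<in>{1..<p}. ev f (\<zeta> ^ j)) = u * (\<Prod>j\<in>{2..<p}. ev f (\<zeta> ^ j))"
    by (simp add: f)
  then have eq: "u * (\<Prod>j\<in>{2..<p}. ev f (\<zeta> ^ j)) = of_int (cnorm f)" by (simp add: of_int_cnorm)
  have "cnorm f \<noteq> 0"
  proof
    assume "cnorm f = 0"
    then obtain j where j: "j \<in> {1..<p}" "ev f (\<zeta> ^ j) = 0"
      using of_int_cnorm[of f] by (auto simp: prod_zero_iff)
    have "coprime j p" using prime_imp_coprime[OF prime_p not_p_dvd[OF j(1)]] by (simp add: coprime_commute)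
    then obtain i where i: "[j * i = 1] (mod p)" using cong_solve_coprime_nat[of j p] by auto
    have pi: "\<not> p dvd i"
    proof
      assume "p dvd i"
      then have "[j * i = 0] (mod p)" by (simp add: cong_0_iff)
      then have "[1 = 0] (mod p)" using i cong_sym cong_trans by blast
      then show False using p_gt_1 by (simp add: cong_0_iff)
    qed
    have "ev (pcompose f (monom 1 j)) \<zeta> = ev 0 \<zeta>" using j(2) by simp
    from ev_conj_eq[OF this pi] have "ev f (\<zeta> ^ (j * i)) = 0"
      by (simp add: mult.commute flip: power_mult)
    moreover have "\<zeta> ^ (j * i) = \<zeta>"
      using i zeta_power_mod[of "j * i"] zeta_power_mod[of 1] by (simp add: cong_def)
    ultimately show False using assms(2) f by simp
  qed
  then show ?thesis using eq
    by (intro bexI[of _ "\<Prod>j\<in>{2..<p}. ev f (\<zeta> ^ j)"]) (auto intro!: zring_prod)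
qed

lemma rat_adjoin_fraction:
  assumes "x \<in> rat_adjoin \<zeta>"
  shows "\<exists>u\<in>zring. \<exists>v::int. v \<noteq> 0 \<and> x = u / of_int v"
proof -
  define E where "E = {x. \<exists>u\<in>zring. \<exists>v::int. v \<noteq> 0 \<and> x = u / of_int v}"
  have EI: "u / of_int v \<in> E" if "u \<in> zring" "v \<noteq> 0" for u v using that by (auto simp: E_def)
  have "subfield E complex_field"
  proof (rule subfield_complexI)
    show "1 \<in> E" using EI[of 1 1] by simp
  next
    fix x y assume "x \<in> E" "y \<in> E"
    then obtain u v u' v' where uv: "u \<in> zring" "v \<noteq> 0" "x = u / of_int v"
      "u' \<in> zring" "v' \<noteq> 0" "y = u' / of_int v'" by (auto simp: E_def)
    have "x + y = (u * of_int v' + u' * of_int v) / of_int (v * v')"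
      using uv by (simp add: field_simps)
    also have "\<dots> \<in> E" using uv by (intro EI) auto
    finally show "x + y \<in> E" .
    have "x * y = (u * u') / of_int (v * v')" using uv by simp
    also have "\<dots> \<in> E" using uv by (intro EI) auto
    finally show "x * y \<in> E" .
  next
    fix x assume "x \<in> E"
    then obtain u v where uv: "u \<in> zring" "v \<noteq> 0" "x = u / of_int v" by (auto simp: E_def)
    show "- x \<in> E" using EI[of "- u" v] uv by simp
    show "inverse x \<in> E"
    proof (cases "u = 0")
      case True then show ?thesis using EI[of 0 1] uv by simp
    next
      case False
      then obtain w n where w: "w \<in> zring" "n \<noteq> 0" "u * w = of_int n"
        using cnorm_multiple[OF uv(1)] by blast
      then have "w \<noteq> 0" by auto
      then have "inverse x = of_int v * w / of_int n"
        using False unfolding w(3)[symmetric] uv(3) by (simp add: field_simps)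
      also have "\<dots> \<in> E" using w uv by (intro EI) auto
      finally show ?thesis .
    qed
  qed
  moreover have "{\<zeta>} \<subseteq> E" using EI[of \<zeta> 1] by simp
  ultimately have "rat_adjoin \<zeta> \<subseteq> E" unfolding rat_adjoin_def by (rule gen_least)
  then show ?thesis using assms by (auto simp: E_def)
qed

definition psi :: "complex \<Rightarrow> complex" where "psi x = x ^ p + (1 - \<zeta>)"

text \<open>\<open>crit n\<close> is the iterate \<open>\<phi>\<^sup>n\<^sup>+\<^sup>1(1)\<close> of the critical point.\<close>

definition crit :: "nat \<Rightarrow> complex" where "crit n = 1 + (psi ^^ n) (1 - \<zeta>)"

lemma crit_0: "crit 0 = 2 - \<zeta>" by (simp add: crit_def)

lemma crit_Suc: "crit (Suc n) = (crit n - 1) ^ p + (2 - \<zeta>)"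
  by (simp add: crit_def psi_def)

lemma pi_in: "1 - \<zeta> \<in> zring" by auto

lemma crit_in [simp]: "crit n \<in> zring"
proof (induction n)
  case 0 then show ?case using zring_add[OF zring_1 pi_in] by (simp add: crit_0)
next
  case (Suc n)
  have "2 - \<zeta> \<in> zring" using zring_add[OF zring_1 pi_in] by simp
  then show ?case using Suc by (simp add: crit_Suc)
qed

text \<open>\<open>crit n - 1\<close> is a multiple of \<open>1 - \<zeta>\<close>, and its
  \<open>p\<close>-th power a multiple of \<open>p (1 - \<zeta>)\<close>, because \<open>p\<close>
  divides \<open>(1 - \<zeta>) ^ (p - 1)\<close>. By \<open>cnorm_cong\<close> the norms of all
  \<open>crit n\<close> therefore agree modulo \<open>p ^ 2\<close>.\<close>

lemma crit_cong: "ocong (of_nat p * (1 - \<zeta>)) (crit n) (2 - \<zeta>)"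
  and crit_cong_1: "ocong (1 - \<zeta>) (crit n) 1"
proof -
  have *: "ocong (1 - \<zeta>) (crit n) 1" for n
  proof (induction n)
    case 0
    have "crit 0 - 1 = (1 - \<zeta>) * 1" by (simp add: crit_0)
    then show ?case unfolding ocong_def using zring_1 by blast
  next
    case (Suc n)
    then obtain z where z: "z \<in> zring" "crit n - 1 = (1 - \<zeta>) * z" by (auto simp: ocong_def)
    have "crit (Suc n) - 1 = (1 - \<zeta>) * ((1 - \<zeta>) ^ (p - 1) * z ^ p + 1)"
      using p_gt_1 unfolding crit_Suc z(2)
      by (simp add: power_mult_distrib distrib_left mult.assoc[symmetric] flip: power_Suc)
    then show ?case unfolding ocong_def using z(1) pi_in
      by (intro bexI[of _ "(1 - \<zeta>) ^ (p - 1) * z ^ p + 1"]) auto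
  qed
  show "ocong (1 - \<zeta>) (crit n) 1" by (rule *)
  show "ocong (of_nat p * (1 - \<zeta>)) (crit n) (2 - \<zeta>)"
  proof (cases n)
    case 0 then show ?thesis by (simp add: crit_0)
  next
    case (Suc m)
    obtain z where z: "z \<in> zring" "crit m - 1 = (1 - \<zeta>) * z" using *[of m] by (auto simp: ocong_def)
    obtain y where y: "y \<in> zring" "(1 - \<zeta>) ^ (p - 1) = of_nat p * y" using pi_power by blast
    have "crit n - (2 - \<zeta>) = (1 - \<zeta>) ^ p * z ^ p"
      unfolding Suc crit_Suc z(2) by (simp add: power_mult_distrib)
    also have "(1 - \<zeta>) ^ p = (1 - \<zeta>) ^ (p - 1) * (1 - \<zeta>)"
      using p_gt_1 by (subst power_minus_mult) auto
    finally have "crit n - (2 - \<zeta>) = of_nat p * (1 - \<zeta>) * (y * z ^ p)"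
      unfolding y(2) by (simp only: mult_ac)
    then show ?thesis unfolding ocong_def using y z by (intro bexI[of _ "y * z ^ p"]) auto
  qed
qed

text \<open>This holds because \<open>0 \<mapsto> 1 - \<zeta> \<mapsto> 1 - \<zeta>\<close> under \<open>\<phi>\<close>.\<close>

lemma crit_add_cong: "ocong (crit i) (crit (i + Suc k)) (1 - \<zeta>)"
proof (induction k)
  case 0
  have "ocong (crit i) (crit i - 1) (- 1)"
    unfolding ocong_def by (intro bexI[of _ 1]) auto
  then have "ocong (crit i) ((crit i - 1) ^ p + (2 - \<zeta>)) ((- 1) ^ p + (2 - \<zeta>))"
    by (intro ocong_add ocong_power ocong_refl) auto
  then show ?case using odd_p by (simp add: crit_Suc)
next
  case (Suc k)
  have "ocong (crit i) (crit (i + Suc k) + (- 1)) ((1 - \<zeta>) + (- 1))"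
    using Suc by (intro ocong_add ocong_refl)
  then have "ocong (crit i) ((crit (i + Suc k) - 1) ^ p + (2 - \<zeta>)) ((- \<zeta>) ^ p + (2 - \<zeta>))"
    by (intro ocong_add ocong_power ocong_refl) auto
  then show ?case using odd_p by (simp add: crit_Suc power_minus_odd)
qed

section \<open>Coprimality of the critical values\<close>

definition comaximal :: "complex \<Rightarrow> complex \<Rightarrow> bool" where
  "comaximal a b \<longleftrightarrow> (\<exists>r\<in>zring. \<exists>s\<in>zring. r * a + s * b = 1)"

lemma comaximal_mult:
  assumes "comaximal a b" "comaximal a c" "a \<in> zring" "b \<in> zring" "c \<in> zring"
  shows "comaximal a (b * c)"
proof -
  obtain r s r' s' where *: "r \<in> zring" "s \<in> zring" "r * a + s * b = 1"
    "r' \<in> zring" "s' \<in> zring" "r' * a + s' * c = 1" using assms unfolding comaximal_def by auto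
  have "(r * a + s * b) * (r' * a + s' * c) = 1" using * by simp
  then have "(r * r' * a + r * s' * c + s * r' * b) * a + (s * s') * (b * c) = 1"
    by (simp add: algebra_simps)
  then show ?thesis unfolding comaximal_def
    using * assms by (intro bexI[of _ "r * r' * a + r * s' * c + s * r' * b"] bexI[of _ "s * s'"]) auto
qed

lemma comaximal_power:
  assumes "comaximal a b" "a \<in> zring" "b \<in> zring"
  shows "comaximal a (b ^ n)"
proof (induction n)
  case 0 show ?case unfolding comaximal_def by (intro bexI[of _ 0] bexI[of _ 1]) auto
next
  case (Suc n) then show ?case using assms by (auto intro!: comaximal_mult)
qed

lemma comaximal_prod:
  assumes "finite A" "a \<in> zring" "\<And>i. i \<in> A \<Longrightarrow> comaximal a (f i)" "\<And>i. i \<in> A \<Longrightarrow> f i \<in> zring"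
  shows "comaximal a (prod f A)"
  using assms(1,3,4)
proof (induction A rule: finite_induct)
  case empty show ?case unfolding comaximal_def by (intro bexI[of _ 0] bexI[of _ 1]) auto
next
  case (insert i A) then show ?case using assms(2) by (auto intro!: comaximal_mult zring_prod)
qed

text \<open>The ideal of \<open>crit n\<close> and \<open>crit i\<close> contains
  \<open>1 - \<zeta>\<close> by \<open>crit_add_cong\<close>, whereas \<open>crit i\<close> is
  \<open>1\<close> modulo \<open>1 - \<zeta>\<close>; so it contains \<open>1\<close>.\<close>

lemma comaximal_crit:
  assumes "i < n"
  shows "comaximal (crit n) (crit i)"
proof -
  obtain x where x: "x \<in> zring" "crit n - (1 - \<zeta>) = crit i * x"
    using crit_add_cong[of i "n - Suc i"] assms by (auto simp: ocong_def)
  obtain z where z: "z \<in> zring" "crit i - 1 = (1 - \<zeta>) * z"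
    using crit_cong_1 by (auto simp: ocong_def)
  have "1 - \<zeta> = crit n - crit i * x" using x(2) by (simp add: algebra_simps)
  then have "(crit n - crit i * x) * z = crit i - 1" using z(2) by simp
  then have "(- z) * crit n + (1 + x * z) * crit i = 1" by (simp add: algebra_simps)
  then show ?thesis unfolding comaximal_def
    using x z by (intro bexI[of _ "- z"] bexI[of _ "1 + x * z"]) auto
qed

lemma crit_not_pth_power:
  assumes nw: "\<not> [2 ^ (p - 1) = 1] (mod p ^ 2)" and x: "x \<in> rat_adjoin \<zeta>"
  shows "crit n * (\<Prod>i<n. crit i ^ f i) \<noteq> x ^ p"
proof
  assume eq: "crit n * (\<Prod>i<n. crit i ^ f i) = x ^ p"
  obtain u v where uv: "u \<in> zring" "v \<noteq> 0" "x = u / of_int v" using rat_adjoin_fraction[OF x] by blast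
  have b: "(\<Prod>i<n. crit i ^ f i) \<in> zring" by (auto intro!: zring_prod)
  have "comaximal (crit n) (\<Prod>i<n. crit i ^ f i)"
    by (intro comaximal_prod comaximal_power comaximal_crit) auto
  then obtain r s where rs: "r \<in> zring" "s \<in> zring" "r * crit n + s * (\<Prod>i<n. crit i ^ f i) = 1"
    by (auto simp: comaximal_def)
  show False
    by (rule not_pth_power_if_comaximal[OF nw crit_in crit_cong b uv(1,2) _ rs])
       (use uv in \<open>simp add: eq power_divide\<close>)
qed

text \<open>Otherwise \<open>1 - \<zeta>\<close> would be a unit and \<open>p\<close> would divide
  \<open>1\<close>. The nonvanishing of the critical values is what keeps the roots of the iterates
  distinct, see \<open>rho_inj\<close>.\<close>

lemma crit_nz: "crit n \<noteq> 0"
proof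
  assume "crit n = 0"
  then obtain z where "z \<in> zring" "- 1 = (1 - \<zeta>) * z" using crit_cong_1[of n] by (auto simp: ocong_def)
  then have "(-1) ^ (p - 1) = (1 - \<zeta>) ^ (p - 1) * z ^ (p - 1)" by (simp flip: power_mult_distrib)
  moreover obtain y where "y \<in> zring" "(1 - \<zeta>) ^ (p - 1) = of_nat p * y" using pi_power by blast
  ultimately have "of_int 1 = of_int (int p) * (y * z ^ (p - 1))" "y * z ^ (p - 1) \<in> zring"
    using odd_p \<open>z \<in> zring\<close> by (auto simp: mult.assoc)
  then have "int p dvd 1" by (rule of_int_eq_mult_imp_dvd)
  then show False using p_gt_1 by simp
qed

section \<open>Kummer extensions\<close>

lemma radical_mem_of_coprime:
  assumes E: "subfield E complex_field" and "b ^ d \<in> E" "b ^ p \<in> E" "\<not> p dvd d"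
  shows "b \<in> E"
proof (cases "b = 0")
  case True then show ?thesis using subfield_0[OF E] by simp
next
  case b: False
  have "coprime (int d) (int p)"
    using prime_imp_coprime[OF prime_p assms(4)] by (simp add: coprime_commute)
  then obtain x y where xy: "x * int d + y * int p = 1" using bezout_int[of "int d" "int p"] by auto
  have "b = b powi (int d * x + int p * y)" using xy by (simp add: mult.commute)
  also have "\<dots> = (b ^ d) powi x * (b ^ p) powi y"
    using b by (simp add: power_int_add power_int_mult)
  also have "\<dots> \<in> E" by (intro subfield_mult subfield_power_int assms E)
  finally show ?thesis .
qed

lemma degree_radical_poly: "degree (monom 1 p - [:c:] :: complex poly) = p"
proof (rule antisym)
  show "degree (monom 1 p - [:c:]) \<le> p" by (rule degree_diff_le) (auto simp: degree_monom_le)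
  show "p \<le> degree (monom 1 p - [:c:])"
    using p_gt_1 by (intro le_degree) (auto simp: coeff_pCons split: nat.split)
qed

lemma coeff_radical_poly:
  "coeff (monom 1 p - [:c:] :: complex poly) i = (if i = p then 1 else if i = 0 then - c else 0)"
  using p_gt_1 by (auto simp: coeff_pCons split: nat.split)

lemma coeff_radical_poly_in:
  assumes "subfield E complex_field" "c \<in> E"
  shows "coeff (monom 1 p - [:c:]) i \<in> E"
  unfolding coeff_radical_poly using assms by (auto intro: subfield_closed)

text \<open>\<open>X ^ p - b ^ p\<close> is the minimal polynomial of \<open>b\<close>. The roots of
  a monic factor of degree \<open>d\<close> are \<open>p\<close>-th roots of \<open>b ^ p\<close>,
  so its constant term is \<open>(- b) ^ d\<close> up to a power of \<open>\<zeta>\<close>. Hence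
  \<open>(- b) ^ d\<close> lies in \<open>E\<close>, and \<open>b \<notin> E\<close> leaves only
  \<open>d = p\<close>.\<close>

lemma radical_poly_dvd:
  assumes E: "subfield E complex_field" and z: "\<zeta> \<in> E" and b: "b ^ p \<in> E" "b \<notin> E"
    and f: "\<And>i. coeff f i \<in> E" "poly f b = 0"
  shows "\<exists>q. (\<forall>i. coeff q i \<in> E) \<and> f = (monom 1 p - [:b ^ p:]) * q"
proof -
  let ?F = "monom 1 p - [:b ^ p:]"
  define P where "P = (\<lambda>d. \<exists>g. g \<noteq> 0 \<and> (\<forall>i. coeff g i \<in> E) \<and> poly g b = 0 \<and> degree g = d)"
  define d where "d = (LEAST d. P d)"
  have F: "?F \<noteq> 0" "poly ?F b = 0" "coeff ?F i \<in> E" for i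
    using degree_radical_poly[of "b ^ p"] p_gt_1 coeff_radical_poly_in[OF E b(1)]
    by (auto simp: poly_monom simp del: coeff_diff)
  then have "P p" unfolding P_def using degree_radical_poly[of "b ^ p"] by blast
  then have Pd: "P d" and dle: "d \<le> p" unfolding d_def by (auto intro: LeastI Least_le)
  have min: "g = 0" if "\<And>i. coeff g i \<in> E" "poly g b = 0" "degree g < d" for g
    using not_less_Least[of "degree g" P] that unfolding d_def P_def by blast
  obtain g0 where g0: "g0 \<noteq> 0" "\<And>i. coeff g0 i \<in> E" "poly g0 b = 0" "degree g0 = d"
    using Pd by (auto simp: P_def)
  define g where "g = smult (inverse (lead_coeff g0)) g0"
  have g: "g \<noteq> 0" "coeff g i \<in> E" "poly g b = 0" "degree g = d" "lead_coeff g = 1" for i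
    using g0 by (auto simp: g_def intro!: subfield_mult[OF E] subfield_inverse[OF E])
  have div: "\<exists>q r. h = k * q + r \<and> (\<forall>i. coeff q i \<in> E) \<and> (\<forall>i. coeff r i \<in> E)
      \<and> (r = 0 \<or> degree r < degree k)"
    if "\<And>i. coeff h i \<in> E" "\<And>i. coeff k i \<in> E" "lead_coeff k = 1" for h k
    by (rule monic_division) (use that E in \<open>auto intro: subfield_closed\<close>)
  obtain q r where qr: "?F = g * q + r" "\<forall>i. coeff q i \<in> E" "\<forall>i. coeff r i \<in> E"
    "r = 0 \<or> degree r < degree g" using div[of ?F g] F(3) g by blast
  have "poly r b = 0" using F(2) g(3) unfolding qr(1) by simp
  then have "r = 0" using min[of r] qr g(4) by auto
  then have Fg: "?F = g * q" using qr(1) by simp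
  have "d > 0"
  proof (rule ccontr)
    assume "\<not> d > 0"
    then obtain c where "g = [:c:]" using g(4) by (metis degree_eq_zeroE gr0I)
    then show False using g(1,3) by simp
  qed
  obtain A where A: "size A = degree g" "g = smult (lead_coeff g) (\<Prod>x\<in>#A. [:-x, 1:])"
    using alg_closed_imp_factorization[OF g(1)] by blast
  have gA: "g = (\<Prod>x\<in>#A. [:-x, 1:])" using A(2) g(5) by simp
  have root: "x ^ p = b ^ p" if "x \<in># A" for x
  proof -
    have "poly g x = 0" unfolding gA using that by (auto simp: poly_prod_mset prod_mset_zero_iff)
    then have "poly ?F x = 0" unfolding Fg by simp
    then show ?thesis by (simp add: poly_monom)
  qed
  \<comment> \<open>Comparing \<open>p\<close>-th powers determines the constant term without
    choosing a power of \<open>\<zeta>\<close> for each root.\<close>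
  have "poly g 0 = (\<Prod>x\<in>#A. - x)" unfolding gA by (simp add: poly_prod_mset image_mset.compositionality o_def)
  moreover have "(\<Prod>x\<in>#A. - x) ^ p = (\<Prod>x\<in>#A. (- x) ^ p)"
    by (induction A) (simp_all add: power_mult_distrib flip: mult_minus_left)
  ultimately have "poly g 0 ^ p = (\<Prod>x\<in>#A. (- x) ^ p)" by simp
  also have "\<dots> = (\<Prod>x\<in>#A. (- b) ^ p)"
    using root odd_p by (intro arg_cong[of _ _ prod_mset] image_mset_cong) (simp add: power_minus_odd)
  also have "\<dots> = ((- b) ^ d) ^ p" using A(1) g(4) by (simp add: mult.commute flip: power_mult)
  finally obtain i where "poly g 0 = \<zeta> ^ i * (- b) ^ d" using eq_zeta_mult by blast
  then have "(- b) ^ d = coeff g 0 / \<zeta> ^ i" by (simp add: poly_0_coeff_0)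
  also have "\<dots> \<in> E" using z g(2) by (intro subfield_divide subfield_power E)
  finally have "(- b) ^ d \<in> E" .
  moreover have "(- b) ^ p \<in> E" using b(1) odd_p E by (simp add: power_minus_odd subfield_uminus)
  moreover have "- b \<notin> E" using b(2) subfield_uminus[OF E, of "- b"] by auto
  ultimately have "p dvd d" using radical_mem_of_coprime[OF E] by blast
  then have dp: "d = p" using dle \<open>d > 0\<close> by (simp add: dvd_imp_le le_antisym)
  obtain q' r' where qr': "f = ?F * q' + r'" "\<forall>i. coeff q' i \<in> E" "\<forall>i. coeff r' i \<in> E"
    "r' = 0 \<or> degree r' < degree ?F"
    using div[of f ?F, OF f(1) F(3)] p_gt_1 unfolding degree_radical_poly coeff_radical_poly by auto
  have "poly r' b = 0" using F(2) f(2) unfolding qr'(1) by simp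
  then have "r' = 0" using min[of r'] qr' dp degree_radical_poly by auto
  then show ?thesis using qr' by auto
qed

text \<open>Applying \<open>\<sigma>\<close> to the coefficients of \<open>f\<close> and evaluating
  at \<open>b'\<close> depends only on \<open>poly f b\<close>, by \<open>radical_poly_dvd\<close>.
  The last conjunct exposes this formula because \<open>kummer_radical\<close> computes with
  it.\<close>

lemma embeds_extend_radical:
  assumes E: "subfield E complex_field" and z: "\<zeta> \<in> E" and b: "b ^ p \<in> E" "b \<notin> E"
    and \<sigma>: "embeds E \<sigma>" and b': "b' ^ p = \<sigma> (b ^ p)"
  shows "\<exists>\<tau>. embeds (gen (insert b E)) \<tau> \<and> (\<forall>x\<in>E. \<tau> x = \<sigma> x) \<and> \<tau> b = b'
    \<and> (\<forall>f. (\<forall>i. coeff f i \<in> E) \<longrightarrow> \<tau> (poly f b) = poly (map_poly \<sigma> f) b')"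
proof -
  let ?M = "map_poly \<sigma>" and ?F = "monom 1 p - [:b ^ p:]"
  define PE where "PE f \<longleftrightarrow> (\<forall>i. coeff f i \<in> E)" for f :: "complex poly"
  have cM: "coeff (?M f) i = \<sigma> (coeff f i)" for f i
    using embeds_0[OF E \<sigma>] by (simp add: coeff_map_poly)
  have M_add: "?M (f + g) = ?M f + ?M g" if "PE f" "PE g" for f g
    using that by (intro poly_eqI) (simp add: cM PE_def embeds_add[OF E \<sigma>])
  have M_mult: "?M (f * g) = ?M f * ?M g" if "PE f" "PE g" for f g
    using that by (intro poly_eqI)
      (simp add: cM PE_def coeff_mult embeds_sum[OF E \<sigma>] embeds_mult[OF E \<sigma>] subfield_mult[OF E])
  have PE_add: "PE (f + g)" if "PE f" "PE g" for f g
    using that by (simp add: PE_def subfield_add[OF E])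
  have PE_mult: "PE (f * g)" if "PE f" "PE g" for f g
    using that by (simp add: PE_def coeff_mult subfield_sum[OF E] subfield_mult[OF E])
  have PE_const: "PE [:c:]" if "c \<in> E" for c
    using that subfield_0[OF E] by (simp add: PE_def coeff_pCons split: nat.split)
  have M_const: "?M [:c:] = [:\<sigma> c:]" for c
    using embeds_0[OF E \<sigma>] by (intro poly_eqI) (simp add: cM coeff_pCons split: nat.split)
  have zero: "poly (?M f) b' = 0" if f: "PE f" "poly f b = 0" for f
  proof -
    obtain q where q: "PE q" "f = ?F * q"
      using radical_poly_dvd[OF E z b, of f] f unfolding PE_def by auto
    have "PE ?F" using coeff_radical_poly_in[OF E b(1)] by (simp add: PE_def del: coeff_diff)
    moreover have "?M ?F = monom 1 p - [:\<sigma> (b ^ p):]"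
      using b(1) embeds_0[OF E \<sigma>] embeds_1[OF E \<sigma>] embeds_uminus[OF E \<sigma>]
      by (intro poly_eqI) (simp only: cM coeff_radical_poly split: if_split, simp)
    ultimately show ?thesis using b' q by (simp add: M_mult poly_monom)
  qed
  define \<tau> where "\<tau> x = poly (?M (SOME f. PE f \<and> x = poly f b)) b'" for x
  have \<tau>: "\<tau> (poly f b) = poly (?M f) b'" if f: "PE f" for f
  proof -
    define g where "g = (SOME g. PE g \<and> poly f b = poly g b)"
    have g: "PE g" "poly f b = poly g b"
      using someI[of "\<lambda>g. PE g \<and> poly f b = poly g b" f] f unfolding g_def by auto
    have 1: "PE (g + [:-1:] * f)"
      by (intro PE_add PE_mult PE_const g(1) f subfield_uminus[OF E] subfield_1[OF E])
    have "poly (?M (g + [:-1:] * f)) b' = 0" using g(2) by (intro zero[OF 1]) simp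
    moreover have "?M (g + [:-1:] * f) = ?M g + [:\<sigma> (-1):] * ?M f"
      using g(1) f by (simp only: M_add M_mult PE_mult PE_const subfield_uminus[OF E] subfield_1[OF E] M_const)
    ultimately show ?thesis
      using embeds_uminus[OF E \<sigma> subfield_1[OF E]] embeds_1[OF E \<sigma>] by (simp add: \<tau>_def g_def)
  qed
  have rep: "\<exists>f. PE f \<and> x = poly f b" if "x \<in> gen (insert b E)" for x
    using gen_adjoin_radical[OF E b(1) _ that] p_gt_1 unfolding PE_def by auto
  have \<tau>E: "\<tau> x = \<sigma> x" if "x \<in> E" for x
    using \<tau>[OF PE_const[OF that]] by (simp add: M_const)
  have "embeds (gen (insert b E)) \<tau>"
    unfolding embeds_def
  proof (intro conjI ballI)
    show "\<tau> 1 = 1" using \<tau>E[OF subfield_1[OF E]] embeds_1[OF E \<sigma>] by simp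
    fix x y assume "x \<in> gen (insert b E)" "y \<in> gen (insert b E)"
    then obtain f g where fg: "PE f" "x = poly f b" "PE g" "y = poly g b" using rep by meson
    show "\<tau> (x + y) = \<tau> x + \<tau> y"
      using \<tau>[OF PE_add[OF fg(1,3)]] \<tau>[OF fg(1)] \<tau>[OF fg(3)] by (simp add: fg M_add)
    show "\<tau> (x * y) = \<tau> x * \<tau> y"
      using \<tau>[OF PE_mult[OF fg(1,3)]] \<tau>[OF fg(1)] \<tau>[OF fg(3)] by (simp add: fg M_mult)
  qed
  moreover have "\<tau> b = b'"
  proof -
    have "PE [:0, 1:]" by (auto simp: PE_def coeff_pCons subfield_closed[OF E] split: nat.split)
    moreover have "?M [:0, 1:] = [:0, 1:]"
      using embeds_0[OF E \<sigma>] embeds_1[OF E \<sigma>]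
      by (intro poly_eqI) (simp add: cM coeff_pCons split: nat.split)
    ultimately show ?thesis using \<tau>[of "[:0, 1:]"] by simp
  qed
  ultimately show ?thesis using \<tau>E \<tau> unfolding PE_def by blast
qed

text \<open>The embedding over \<open>E\<close> with \<open>b \<mapsto> \<zeta> b\<close> multiplies
  \<open>x\<close> by some \<open>\<zeta> ^ j\<close>. When \<open>x\<close> is written as a
  polynomial in \<open>b\<close> of degree below \<open>p\<close>, comparing coefficients leaves
  only the \<open>j\<close>-th one, as \<open>b\<close> has degree \<open>p\<close> over
  \<open>E\<close>.\<close>

lemma kummer_radical:
  assumes E: "subfield E complex_field" and z: "\<zeta> \<in> E" and b: "b ^ p \<in> E" "b \<notin> E"
    and x: "x \<in> gen (insert b E)" "x ^ p \<in> E"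
  shows "\<exists>k\<in>E. \<exists>j. x = k * b ^ j"
proof -
  let ?F = "monom 1 p - [:b ^ p:]"
  have "(\<zeta> * b) ^ p = b ^ p" by (simp add: power_mult_distrib)
  then obtain \<tau> where \<tau>: "embeds (gen (insert b E)) \<tau>" "\<And>x. x \<in> E \<Longrightarrow> \<tau> x = x"
    "\<And>f. (\<forall>i. coeff f i \<in> E) \<Longrightarrow> \<tau> (poly f b) = poly f (\<zeta> * b)"
    using embeds_extend_radical[OF E z b embeds_id, of "\<zeta> * b"] by (auto simp: map_poly_idI)
  obtain f where f: "\<And>i. coeff f i \<in> E" "x = poly f b"
    using gen_adjoin_radical[OF E b(1) _ x(1)] p_gt_1 by auto
  have F: "coeff ?F i \<in> E" for i by (rule coeff_radical_poly_in[OF E b(1)])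
  have lc: "lead_coeff ?F = 1" using p_gt_1 unfolding degree_radical_poly coeff_radical_poly by simp
  obtain q r where qr: "f = ?F * q + r" "\<forall>i. coeff r i \<in> E" "r = 0 \<or> degree r < degree ?F"
    using monic_division[of E ?F f, OF _ _ _ lc F f(1)] E by (auto intro: subfield_closed)
  have xr: "x = poly r b" unfolding f(2) qr(1) by (simp add: poly_monom)
  have degr: "degree r < p" using qr(3) degree_radical_poly p_gt_1 by auto
  have "\<tau> x ^ p = x ^ p"
    using embeds_power[OF subfield_gen \<tau>(1) x(1), of p] \<tau>(2)[OF x(2)] by simp
  then obtain j where j: "j < p" "\<tau> x = \<zeta> ^ j * x" using eq_zeta_mult by blast
  define h where "h = pcompose r [:0, \<zeta>:] - smult (\<zeta> ^ j) r"
  have ch: "coeff h i = (\<zeta> ^ i - \<zeta> ^ j) * coeff r i" for i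
    by (simp add: h_def coeff_pcompose_linear algebra_simps)
  have "poly h b = 0"
    using j(2) \<tau>(3)[OF qr(2)] by (simp add: h_def xr poly_pcompose mult.commute)
  moreover have hE: "coeff h i \<in> E" for i
    unfolding ch using qr(2) z E by (auto intro: subfield_closed)
  ultimately obtain s where s: "h = ?F * s" using radical_poly_dvd[OF E z b, of h] by blast
  have "h = 0"
  proof (rule ccontr)
    assume "h \<noteq> 0"
    then have "degree h = p + degree s"
      unfolding s by (subst degree_mult_eq) (auto simp: degree_radical_poly)
    then have "coeff h (p + degree s) \<noteq> 0" using \<open>h \<noteq> 0\<close> by (metis leading_coeff_0_iff)
    then have "coeff r (p + degree s) \<noteq> 0" unfolding ch by auto
    then show False using degr le_degree by fastforce
  qed
  have "coeff r i = 0" if "i \<noteq> j" for i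
  proof (cases "i < p")
    case True
    then have "\<zeta> ^ i \<noteq> \<zeta> ^ j" using that j(1) zeta_power_inj by (auto dest: inj_onD)
    then show ?thesis using ch[of i] \<open>h = 0\<close> by simp
  next
    case False then show ?thesis using degr by (simp add: coeff_eq_0)
  qed
  then have "r = monom (coeff r j) j" by (intro poly_eqI) simp
  then have "x = coeff r j * b ^ j" using xr by (metis poly_monom)
  then show ?thesis using qr(2) by blast
qed

text \<open>The two claims share one induction: adjoining a further radical \<open>b a\<close>
  requires \<open>b a \<notin> E\<close> for either of them, and this follows from the first claim
  for \<open>A\<close>.\<close>

lemma kummer:
  assumes "finite A" and F: "subfield F complex_field" "\<zeta> \<in> F"
    and "\<And>i. i \<in> A \<Longrightarrow> b i \<noteq> 0" "\<And>i. i \<in> A \<Longrightarrow> b i ^ p \<in> F"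
    and "\<forall>e :: 'a \<Rightarrow> int. (\<Prod>i\<in>A. b i powi e i) \<in> F \<longrightarrow> (\<forall>i\<in>A. int p dvd e i)"
  shows "(\<forall>x. x \<in> gen (F \<union> b ` A) \<longrightarrow> x ^ p \<in> F \<longrightarrow>
        (\<exists>k\<in>F. \<exists>e :: 'a \<Rightarrow> int. x = k * (\<Prod>i\<in>A. b i powi e i)))
    \<and> (\<forall>\<sigma> b'. embeds F \<sigma> \<longrightarrow> (\<forall>i\<in>A. b' i ^ p = \<sigma> (b i ^ p)) \<longrightarrow>
        (\<exists>\<tau>. embeds (gen (F \<union> b ` A)) \<tau> \<and> (\<forall>x\<in>F. \<tau> x = \<sigma> x) \<and> (\<forall>i\<in>A. \<tau> (b i) = b' i)))"
  using assms(1,4-)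
proof (induction A rule: finite_induct)
  case empty
  show ?case by (auto simp: gen_subfield[OF F(1)])
next
  case (insert a A)
  define E where "E = gen (F \<union> b ` A)"
  have E: "subfield E complex_field" unfolding E_def by (rule subfield_gen)
  have FE: "F \<subseteq> E" unfolding E_def by (auto intro: gen_incl)
  have genE: "gen (F \<union> b ` insert a A) = gen (insert (b a) E)"
  proof -
    have "gen (insert (b a) E) = gen (E \<union> {b a})" by simp
    also have "\<dots> = gen (F \<union> b ` A \<union> {b a})" unfolding E_def by (rule gen_gen_Un)
    finally show ?thesis by (simp add: insert_commute Un_commute)
  qed
  have prod_upd: "(\<Prod>i\<in>insert a A. b i powi (if i = a then n else e i)) = b a powi n * (\<Prod>i\<in>A. b i powi e i)"
    for n :: int and e
  proof -
    have "(\<Prod>i\<in>A. b i powi (if i = a then n else e i)) = (\<Prod>i\<in>A. b i powi e i)"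
      using insert.hyps(2) by (intro prod.cong) auto
    then show ?thesis using insert.hyps by simp
  qed
  have indepA: "int p dvd e i" if "(\<Prod>i\<in>A. b i powi e i) \<in> F" "i \<in> A" for e :: "'a \<Rightarrow> int" and i
  proof -
    have "(\<Prod>i\<in>insert a A. b i powi (if i = a then 0 else e i)) \<in> F"
      unfolding prod_upd using that by simp
    from insert.prems(3)[rule_format, OF this, of i] show ?thesis using that(2) insert.hyps(2) by (cases "i = a") auto
  qed
  have IH: "(\<forall>x. x \<in> E \<longrightarrow> x ^ p \<in> F \<longrightarrow>
        (\<exists>k\<in>F. \<exists>e :: 'a \<Rightarrow> int. x = k * (\<Prod>i\<in>A. b i powi e i)))
    \<and> (\<forall>\<sigma> b'. embeds F \<sigma> \<longrightarrow> (\<forall>i\<in>A. b' i ^ p = \<sigma> (b i ^ p)) \<longrightarrow>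
        (\<exists>\<tau>. embeds E \<tau> \<and> (\<forall>x\<in>F. \<tau> x = \<sigma> x) \<and> (\<forall>i\<in>A. \<tau> (b i) = b' i)))"
    unfolding E_def by (rule insert.IH) (use insert.prems(1,2) indepA in auto)
  note IH1 = conjunct1[OF IH, rule_format] and IH2 = conjunct2[OF IH, rule_format]
  have z: "\<zeta> \<in> E" using F(2) FE by blast
  have baF: "b a ^ p \<in> F" using insert.prems(2) by simp
  then have ba: "b a ^ p \<in> E" using FE by blast
  have ba0: "b a \<noteq> 0" using insert.prems(1) by simp
  \<comment> \<open>Otherwise \<open>b a\<close> would be a product of the earlier radicals up to an
    element of \<open>F\<close>, which is a relation with exponent \<open>1\<close> at
    \<open>a\<close>.\<close>
  have baE: "b a \<notin> E"
  proof
    assume "b a \<in> E"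
    then obtain k e where ke: "k \<in> F" "b a = k * (\<Prod>i\<in>A. b i powi e i)"
      using IH1[OF _ baF] by blast
    have "(\<Prod>i\<in>A. b i powi e i) \<noteq> 0" using insert.prems(1) insert.hyps(1) by simp
    moreover have "(\<Prod>i\<in>A. b i powi (- e i)) = inverse (\<Prod>i\<in>A. b i powi e i)"
      by (simp add: power_int_minus prod_inversef[symmetric] o_def)
    ultimately have "b a * (\<Prod>i\<in>A. b i powi (- e i)) = k" using ke(2) by simp
    then have "(\<Prod>i\<in>insert a A. b i powi (if i = a then 1 else - e i)) \<in> F"
      unfolding prod_upd using ke(1) by simp
    from insert.prems(3)[rule_format, OF this, of a] show False using p_gt_1 by simp
  qed
  show ?case
    unfolding genE
  proof (intro conjI allI impI)
    fix x assume x: "x \<in> gen (insert (b a) E)" "x ^ p \<in> F"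
    then obtain k j where kj: "k \<in> E" "x = k * b a ^ j"
      using kummer_radical[OF E z ba baE] FE by blast
    have "k ^ p = x ^ p / (b a ^ p) ^ j"
      using ba0 unfolding kj(2) by (simp add: power_mult_distrib mult.commute flip: power_mult)
    also have "\<dots> \<in> F" by (intro subfield_divide subfield_power F x baF)
    finally obtain l e where le: "l \<in> F" "k = l * (\<Prod>i\<in>A. b i powi e i)"
      using IH1[OF kj(1)] by blast
    have "x = l * (\<Prod>i\<in>insert a A. b i powi (if i = a then int j else e i))"
      unfolding prod_upd kj(2) le(2) by simp
    then show "\<exists>k\<in>F. \<exists>e :: 'a \<Rightarrow> int. x = k * (\<Prod>i\<in>insert a A. b i powi e i)"
      by (rule bexI[OF exI[where x = "\<lambda>i. if i = a then int j else e i"] le(1)])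
  next
    fix \<sigma> b' assume \<sigma>: "embeds F \<sigma>" and b': "\<forall>i\<in>insert a A. b' i ^ p = \<sigma> (b i ^ p)"
    then obtain \<tau> where \<tau>: "embeds E \<tau>" "\<forall>x\<in>F. \<tau> x = \<sigma> x" "\<forall>i\<in>A. \<tau> (b i) = b' i"
      using IH2[OF \<sigma>, of b'] by auto
    have "b' a ^ p = \<tau> (b a ^ p)" using b' \<tau>(2) baF by simp
    then obtain \<tau>' where \<tau>': "embeds (gen (insert (b a) E)) \<tau>'" "\<forall>x\<in>E. \<tau>' x = \<tau> x" "\<tau>' (b a) = b' a"
      using embeds_extend_radical[OF E z ba baE \<tau>(1)] by blast
    moreover have "b i \<in> E" if "i \<in> A" for i using that unfolding E_def by (auto intro: gen_incl)
    ultimately show "\<exists>\<tau>. embeds (gen (insert (b a) E)) \<tau> \<and> (\<forall>x\<in>F. \<tau> x = \<sigma> x)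
        \<and> (\<forall>i\<in>insert a A. \<tau> (b i) = b' i)"
      using \<tau>(2,3) FE by (intro exI[of _ \<tau>']) auto
  qed
qed

end

section \<open>The iterated wreath product\<close>

text \<open>The label \<open>k v\<close> is the rotation of the children of the vertex \<open>v\<close>.\<close>

fun act :: "nat \<Rightarrow> (nat list \<Rightarrow> nat) \<Rightarrow> nat list \<Rightarrow> nat list" where
  "act p k [] = []"
| "act p k (y # x) = (y + k []) mod p # act p (\<lambda>v. k (y # v)) x"

text \<open>\<open>act\<close> recurses from the root, as the wreath product does, whereas the tower
  of fields grows at the leaves. This lemma and \<open>prod_words_Suc\<close> translate between the
  two directions.\<close>

lemma act_snoc: "act p k (w @ [j]) = act p k w @ [(j + k w) mod p]"
  by (induction w arbitrary: k) auto

lemma act_in_words: "p > 0 \<Longrightarrow> w \<in> words p n \<Longrightarrow> act p k w \<in> words p n"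
proof (induction w arbitrary: k n)
  case Nil then show ?case by (simp add: words_def)
next
  case (Cons y x)
  then obtain m where m: "n = Suc m" "x \<in> words p m" by (cases n) (auto simp: words_def)
  then have "act p (\<lambda>v. k (y # v)) x \<in> words p m" using Cons by blast
  then show ?case using m(1) Cons.prems(1) by (auto simp: words_def)
qed

lemma words_snoc: "w @ [j] \<in> words p (Suc n) \<longleftrightarrow> w \<in> words p n \<and> j < p"
  by (auto simp: words_def)

lemma words_SucE:
  assumes "w \<in> words p (Suc n)"
  obtains v j where "w = v @ [j]" "v \<in> words p n" "j < p"
  using assms by (cases w rule: rev_cases) (auto simp: words_snoc, simp add: words_def)

lemma finite_words: "finite (words p n)"
  using finite_lists_length_eq[of "{..<p}" n] by (simp add: words_def conj_commute)

lemma prod_words_Suc: "(\<Prod>w\<in>words p (Suc n). f w) = (\<Prod>w\<in>words p n. \<Prod>j<p. f (w @ [j]))"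
proof -
  have "bij_betw (\<lambda>(w, j). w @ [j]) (words p n \<times> {..<p}) (words p (Suc n))"
    unfolding bij_betw_def
    by (auto simp: inj_on_def words_snoc elim!: words_SucE)
  then have "(\<Prod>w\<in>words p (Suc n). f w) = (\<Prod>(w, j)\<in>words p n \<times> {..<p}. f (w @ [j]))"
    by (subst prod.reindex_bij_betw[symmetric]) (auto simp: case_prod_unfold)
  then show ?thesis by (simp add: prod.cartesian_product)
qed

text \<open>The block permutation gives the label of the root and the elements chosen for the blocks
  give the labels of the subtrees. Labels matter only modulo \<open>p\<close>, so a permutation has
  many labellings.\<close>

lemma iterated_wreath_eq:
  assumes "p > 0"
  shows "iterated_wreath p n = range (\<lambda>k. restrict (act p k) (words p n))"
proof (induction n)
  case 0
  have "Bij {[]} = {\<lambda>w\<in>{[] :: nat list}. w}"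
    by (auto simp: Bij_def extensional_def fun_eq_iff restrict_def bij_betw_def)
  moreover have "restrict (act p k) {[]} = (\<lambda>w\<in>{[]}. w)" for k
    by (auto simp: restrict_def fun_eq_iff)
  ultimately show ?case by (simp only: iterated_wreath.simps words_0) auto
next
  case (Suc n)
  show ?case
  proof (intro subset_antisym subsetI)
    fix f assume "f \<in> iterated_wreath p (Suc n)"
    then obtain h g where f: "f = (\<lambda>w\<in>words p (Suc n). h (hd w) # g (hd w) (tl w))"
      and h: "h \<in> cyclic_perms p" and g: "g \<in> {..<p} \<rightarrow> range (\<lambda>k. restrict (act p k) (words p n))"
      unfolding iterated_wreath.simps wreath_def words_Suc Suc by blast
    obtain c where c: "h = (\<lambda>i\<in>{..<p}. (i + c) mod p)" using h by (auto simp: cyclic_perms_def)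
    have "\<forall>y\<in>{..<p}. \<exists>k. g y = restrict (act p k) (words p n)" using g by auto
    then obtain K where K: "\<And>y. y < p \<Longrightarrow> g y = restrict (act p (K y)) (words p n)"
      by (metis lessThan_iff)
    define k where "k v = (case v of [] \<Rightarrow> c | y # v \<Rightarrow> K y v)" for v
    have "f = restrict (act p k) (words p (Suc n))"
      unfolding f
    proof (rule restrict_ext)
      fix w assume "w \<in> words p (Suc n)"
      then obtain y x where w: "w = y # x" "y < p" "x \<in> words p n"
        by (auto simp: words_Suc cons_set_def)
      then show "h (hd w) # g (hd w) (tl w) = act p k w"
        by (simp add: c K k_def)
    qed
    then show "f \<in> range (\<lambda>k. restrict (act p k) (words p (Suc n)))" by blast
  next
    fix f assume "f \<in> range (\<lambda>k. restrict (act p k) (words p (Suc n)))"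
    then obtain k where f: "f = restrict (act p k) (words p (Suc n))" by auto
    let ?h = "\<lambda>i\<in>{..<p}. (i + k []) mod p"
    let ?g = "\<lambda>y. restrict (act p (\<lambda>v. k (y # v))) (words p n)"
    have "f = (\<lambda>w\<in>words p (Suc n). ?h (hd w) # ?g (hd w) (tl w))"
      unfolding f
    proof (rule restrict_ext)
      fix w assume "w \<in> words p (Suc n)"
      then obtain y x where w: "w = y # x" "y < p" "x \<in> words p n"
        by (auto simp: words_Suc cons_set_def)
      then show "act p k w = ?h (hd w) # ?g (hd w) (tl w)" by simp
    qed
    then have 1: "f = (\<lambda>w\<in>cons_set {..<p} (words p n). ?h (hd w) # ?g (hd w) (tl w))"
      unfolding words_Suc .
    have 2: "?h \<in> cyclic_perms p" by (auto simp: cyclic_perms_def)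
    have 3: "?g \<in> {..<p} \<rightarrow> iterated_wreath p n" unfolding Suc by blast
    show "f \<in> iterated_wreath p (Suc n)"
      unfolding iterated_wreath.simps wreath_def
      by (intro CollectI exI[of _ ?h] exI[of _ ?g] conjI 1 2 3)
  qed
qed

section \<open>The adding machine\<close>

text \<open>\<open>act p (carry p)\<close> adds \<open>1\<close> to a word read in base \<open>p\<close>, least significant digit first.\<close>

definition carry :: "nat \<Rightarrow> nat list \<Rightarrow> nat" where
  "carry p w = (if set w \<subseteq> {p - 1} then 1 else 0)"

fun val :: "nat \<Rightarrow> nat list \<Rightarrow> nat" where
  "val p [] = 0"
| "val p (y # x) = y + p * val p x"

lemma act_0: "set w \<subseteq> {..<p} \<Longrightarrow> act p (\<lambda>_. 0) w = w"
  by (induction w) auto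

text \<open>At a digit \<open>p - 1\<close> the carry goes on into the rest of the word; at any
  other digit all labels below are zero and the rest stays fixed. The modulus accounts for the
  overflow when all digits are \<open>p - 1\<close>.\<close>

lemma val_act_carry:
  assumes "p > 0" "w \<in> words p n"
  shows "[val p (act p (carry p) w) = val p w + 1] (mod p ^ n)"
  using assms(2)
proof (induction w arbitrary: n)
  case Nil then show ?case by (auto simp: words_def)
next
  case (Cons y x)
  then obtain m where m: "n = Suc m" "x \<in> words p m" "y < p" by (cases n) (auto simp: words_def)
  show ?case
  proof (cases "y = p - 1")
    case True
    then have "(\<lambda>v. carry p (y # v)) = carry p" by (auto simp: carry_def)
    then have "act p (carry p) (y # x) = 0 # act p (carry p) x"
      using True assms(1) by (simp add: carry_def)
    moreover have "[p * val p (act p (carry p) x) = p * (val p x + 1)] (mod p * p ^ m)"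
      using Cons.IH[OF m(2)] unfolding cong_def mod_mult_mult1 by simp
    moreover have "p * (val p x + 1) = val p (y # x) + 1" using True assms(1) by simp
    ultimately show ?thesis using m(1) by simp
  next
    case False
    then have "(\<lambda>v. carry p (y # v)) = (\<lambda>_. 0)" by (auto simp: carry_def)
    then have "act p (carry p) (y # x) = (y + 1) # x"
      using False m(2,3) by (simp add: carry_def act_0 words_def)
    then show ?thesis by simp
  qed
qed

lemma val_less: "w \<in> words p n \<Longrightarrow> val p w < p ^ n"
proof (induction w arbitrary: n)
  case Nil then show ?case by (auto simp: words_def)
next
  case (Cons y x)
  then obtain m where m: "n = Suc m" "x \<in> words p m" "y < p" by (cases n) (auto simp: words_def)
  have "y + p * val p x < p + p * val p x" using m by simp
  also have "\<dots> = p * (val p x + 1)" by simp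
  also have "\<dots> \<le> p * p ^ m" using Cons.IH[OF m(2)] by (intro mult_le_mono2) simp
  finally show ?case using m by simp
qed

lemma val_inj: "inj_on (val p) (words p n)"
proof (induction n)
  case 0 then show ?case by (simp add: words_0)
next
  case (Suc n)
  show ?case
  proof (rule inj_onI)
    fix v w assume vw: "v \<in> words p (Suc n)" "w \<in> words p (Suc n)" "val p v = val p w"
    obtain y x where v: "v = y # x" "y < p" "x \<in> words p n"
      using vw(1) by (auto simp: words_Suc cons_set_def)
    obtain y' x' where w: "w = y' # x'" "y' < p" "x' \<in> words p n"
      using vw(2) by (auto simp: words_Suc cons_set_def)
    have eq: "y + p * val p x = y' + p * val p x'" using vw(3) v w by simp
    have "(y + p * val p x) mod p = (y' + p * val p x') mod p" using eq by simp
    then have "y = y'" using v w by simp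
    moreover from this have "val p x = val p x'" using eq v by simp
    ultimately show "v = w" using v w Suc by (auto dest: inj_onD)
  qed
qed

text \<open>The orbit of the zero word. It runs through all words of length \<open>n\<close> in a
  single cycle, so relations between radicals become sequences indexed by \<open>i\<close>, on which
  the cyclic automorphism acts as a shift.\<close>

definition odometer :: "nat \<Rightarrow> nat \<Rightarrow> nat \<Rightarrow> nat list" where
  "odometer p n i = (act p (carry p) ^^ i) (replicate n 0)"

lemma odometer_Suc: "odometer p n (Suc i) = act p (carry p) (odometer p n i)"
  by (simp add: odometer_def)

lemma odometer_in_words: "p > 0 \<Longrightarrow> odometer p n i \<in> words p n"
proof (induction i)
  case 0 then show ?case by (auto simp: odometer_def words_def)
next
  case (Suc i) then show ?case by (simp add: odometer_Suc act_in_words)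
qed

lemma val_odometer:
  assumes "p > 0"
  shows "val p (odometer p n i) = i mod p ^ n"
proof -
  have "[val p (odometer p n i) = i] (mod p ^ n)"
  proof (induction i)
    case 0
    have "val p (replicate n 0) = 0" by (induction n) auto
    then show ?case by (simp add: odometer_def)
  next
    case (Suc i)
    have "[val p (odometer p n (Suc i)) = val p (odometer p n i) + 1] (mod p ^ n)"
      unfolding odometer_Suc by (rule val_act_carry[OF assms odometer_in_words[OF assms]])
    moreover have "[val p (odometer p n i) + 1 = i + 1] (mod p ^ n)"
      using Suc by (intro cong_add cong_refl)
    ultimately show ?case unfolding Suc_eq_plus1 by (rule cong_trans)
  qed
  then show ?thesis using val_less[OF odometer_in_words[OF assms]] by (simp add: cong_def)
qed

lemma odometer_eq:
  assumes "p > 0" "i mod p ^ n = j mod p ^ n"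
  shows "odometer p n i = odometer p n j"
  by (rule inj_onD[OF val_inj[of p n]])
     (use assms in \<open>simp_all add: odometer_in_words val_odometer\<close>)

lemma bij_odometer:
  assumes "p > 0"
  shows "bij_betw (odometer p n) {..<p ^ n} (words p n)"
  unfolding bij_betw_def
proof
  show inj: "inj_on (odometer p n) {..<p ^ n}"
  proof (rule inj_onI)
    fix i j assume "i \<in> {..<p ^ n}" "j \<in> {..<p ^ n}" "odometer p n i = odometer p n j"
    then have "i mod p ^ n = j mod p ^ n" by (metis val_odometer[OF assms])
    then show "i = j" using \<open>i \<in> _\<close> \<open>j \<in> _\<close> by simp
  qed
  show "odometer p n ` {..<p ^ n} = words p n"
    by (rule card_subset_eq[OF finite_words])
       (use odometer_in_words[OF assms] inj in \<open>auto simp: card_image card_words\<close>)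
qed

section \<open>The difference operator modulo the prime\<close>

definition fdiff :: "(nat \<Rightarrow> int) \<Rightarrow> nat \<Rightarrow> int" where
  "fdiff f i = f (Suc i) - f i"

text \<open>The polynomial \<open>q\<close> in the shift operator, so that iterated differences
  become powers of \<open>X - 1\<close>.\<close>

definition shift_op :: "int poly \<Rightarrow> (nat \<Rightarrow> int) \<Rightarrow> nat \<Rightarrow> int" where
  "shift_op q f i = (\<Sum>j\<le>degree q. coeff q j * f (i + j))"

lemma shift_op_bound: "degree q \<le> n \<Longrightarrow> shift_op q f i = (\<Sum>j\<le>n. coeff q j * f (i + j))"
  unfolding shift_op_def by (rule sum.mono_neutral_left) (auto simp: coeff_eq_0)

lemma shift_op_add: "shift_op (q + r) f i = shift_op q f i + shift_op r f i"
  using shift_op_bound[of "q + r" "max (degree q) (degree r)"]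
    shift_op_bound[of q "max (degree q) (degree r)"] shift_op_bound[of r "max (degree q) (degree r)"]
  by (simp add: degree_add_le_max distrib_right sum.distrib)

lemma shift_op_smult: "shift_op (smult c q) f i = c * shift_op q f i"
  using shift_op_bound[of "smult c q" "degree q" f i]
  by (simp add: shift_op_def sum_distrib_left mult.assoc)

lemma shift_op_pCons_0: "shift_op (pCons 0 q) f i = shift_op q f (Suc i)"
proof -
  have "shift_op (pCons 0 q) f i = (\<Sum>j\<le>Suc (degree q). coeff (pCons 0 q) j * f (i + j))"
    by (rule shift_op_bound) (simp add: degree_pCons_le)
  then show ?thesis by (simp add: sum.atMost_Suc_shift shift_op_def del: sum.atMost_Suc)
qed

lemma shift_op_monom: "shift_op (monom c k) f i = c * f (i + k)"
  using shift_op_bound[OF degree_monom_le[of c k], of f i]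
  by (simp add: if_distrib[of "\<lambda>x. x * _"] sum.delta' cong: if_cong)

lemma funpow_fdiff: "(fdiff ^^ k) f i = shift_op ([:-1, 1:] ^ k) f i"
proof (induction k arbitrary: i)
  case 0 then show ?case by (simp add: shift_op_def)
next
  case (Suc k)
  have eq: "[:-1, 1:] ^ Suc k = pCons 0 ([:-1, 1:] ^ k) + smult (- 1 :: int) ([:-1, 1:] ^ k)"
    by simp
  have "(fdiff ^^ Suc k) f i = shift_op ([:-1, 1:] ^ k) f (Suc i) - shift_op ([:-1, 1:] ^ k) f i"
    by (simp add: fdiff_def[of "(fdiff ^^ k) f"] Suc)
  then show ?case unfolding eq shift_op_add shift_op_smult shift_op_pCons_0 by simp
qed

lemma linear_power_prime_power:
  assumes "Factorial_Ring.prime p" "odd p"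
  shows "\<exists>s. [:-1, 1:] ^ (p ^ n) = monom (1::int) (p ^ n) + [:-1:] + of_nat p * s"
proof (induction n)
  case 0 show ?case by (intro exI[of _ 0]) (simp add: monom_altdef)
next
  case (Suc n)
  then obtain s where s: "[:-1, 1:] ^ (p ^ n) = monom (1::int) (p ^ n) + [:-1:] + of_nat p * s" by blast
  let ?a = "monom (1::int) (p ^ n)"
  obtain t where t: "(?a + [:-1:] + of_nat p * s) ^ p = (?a + [:-1:]) ^ p + (of_nat p * s) ^ p + of_nat p * t"
    using freshman[OF assms(1)] by blast
  obtain u where u: "(?a + [:-1:]) ^ p = ?a ^ p + [:-1:] ^ p + of_nat p * u"
    using freshman[OF assms(1)] by blast
  have "p > 0" using assms(1) prime_gt_0_nat by blast
  then have w: "(of_nat p * s) ^ p = of_nat p * (s * (of_nat p * s) ^ (p - 1))"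
    by (cases p) (simp_all add: mult.assoc)
  have "[:-1, 1:] ^ (p ^ Suc n) = ([:-1, 1::int:] ^ (p ^ n)) ^ p"
    by (simp add: mult.commute flip: power_mult)
  also have "\<dots> = ?a ^ p + [:-1:] ^ p + of_nat p * u + of_nat p * (s * (of_nat p * s) ^ (p - 1)) + of_nat p * t"
    unfolding s t u w ..
  also have "[:-1:] ^ p = [:-1::int:]" using assms(2) by (simp add: poly_const_pow)
  also have "?a ^ p = monom 1 (p ^ Suc n)" by (simp add: monom_power mult.commute)
  finally show ?case
    by (intro exI[of _ "u + s * (of_nat p * s) ^ (p - 1) + t"]) (simp only: distrib_left add.assoc)
qed

text \<open>Since \<open>(X - 1) ^ (p ^ n) \<equiv> X ^ (p ^ n) - 1\<close> modulo \<open>p\<close>, the difference operator is nilpotent on sequences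
  of period \<open>p ^ n\<close> over \<open>\<int> / p\<close>, and its kernel consists of the constants.\<close>

lemma obtain_constant_mod_p:
  assumes p: "Factorial_Ring.prime p" "odd p"
    and M: "\<And>f. f \<in> M \<Longrightarrow> fdiff f \<in> M" and per: "\<And>f i. f \<in> M \<Longrightarrow> f (i + p ^ n) = f i"
    and e: "e \<in> M" "\<not> int p dvd e i0"
  shows "\<exists>f\<in>M. \<exists>c. \<not> int p dvd c \<and> (\<forall>i. int p dvd f i - c)"
proof -
  define P where "P k \<longleftrightarrow> (\<forall>i. int p dvd (fdiff ^^ k) e i)" for k
  have "P (p ^ n)"
    unfolding P_def
  proof
    fix i
    obtain s where s: "[:-1, 1:] ^ (p ^ n) = monom (1::int) (p ^ n) + [:-1:] + of_nat p * s"
      using linear_power_prime_power[OF p] by blast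
    have "(fdiff ^^ (p ^ n)) e i = e (i + p ^ n) - e i + int p * shift_op s e i"
      unfolding funpow_fdiff s shift_op_add
      using shift_op_monom[of "-1" 0 e i] shift_op_smult[of "int p" s e i]
      by (simp add: shift_op_monom of_nat_poly monom_0)
    then show "int p dvd (fdiff ^^ (p ^ n)) e i" using per[OF e(1)] by simp
  qed
  \<comment> \<open>The last iterated difference of \<open>e\<close> that is nonzero modulo
    \<open>p\<close> has difference zero, so it is constant modulo \<open>p\<close>.\<close>
  then have L: "P (LEAST k. P k)" by (rule LeastI)
  have "\<not> P 0" using e(2) by (auto simp: P_def)
  then obtain k where k: "(LEAST k. P k) = Suc k" using L by (metis not0_implies_Suc)
  have nk: "\<not> P k" using not_less_Least[of k P] k by simp
  define f where "f = (fdiff ^^ k) e"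
  have fM: "f \<in> M" unfolding f_def by (induction k) (auto intro: e M)
  have "P (Suc k)" using L k by simp
  then have "int p dvd f (Suc i) - f i" for i
    unfolding P_def f_def by (simp add: fdiff_def[of "(fdiff ^^ k) e"])
  then have c: "int p dvd f i - f 0" for i
  proof (induction i)
    case (Suc i)
    have "f (Suc i) - f 0 = (f (Suc i) - f i) + (f i - f 0)" by simp
    then show ?case using Suc by (metis dvd_add)
  qed simp
  moreover have "\<not> int p dvd f 0"
  proof
    assume "int p dvd f 0"
    then have "int p dvd f i" for i using c[of i] by (metis diff_add_cancel dvd_add)
    then show False using nk by (simp add: P_def f_def)
  qed
  ultimately show ?thesis using fM by blast
qed

section \<open>The Kummer tower of the iterates\<close>

context cyclotomic
begin

lemma p_gt_0: "p > 0" using p_gt_1 by simp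

lemma zeta_power_power_p: "(\<zeta> ^ k) ^ p = 1"
  using zeta_power_eq_1_iff[of "k * p"] by (simp add: power_mult)

definition pth_root :: "complex \<Rightarrow> complex" where "pth_root x = (SOME y. y ^ p = x)"

lemma pth_root_power: "pth_root x ^ p = x"
  unfolding pth_root_def by (rule someI_ex[OF nth_root_exists[OF p_gt_0]])

text \<open>The points \<open>1 - rho w\<close> for words \<open>w\<close> of length \<open>n\<close> are the roots of the \<open>n\<close>-th iterate.\<close>

definition rho :: "nat list \<Rightarrow> complex" where
  "rho = foldl (\<lambda>\<alpha> j. pth_root (\<alpha> + (1 - \<zeta>)) * \<zeta> ^ j) 1"

definition rad :: "nat list \<Rightarrow> complex" where "rad w = pth_root (rho w + (1 - \<zeta>))"

lemma rho_Nil: "rho [] = 1" by (simp add: rho_def)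

lemma rho_snoc: "rho (w @ [j]) = rad w * \<zeta> ^ j" by (simp add: rho_def rad_def)

lemma rad_power: "rad w ^ p = rho w + (1 - \<zeta>)" by (simp add: rad_def pth_root_power)

lemma rho_snoc_power: "rho (w @ [j]) ^ p = rho w + (1 - \<zeta>)"
  unfolding rho_snoc power_mult_distrib rad_power zeta_power_power_p by simp

text \<open>The product over the last letter turns \<open>x\<close> into \<open>psi x\<close>, so
  the induction moves the argument. Two values matter: \<open>x = 1 - \<zeta>\<close> gives the
  critical value, and \<open>x = z - 1\<close> factors the iterate.\<close>

lemma prod_add_rho: "(\<Prod>w\<in>words p n. x + rho w) = 1 + (psi ^^ n) x"
proof (induction n arbitrary: x)
  case 0 then show ?case by (simp add: words_0 rho_Nil)
next
  case (Suc n)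
  have "(\<Prod>j<p. x + rho (w @ [j])) = psi x + rho w" for w
    using prod_add_zeta[of x "rad w"] by (simp add: rho_snoc rad_power psi_def)
  then have "(\<Prod>w\<in>words p (Suc n). x + rho w) = (\<Prod>w\<in>words p n. psi x + rho w)"
    by (simp add: prod_words_Suc)
  also have "\<dots> = 1 + (psi ^^ Suc n) x" using Suc by (simp add: funpow_swap1)
  finally show ?case .
qed

definition gam :: "nat \<Rightarrow> complex" where "gam n = (\<Prod>w\<in>words p n. rad w)"

lemma gam_power: "gam n ^ p = crit n"
  using prod_add_rho[where n = n and x = "1 - \<zeta>"]
  by (simp add: gam_def prod_power_distrib rad_power crit_def add.commute)

lemma gam_nz: "gam n \<noteq> 0"
  using gam_power[of n] crit_nz[of n] p_gt_0 by (auto simp: zero_power)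

lemma rad_nz: "w \<in> words p n \<Longrightarrow> rad w \<noteq> 0"
  using gam_nz[of n] finite_words[of p n] by (auto simp: gam_def)

lemma rho_inj: "inj_on rho (words p n)"
proof (induction n)
  case 0 then show ?case by (simp add: words_0)
next
  case (Suc n)
  show ?case
  proof (rule inj_onI)
    fix v w assume vw: "v \<in> words p (Suc n)" "w \<in> words p (Suc n)" "rho v = rho w"
    obtain v' i where v: "v = v' @ [i]" "v' \<in> words p n" "i < p" using vw(1) by (elim words_SucE)
    obtain w' j where w: "w = w' @ [j]" "w' \<in> words p n" "j < p" using vw(2) by (elim words_SucE)
    have "rho v' = rho w'" using rho_snoc_power[of v' i] rho_snoc_power[of w' j] vw(3) v w by simp
    then have vw': "v' = w'" using Suc v w by (auto dest: inj_onD)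
    then have "\<zeta> ^ i = \<zeta> ^ j" using vw(3) rad_nz[OF v(2)] by (simp add: v(1) w(1) rho_snoc)
    then show "v = w" using v w vw' zeta_power_inj by (auto dest: inj_onD)
  qed
qed

abbreviation K :: "complex set" where "K \<equiv> rat_adjoin \<zeta>"

text \<open>Level \<open>n\<close> suffices for the generators: earlier levels are recovered from
  \<open>rho w = rho (w @ [0]) ^ p - (1 - \<zeta>)\<close>.\<close>

definition L :: "nat \<Rightarrow> complex set" where "L n = gen (K \<union> rho ` words p n)"

lemma subfield_L: "subfield (L n) complex_field"
  unfolding L_def by (rule subfield_gen)

lemma K_subset_L: "K \<subseteq> L n" unfolding L_def by (auto intro: gen_incl)

lemma zeta_in_L: "\<zeta> \<in> L n" using zeta_in_rat_adjoin K_subset_L by blast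

lemma rho_in_L: "w \<in> words p n \<Longrightarrow> rho w \<in> L n" unfolding L_def by (auto intro: gen_incl)

lemma rad_power_in_L: "w \<in> words p n \<Longrightarrow> rad w ^ p \<in> L n"
  unfolding rad_power using zeta_in_L[of n] subfield_L[of n] rho_in_L[of w n]
  by (auto intro: subfield_closed)

lemma rho_in_L_Suc:
  assumes "w \<in> words p n"
  shows "rho w \<in> L (Suc n)" "rad w \<in> L (Suc n)"
proof -
  have r: "rho (w @ [0]) \<in> L (Suc n)" by (rule rho_in_L) (use assms p_gt_0 words_snoc in auto)
  then show "rad w \<in> L (Suc n)" by (simp add: rho_snoc)
  have "rho w = rho (w @ [0]) ^ p - (1 - \<zeta>)" by (simp add: rho_snoc_power)
  also have "\<dots> \<in> L (Suc n)"
    using r zeta_in_L[of "Suc n"] subfield_L[of "Suc n"] by (intro subfield_closed)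
  finally show "rho w \<in> L (Suc n)" .
qed

lemma L_subset_Suc: "L n \<subseteq> L (Suc n)"
  unfolding L_def[of n] using K_subset_L rho_in_L_Suc(1) by (intro gen_least[OF subfield_L]) auto

lemma L_mono: "m \<le> n \<Longrightarrow> L m \<subseteq> L n"
  by (rule lift_Suc_mono_le[of L]) (rule L_subset_Suc)

lemma L_0: "L 0 = K"
  using gen_subfield[OF subfield_rat_adjoin] subfield_1[OF subfield_rat_adjoin]
  by (simp add: L_def words_0 rho_Nil insert_absorb)

lemma L_Suc: "L (Suc n) = gen (L n \<union> rad ` words p n)"
proof
  show "gen (L n \<union> rad ` words p n) \<subseteq> L (Suc n)"
    using L_subset_Suc rho_in_L_Suc(2) by (intro gen_least[OF subfield_L]) auto
  have "rho w \<in> gen (L n \<union> rad ` words p n)" if w: "w \<in> words p (Suc n)" for w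
  proof -
    obtain v j where v: "w = v @ [j]" "v \<in> words p n" using w by (elim words_SucE)
    show ?thesis unfolding v(1) rho_snoc
      using v(2) zeta_in_L[of n] subfield_gen
      by (intro subfield_mult[OF subfield_gen] subfield_power[OF subfield_gen]) (auto intro: gen_incl)
  qed
  then show "L (Suc n) \<subseteq> gen (L n \<union> rad ` words p n)"
    unfolding L_def[of "Suc n"] using K_subset_L[of n]
    by (intro gen_least[OF subfield_gen]) (auto intro: gen_incl)
qed

definition acts :: "nat \<Rightarrow> (complex \<Rightarrow> complex) \<Rightarrow> (nat list \<Rightarrow> nat) \<Rightarrow> bool" where
  "acts n \<sigma> k \<longleftrightarrow> embeds (L n) \<sigma> \<and> (\<forall>x\<in>K. \<sigma> x = x) \<and> (\<forall>w\<in>words p n. \<sigma> (rho w) = rho (act p k w))"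

lemma acts_L:
  assumes "acts n \<sigma> k" "x \<in> L n"
  shows "\<sigma> x \<in> L n"
proof -
  have "\<sigma> x \<in> L n" if "x \<in> K \<union> rho ` words p n" for x
    using that assms(1) K_subset_L[of n] rho_in_L act_in_words[OF p_gt_0] unfolding acts_def by auto
  then show ?thesis
    using embeds_gen_image_subset[of "K \<union> rho ` words p n" \<sigma> "L n"] assms subfield_L
    unfolding acts_def L_def[symmetric] by blast
qed

lemma acts_rad_power:
  assumes "acts n \<sigma> k" "w \<in> words p n"
  shows "\<sigma> (rad w ^ p) = rad (act p k w) ^ p"
proof -
  have E: "embeds (L n) \<sigma>" using assms(1) by (simp add: acts_def)
  have "1 - \<zeta> \<in> L n" using subfield_L[of n] zeta_in_L[of n] by (intro subfield_closed)
  moreover have "1 - \<zeta> \<in> K" using subfield_rat_adjoin zeta_in_rat_adjoin by (intro subfield_closed)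
  then have "\<sigma> (1 - \<zeta>) = 1 - \<zeta>" using assms(1) by (simp add: acts_def)
  ultimately show ?thesis
    unfolding rad_power using embeds_add[OF subfield_L E rho_in_L[OF assms(2)]] assms
    by (simp add: acts_def)
qed

text \<open>The label at \<open>w\<close> is read off from the child \<open>w @ [0]\<close>, at
  which \<open>rho\<close> is \<open>rad w\<close> itself. The \<open>p\<close>-th power of
  \<open>rad w\<close> then gives back the action on the level above.\<close>

lemma acts_Suc:
  assumes "acts (Suc n) \<sigma> k"
  shows "acts n \<sigma> k" and "w \<in> words p n \<Longrightarrow> \<sigma> (rad w) = rad (act p k w) * \<zeta> ^ (k w)"
proof -
  have E: "embeds (L (Suc n)) \<sigma>" and fix_K: "\<forall>x\<in>K. \<sigma> x = x"
    and \<sigma>: "\<And>w. w \<in> words p (Suc n) \<Longrightarrow> \<sigma> (rho w) = rho (act p k w)"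
    using assms by (auto simp: acts_def)
  have rad: "\<sigma> (rad w) = rad (act p k w) * \<zeta> ^ (k w)" if "w \<in> words p n" for w
  proof -
    have "\<sigma> (rho (w @ [0])) = rho (act p k (w @ [0]))"
      using that p_gt_0 by (intro \<sigma>) (simp add: words_snoc)
    then show ?thesis by (simp add: act_snoc rho_snoc zeta_power_mod)
  qed
  show "w \<in> words p n \<Longrightarrow> \<sigma> (rad w) = rad (act p k w) * \<zeta> ^ (k w)" by (rule rad)
  have "\<sigma> (rho w) = rho (act p k w)" if w: "w \<in> words p n" for w
  proof -
    have 1: "rad w ^ p - (1 - \<zeta>) = rho w" by (simp add: rad_power)
    have z: "1 - \<zeta> \<in> K" using subfield_rat_adjoin zeta_in_rat_adjoin by (intro subfield_closed)
    then have z': "1 - \<zeta> \<in> L (Suc n)" using K_subset_L by blast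
    have r: "rad w \<in> L (Suc n)" by (rule rho_in_L_Suc(2)[OF w])
    have "\<sigma> (rad w ^ p - (1 - \<zeta>)) = \<sigma> (rad w) ^ p - (1 - \<zeta>)"
      using embeds_diff[OF subfield_L E subfield_power[OF subfield_L r] z', of p]
        embeds_power[OF subfield_L E r, of p] fix_K z by simp
    also have "\<sigma> (rad w) ^ p = rad (act p k w) ^ p"
      unfolding rad[OF w] power_mult_distrib zeta_power_power_p by simp
    finally show ?thesis unfolding 1 by (simp add: rad_power)
  qed
  then show "acts n \<sigma> k"
    using embeds_mono[OF E L_subset_Suc] fix_K by (simp add: acts_def)
qed

section \<open>The simultaneous induction along the tower\<close>

definition all_realized :: "nat \<Rightarrow> bool" where
  "all_realized n \<longleftrightarrow> (\<forall>k. \<exists>\<sigma>. acts n \<sigma> k)"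

text \<open>In terms of classes modulo \<open>p\<close>-th powers in \<open>K\<close>: only those
  generated by \<open>crit i\<close> with \<open>i < n\<close> become trivial in
  \<open>L n\<close>.\<close>

definition radicals_generated :: "nat \<Rightarrow> bool" where
  "radicals_generated n \<longleftrightarrow>
     (\<forall>x\<in>L n. x ^ p \<in> K \<longrightarrow> (\<exists>k\<in>K. \<exists>f :: nat \<Rightarrow> int. x = k * (\<Prod>i<n. gam i powi f i)))"

text \<open>The starting point \<open>s\<close> is free because the cyclic automorphism shifts it:
  \<open>kummer_L\<close> takes \<open>s = 0\<close> and \<open>generated_step\<close> takes
  \<open>s = 1\<close>.\<close>

definition radicals_independent :: "nat \<Rightarrow> bool" where
  "radicals_independent n \<longleftrightarrow>
     (\<forall>s f. (\<Prod>i<p ^ n. rad (odometer p n (i + s)) powi f i) \<in> L n \<longrightarrow> (\<forall>i<p ^ n. int p dvd f i))"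

lemma rad_odometer_nz: "rad (odometer p n i) \<noteq> 0"
  using rad_nz[OF odometer_in_words[OF p_gt_0]] .

lemma prod_shift_periodic:
  fixes g :: "nat \<Rightarrow> complex"
  assumes "g N = g 0" "g 0 \<noteq> 0"
  shows "(\<Prod>i<N. g (Suc i)) = (\<Prod>i<N. g i)"
proof -
  have "g 0 * (\<Prod>i<N. g (Suc i)) = (\<Prod>i<Suc N. g i)" by (rule prod.lessThan_Suc_shift[symmetric])
  also have "\<dots> = g 0 * (\<Prod>i<N. g i)" using assms(1) by simp
  finally show ?thesis using assms(2) by simp
qed

lemma odometer_period: "odometer p n (i + p ^ n) = odometer p n i"
  by (rule odometer_eq[OF p_gt_0]) simp

lemma prod_rad_odometer: "(\<Prod>i<p ^ n. rad (odometer p n (i + s))) = gam n"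
proof (induction s)
  case 0
  show ?case unfolding gam_def
    using prod.reindex_bij_betw[OF bij_odometer[OF p_gt_0], of rad n] by simp
next
  case (Suc s)
  have "(\<Prod>i<p ^ n. rad (odometer p n (Suc i + s))) = (\<Prod>i<p ^ n. rad (odometer p n (i + s)))"
    using odometer_period[of n s]
    by (intro prod_shift_periodic) (auto simp: rad_odometer_nz add.commute)
  then show ?case using Suc by simp
qed

lemma prod_powi_power:
  "(\<Prod>i\<in>A. (b i :: complex) powi e i) ^ p = (\<Prod>i\<in>A. (b i ^ p) powi e i)"
proof -
  have "(b i powi e i) ^ p = (b i ^ p) powi e i" for i
    using power_int_mult[of "b i" "e i" "int p"] power_int_mult[of "b i" "int p" "e i"]
    by (simp add: mult.commute)
  then show ?thesis by (simp add: prod_power_distrib)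
qed

lemma prod_power_int:
  "(\<Prod>i\<in>A. (b i :: complex)) powi c = (\<Prod>i\<in>A. b i powi c)"
  by (induction A rule: infinite_finite_induct) (simp_all add: power_int_mult_distrib)

text \<open>Applied to the radicals of level \<open>n\<close>, whose \<open>p\<close>-th powers lie
  in \<open>L n\<close>: if the exponents are constant modulo \<open>p\<close>, their product is a
  power of \<open>gam n\<close> up to a factor in \<open>L n\<close>.\<close>

lemma powi_const_mod_p:
  fixes b :: "nat \<Rightarrow> complex" and e :: "nat \<Rightarrow> int"
  assumes "\<And>i. i < N \<Longrightarrow> b i \<noteq> 0" "\<And>i. i < N \<Longrightarrow> int p dvd e i - c"
  shows "(\<Prod>i<N. b i powi e i) = (\<Prod>i<N. b i) powi c * (\<Prod>i<N. (b i ^ p) powi ((e i - c) div int p))"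
proof -
  have "(\<Prod>i<N. b i powi e i) = (\<Prod>i<N. b i powi c * (b i ^ p) powi ((e i - c) div int p))"
  proof (rule prod.cong[OF refl])
    fix i assume "i \<in> {..<N}"
    then have i: "b i \<noteq> 0" "int p dvd e i - c" using assms by auto
    have "(b i ^ p) powi ((e i - c) div int p) = b i powi (int p * ((e i - c) div int p))"
      by (simp add: power_int_mult)
    also have "int p * ((e i - c) div int p) = e i - c" using i(2) by simp
    finally show "b i powi e i = b i powi c * (b i ^ p) powi ((e i - c) div int p)"
      using i(1) by (simp add: power_int_diff)
  qed
  then show ?thesis by (simp add: prod.distrib prod_power_int)
qed

lemma crit_in_K: "crit n \<in> K"
proof (induction n)
  case 0
  have "1 + (1 - \<zeta>) \<in> K" using subfield_rat_adjoin zeta_in_rat_adjoin by (intro subfield_closed)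
  then show ?case by (simp add: crit_0)
next
  case (Suc n)
  have "(crit n - 1) ^ p + (1 + (1 - \<zeta>)) \<in> K"
    using Suc subfield_rat_adjoin zeta_in_rat_adjoin by (intro subfield_closed)
  then show ?case by (simp add: crit_Suc)
qed

text \<open>The \<open>p\<close>-th power of the expression supplied by \<open>R\<close> would make
  \<open>crit n\<close> a product of powers of earlier critical values and a \<open>p\<close>-th
  power in \<open>K\<close>.\<close>

lemma gam_not_in_L:
  assumes nw: "\<not> [2 ^ (p - 1) = 1] (mod p ^ 2)" and R: "radicals_generated n"
  shows "gam n \<notin> L n"
proof
  assume "gam n \<in> L n"
  then obtain k and f :: "nat \<Rightarrow> int" where kf: "k \<in> K" "gam n = k * (\<Prod>i<n. gam i powi f i)"
    using R crit_in_K[of n] unfolding radicals_generated_def gam_power[symmetric] by blast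
  have eq: "crit n = k ^ p * (\<Prod>i<n. crit i powi f i)"
    using arg_cong[OF kf(2), of "\<lambda>x. x ^ p"]
    by (simp add: gam_power power_mult_distrib prod_powi_power)
  \<comment> \<open>\<open>crit_not_pth_power\<close> takes natural exponents, which keep the
    product in \<open>\<int>[\<zeta>]\<close>. So \<open>- f i\<close> is replaced by its residue
    modulo \<open>p\<close>, and the discrepancy \<open>p * q i\<close> goes into the
    \<open>p\<close>-th power.\<close>
  define f' where "f' i = nat ((- f i) mod int p)" for i
  define q where "q i = (f i + int (f' i)) div int p" for i
  have fq: "f i + int (f' i) = int p * q i" for i
  proof -
    have "(f i + (- f i) mod int p) mod int p = 0" by (simp add: mod_add_right_eq)
    moreover have "int (f' i) = (- f i) mod int p" using p_gt_0 by (simp add: f'_def)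
    ultimately have "int p dvd f i + int (f' i)" by (simp only: dvd_eq_mod_eq_0)
    then show ?thesis by (simp add: q_def)
  qed
  have "crit n * (\<Prod>i<n. crit i ^ f' i) = k ^ p * (\<Prod>i<n. crit i powi f i * crit i ^ f' i)"
    by (simp add: eq prod.distrib)
  also have "(\<Prod>i<n. crit i powi f i * crit i ^ f' i) = (\<Prod>i<n. (crit i powi q i) ^ p)"
  proof (rule prod.cong[OF refl])
    fix i
    have "crit i powi f i * crit i ^ f' i = crit i powi (f i + int (f' i))"
      using crit_nz by (simp add: power_int_add)
    also have "\<dots> = crit i powi (q i * int p)" by (simp add: fq mult.commute)
    also have "\<dots> = (crit i powi q i) ^ p" by (simp only: power_int_mult power_int_of_nat)
    finally show "crit i powi f i * crit i ^ f' i = (crit i powi q i) ^ p" .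
  qed
  also have "k ^ p * \<dots> = (k * (\<Prod>i<n. crit i powi q i)) ^ p"
    by (simp add: power_mult_distrib prod_power_distrib)
  finally have "crit n * (\<Prod>i<n. crit i ^ f' i) = (k * (\<Prod>i<n. crit i powi q i)) ^ p" .
  moreover have "k * (\<Prod>i<n. crit i powi q i) \<in> K"
    using kf(1) crit_in_K
    by (intro subfield_mult subfield_prod subfield_power_int subfield_rat_adjoin)
  ultimately show False using crit_not_pth_power[OF nw] by blast
qed

lemma independent_step:
  assumes nw: "\<not> [2 ^ (p - 1) = 1] (mod p ^ 2)" and P: "all_realized n" and R: "radicals_generated n"
  shows "radicals_independent n"
proof -
  let ?N = "p ^ n" and ?o = "odometer p n"
  have N0: "?N > 0" using p_gt_0 by simp
  obtain \<sigma> where \<sigma>: "acts n \<sigma> (carry p)" using P by (auto simp: all_realized_def)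
  then have E: "embeds (L n) \<sigma>" by (simp add: acts_def)
  \<comment> \<open>The exponent sequences of relations, extended periodically and with any starting
    point, so that the set is closed under differences.\<close>
  define M where "M = {e :: nat \<Rightarrow> int. (\<forall>i. e (i + ?N) = e i)
    \<and> (\<exists>s. (\<Prod>i<?N. rad (?o (i + s)) powi e i) \<in> L n)}"
  have diff: "fdiff e \<in> M" if e: "e \<in> M" for e
  proof -
    have per: "\<And>i. e (i + ?N) = e i" using e by (simp add: M_def)
    obtain s where s: "(\<Prod>i<?N. rad (?o (i + s)) powi e i) \<in> L n" using e by (auto simp: M_def)
    define y where "y = (\<Prod>i<?N. rad (?o (i + s)) powi e i)"
    define y' where "y' = (\<Prod>i<?N. rad (?o (Suc i + s)) powi e i)"
    have y: "y = (\<Prod>i<?N. rad (?o (Suc i + s)) powi e (Suc i))"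
      unfolding y_def
      using per[of 0] odometer_period[of n s]
      by (intro prod_shift_periodic[symmetric]) (auto simp: rad_odometer_nz add.commute power_int_eq_0_iff)
    have yL: "y \<in> L n" using s by (simp add: y_def)
    \<comment> \<open>The radicals need not lie in \<open>L n\<close>, so \<open>\<sigma>\<close> is
      applied only to \<open>y\<close> and to their \<open>p\<close>-th powers, which it moves one
      step along the cycle. This determines \<open>\<sigma> y\<close> as \<open>y'\<close> up to a
      power of \<open>\<zeta>\<close>, and \<open>y / y'\<close> is the relation with the
      differences of \<open>e\<close> as exponents.\<close>
    have "\<sigma> y ^ p = \<sigma> (y ^ p)" using embeds_power[OF subfield_L E yL] by simp
    also have "y ^ p = (\<Prod>i<?N. (rad (?o (i + s)) ^ p) powi e i)"
      unfolding y_def by (rule prod_powi_power)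
    also have "\<sigma> \<dots> = (\<Prod>i<?N. \<sigma> (rad (?o (i + s)) ^ p) powi e i)"
      using rad_power_in_L[OF odometer_in_words[OF p_gt_0]]
      by (subst embeds_prod[OF subfield_L E])
         (auto simp: embeds_power_int[OF subfield_L E] intro: subfield_power_int subfield_L)
    also have "\<dots> = (\<Prod>i<?N. (rad (?o (Suc i + s)) ^ p) powi e i)"
      using acts_rad_power[OF \<sigma> odometer_in_words[OF p_gt_0]] by (simp add: odometer_Suc)
    also have "\<dots> = y' ^ p" unfolding y'_def by (rule prod_powi_power[symmetric])
    finally obtain j where j: "\<sigma> y = \<zeta> ^ j * y'" using eq_zeta_mult by blast
    have "\<sigma> y / \<zeta> ^ j \<in> L n"
      by (intro subfield_divide subfield_power subfield_L zeta_in_L acts_L[OF \<sigma>] yL)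
    then have y'L: "y' \<in> L n" using j by simp
    have "(\<Prod>i<?N. rad (?o (i + Suc s)) powi fdiff e i) = y / y'"
      unfolding y y'_def by (simp add: fdiff_def power_int_diff rad_odometer_nz prod_dividef)
    also have "\<dots> \<in> L n" using yL y'L by (intro subfield_divide subfield_L)
    finally have "(\<Prod>i<?N. rad (?o (i + Suc s)) powi fdiff e i) \<in> L n" .
    moreover have "fdiff e (i + ?N) = fdiff e i" for i
      using per[of i] per[of "Suc i"] by (simp add: fdiff_def)
    ultimately show ?thesis unfolding M_def by blast
  qed
  show ?thesis
    unfolding radicals_independent_def
  proof (intro allI impI)
    fix s f i0 assume f: "(\<Prod>i<?N. rad (?o (i + s)) powi f i) \<in> L n" and i0: "i0 < ?N"
    define e where "e i = f (i mod ?N)" for i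
    have "(\<Prod>i<?N. rad (?o (i + s)) powi e i) = (\<Prod>i<?N. rad (?o (i + s)) powi f i)"
      by (intro prod.cong) (auto simp: e_def)
    then have eM: "e \<in> M" using f unfolding M_def by (auto simp: e_def intro!: exI[of _ s])
    show "int p dvd f i0"
    proof (rule ccontr)
      assume "\<not> int p dvd f i0"
      then have "\<not> int p dvd e i0" using i0 by (simp add: e_def)
      then obtain g c where g: "g \<in> M" "\<not> int p dvd c" "\<And>i. int p dvd g i - c"
        using obtain_constant_mod_p[OF prime_p odd_p diff _ eM] unfolding M_def by blast
      obtain s where s: "(\<Prod>i<?N. rad (?o (i + s)) powi g i) \<in> L n" using g(1) by (auto simp: M_def)
      define h where "h = (\<Prod>i<?N. (rad (?o (i + s)) ^ p) powi ((g i - c) div int p))"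
      have hL: "h \<in> L n" unfolding h_def
        by (intro subfield_prod subfield_power_int subfield_L rad_power_in_L odometer_in_words p_gt_0)
      have h0: "h \<noteq> 0" unfolding h_def by (simp add: rad_odometer_nz power_int_eq_0_iff)
      have "(\<Prod>i<?N. rad (?o (i + s)) powi g i) = gam n powi c * h"
        unfolding h_def using powi_const_mod_p[of ?N "\<lambda>i. rad (?o (i + s))" g c] g(3)
        by (simp add: rad_odometer_nz prod_rad_odometer)
      then have "gam n powi c = (\<Prod>i<?N. rad (?o (i + s)) powi g i) / h" using h0 by simp
      also have "\<dots> \<in> L n" by (intro subfield_divide subfield_L s hL)
      finally have gc: "gam n powi c \<in> L n" .
      have "gam n ^ nat \<bar>c\<bar> \<in> L n"
      proof (cases "c \<ge> 0")
        case True then show ?thesis using gc by (simp add: power_int_def)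
      next
        case False
        then have "gam n ^ nat \<bar>c\<bar> = inverse (gam n powi c)" by (simp add: power_int_def power_inverse)
        then show ?thesis using gc subfield_L by (simp add: subfield_inverse)
      qed
      moreover have "gam n ^ p \<in> L n" using gam_power crit_in_K K_subset_L by auto
      moreover have "\<not> p dvd nat \<bar>c\<bar>" using g(2) by (simp add: dvd_nat_abs_iff)
      ultimately have "gam n \<in> L n" using radical_mem_of_coprime[OF subfield_L] by blast
      then show False using gam_not_in_L[OF nw R] by simp
    qed
  qed
qed

lemma rad_image_odometer: "rad ` words p n = (\<lambda>i. rad (odometer p n i)) ` {..<p ^ n}"
  by (simp add: image_image flip: bij_betw_imp_surj_on[OF bij_odometer[OF p_gt_0, of n]])

lemma L_Suc': "L (Suc n) = gen (L n \<union> (\<lambda>i. rad (odometer p n i)) ` {..<p ^ n})"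
  unfolding L_Suc rad_image_odometer ..

lemma kummer_L:
  assumes Q: "radicals_independent n"
  shows "\<And>x. x \<in> L (Suc n) \<Longrightarrow> x ^ p \<in> L n \<Longrightarrow>
      \<exists>k\<in>L n. \<exists>e :: nat \<Rightarrow> int. x = k * (\<Prod>i<p ^ n. rad (odometer p n i) powi e i)"
    and "\<And>\<sigma> b'. embeds (L n) \<sigma> \<Longrightarrow> (\<And>i. i < p ^ n \<Longrightarrow> b' i ^ p = \<sigma> (rad (odometer p n i) ^ p)) \<Longrightarrow>
      \<exists>\<tau>. embeds (L (Suc n)) \<tau> \<and> (\<forall>x\<in>L n. \<tau> x = \<sigma> x) \<and> (\<forall>i<p ^ n. \<tau> (rad (odometer p n i)) = b' i)"
proof -
  have ind: "\<forall>e :: nat \<Rightarrow> int. (\<Prod>i<p ^ n. rad (odometer p n i) powi e i) \<in> L n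
      \<longrightarrow> (\<forall>i\<in>{..<p ^ n}. int p dvd e i)"
    using Q[unfolded radicals_independent_def, rule_format, of 0] by simp
  have nz: "rad (odometer p n i) \<noteq> 0" and pow: "rad (odometer p n i) ^ p \<in> L n"
    if "i \<in> {..<p ^ n}" for i
    by (rule rad_odometer_nz, rule rad_power_in_L[OF odometer_in_words[OF p_gt_0]])
  note * = kummer[of "{..<p ^ n}" "L n" "\<lambda>i. rad (odometer p n i)",
      OF finite_lessThan subfield_L zeta_in_L nz pow ind, folded L_Suc']
  show "\<exists>k\<in>L n. \<exists>e :: nat \<Rightarrow> int. x = k * (\<Prod>i<p ^ n. rad (odometer p n i) powi e i)"
    if "x \<in> L (Suc n)" "x ^ p \<in> L n" for x
    using conjunct1[OF *] that by blast
  show "\<exists>\<tau>. embeds (L (Suc n)) \<tau> \<and> (\<forall>x\<in>L n. \<tau> x = \<sigma> x) \<and> (\<forall>i<p ^ n. \<tau> (rad (odometer p n i)) = b' i)"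
    if "embeds (L n) \<sigma>" "\<And>i. i < p ^ n \<Longrightarrow> b' i ^ p = \<sigma> (rad (odometer p n i) ^ p)" for \<sigma> b'
    using conjunct2[OF *, rule_format, of \<sigma> b'] that by auto
qed

lemma realized_step:
  assumes P: "all_realized n" and Q: "radicals_independent n"
  shows "all_realized (Suc n)"
  unfolding all_realized_def
proof
  fix k
  obtain \<sigma> where \<sigma>: "acts n \<sigma> k" using P by (auto simp: all_realized_def)
  \<comment> \<open>The image of \<open>rad v\<close> is prescribed so that the children of
    \<open>v\<close> are rotated by \<open>k v\<close>.\<close>
  define b' where "b' i = rad (act p k (odometer p n i)) * \<zeta> ^ k (odometer p n i)" for i
  have "b' i ^ p = \<sigma> (rad (odometer p n i) ^ p)" for i
    unfolding acts_rad_power[OF \<sigma> odometer_in_words[OF p_gt_0]] b'_def power_mult_distrib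
      zeta_power_power_p by simp
  then obtain \<tau> where \<tau>: "embeds (L (Suc n)) \<tau>" "\<And>x. x \<in> L n \<Longrightarrow> \<tau> x = \<sigma> x"
    "\<And>i. i < p ^ n \<Longrightarrow> \<tau> (rad (odometer p n i)) = b' i"
    using kummer_L(2)[OF Q, of \<sigma> b'] \<sigma> unfolding acts_def by blast
  have fix_K: "\<forall>x\<in>K. \<tau> x = x"
    using \<tau>(2)[OF subsetD[OF K_subset_L]] \<sigma> by (simp add: acts_def)
  have "\<tau> (rho w) = rho (act p k w)" if w: "w \<in> words p (Suc n)" for w
  proof -
    obtain v j where v: "w = v @ [j]" "v \<in> words p n" using w by (elim words_SucE)
    obtain i where i: "i < p ^ n" "v = odometer p n i"
      using v(2) bij_odometer[OF p_gt_0, of n] by (auto simp: bij_betw_def)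
    have "\<zeta> ^ j \<in> K" by (intro subfield_power subfield_rat_adjoin zeta_in_rat_adjoin)
    then have "\<tau> (\<zeta> ^ j) = \<zeta> ^ j" "\<zeta> ^ j \<in> L (Suc n)" using fix_K K_subset_L by auto
    then have "\<tau> (rho w) = b' i * \<zeta> ^ j"
      unfolding v(1) rho_snoc
      using embeds_mult[OF subfield_L \<tau>(1) rho_in_L_Suc(2)[OF v(2)]] \<tau>(3)[OF i(1)] i(2) by simp
    also have "\<dots> = rho (act p k w)"
      by (simp add: v(1) act_snoc rho_snoc b'_def i(2) zeta_power_mod power_add)
    finally show ?thesis .
  qed
  then show "\<exists>\<sigma>. acts (Suc n) \<sigma> k" using \<tau>(1) fix_K unfolding acts_def by blast
qed

text \<open>The cyclic automorphism multiplies \<open>x\<close> by a power of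
  \<open>\<zeta>\<close>, so by independence the exponents of \<open>x\<close> are constant modulo
  \<open>p\<close> along the cycle. Splitting off a power of \<open>gam n\<close> leaves an element
  of \<open>L n\<close> whose \<open>p\<close>-th power lies in \<open>K\<close>, to which
  \<open>R\<close> applies.\<close>

lemma generated_step:
  assumes P: "all_realized (Suc n)" and Q: "radicals_independent n" and R: "radicals_generated n"
  shows "radicals_generated (Suc n)"
  unfolding radicals_generated_def
proof (intro ballI impI)
  fix x assume x: "x \<in> L (Suc n)" "x ^ p \<in> K"
  let ?N = "p ^ n" and ?o = "odometer p n"
  show "\<exists>k\<in>K. \<exists>f :: nat \<Rightarrow> int. x = k * (\<Prod>i<Suc n. gam i powi f i)"
  proof (cases "x = 0")
    case True then show ?thesis using subfield_0[OF subfield_rat_adjoin] by (intro bexI[of _ 0]) auto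
  next
    case False
    obtain k e where ke: "k \<in> L n" "x = k * (\<Prod>i<?N. rad (?o i) powi e i)"
      using kummer_L(1)[OF Q x(1)] x(2) K_subset_L by blast
    have k0: "k \<noteq> 0" using False ke(2) by auto
    obtain \<tau> where \<tau>: "acts (Suc n) \<tau> (carry p)" using P by (auto simp: all_realized_def)
    then have E: "embeds (L (Suc n)) \<tau>" and fix_K: "\<And>x. x \<in> K \<Longrightarrow> \<tau> x = x" by (auto simp: acts_def)
    note \<tau>' = acts_Suc[OF \<tau>]
    have "\<tau> x ^ p = x ^ p" using embeds_power[OF subfield_L E x(1), of p] fix_K[OF x(2)] by simp
    then obtain j where j: "\<tau> x = \<zeta> ^ j * x" using eq_zeta_mult by blast
    have radL: "rad (?o i) \<in> L (Suc n)" for i by (rule rho_in_L_Suc(2)[OF odometer_in_words[OF p_gt_0]])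
    have kL: "k \<in> L (Suc n)" using ke(1) L_subset_Suc by blast
    define u where "u = (\<Prod>i<?N. (\<zeta> ^ carry p (?o i)) powi e i)"
    have uL: "u \<in> L n" unfolding u_def
      by (intro subfield_prod subfield_power_int subfield_power subfield_L zeta_in_L)
    have u0: "u \<noteq> 0" unfolding u_def by (simp add: power_int_eq_0_iff)
    define Y where "Y = (\<Prod>i<?N. rad (?o (i + 1)) powi e i)"
    have Y0: "Y \<noteq> 0" unfolding Y_def by (simp add: rad_odometer_nz power_int_eq_0_iff)
    have rL: "rad (?o i) powi e i \<in> L (Suc n)" for i
      by (intro subfield_power_int subfield_L radL)
    have "\<tau> x = \<tau> k * \<tau> (\<Prod>i<?N. rad (?o i) powi e i)"
      unfolding ke(2) by (intro embeds_mult[OF subfield_L E] kL subfield_prod subfield_L rL)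
    also have "\<tau> (\<Prod>i<?N. rad (?o i) powi e i) = (\<Prod>i<?N. \<tau> (rad (?o i) powi e i))"
      by (intro embeds_prod[OF subfield_L E] rL)
    also have "\<dots> = (\<Prod>i<?N. \<tau> (rad (?o i)) powi e i)"
      by (simp add: embeds_power_int[OF subfield_L E radL])
    also have "(\<Prod>i<?N. \<tau> (rad (?o i)) powi e i) = Y * u"
      unfolding Y_def u_def prod.distrib[symmetric]
      using \<tau>'(2)[OF odometer_in_words[OF p_gt_0]] odometer_Suc[of p n]
      by (simp add: power_int_mult_distrib)
    finally have \<tau>x: "\<tau> x = \<tau> k * (Y * u)" .
    \<comment> \<open>The cyclic extension of \<open>e\<close> allows the product for
      \<open>x\<close> to start one step later, with the same radicals as in \<open>Y\<close>, so
      that the exponents can be compared.\<close>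
    define e' where "e' i = e (i mod ?N)" for i
    have "x = k * (\<Prod>i<?N. rad (?o i) powi e' i)"
      unfolding ke(2) by (intro arg_cong2[of _ _ _ _ "(*)"] prod.cong) (auto simp: e'_def)
    also have "(\<Prod>i<?N. rad (?o i) powi e' i) = (\<Prod>i<?N. rad (?o (Suc i)) powi e' (Suc i))"
      using odometer_period[of n 0] p_gt_0
      by (intro prod_shift_periodic[symmetric]) (auto simp: rad_odometer_nz power_int_eq_0_iff e'_def)
    finally have x': "x = k * (\<Prod>i<?N. rad (?o (Suc i)) powi e' (Suc i))" .
    define Z where "Z = (\<Prod>i<?N. rad (?o (Suc i)) powi e' (Suc i))"
    have Z0: "Z \<noteq> 0" unfolding Z_def by (simp add: rad_odometer_nz power_int_eq_0_iff)
    have "(\<Prod>i<?N. rad (?o (i + 1)) powi (e i - e' (Suc i))) = Y / Z"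
      unfolding Y_def Z_def by (simp add: power_int_diff rad_odometer_nz prod_dividef)
    also have "\<dots> = \<zeta> ^ j * k / (\<tau> k * u)"
    proof -
      have "\<tau> k * (Y * u) = \<zeta> ^ j * (k * Z)" using \<tau>x j x' by (simp add: Z_def)
      moreover have "\<tau> k \<noteq> 0" using embeds_eq_0_iff[OF subfield_L E kL] k0 by simp
      ultimately show ?thesis using Z0 u0 by (simp add: field_simps)
    qed
    also have "\<dots> \<in> L n"
      by (intro subfield_divide subfield_mult subfield_power subfield_L zeta_in_L ke(1) uL acts_L[OF \<tau>'(1)])
    finally have inL: "(\<Prod>i<?N. rad (?o (i + 1)) powi (e i - e' (Suc i))) \<in> L n" .
    have dvd: "int p dvd e i - e' (Suc i)" if "i < ?N" for i
      using Q[unfolded radicals_independent_def, rule_format, OF inL that] .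
    have const: "i < ?N \<Longrightarrow> int p dvd e i - e 0" for i
    proof (induction i)
      case (Suc i)
      have "e' (Suc i) = e (Suc i)" using Suc.prems by (simp add: e'_def)
      then have "int p dvd e i - e (Suc i)" using dvd[of i] Suc.prems by simp
      moreover have "int p dvd e i - e 0" using Suc by simp
      moreover have "e (Suc i) - e 0 = (e i - e 0) - (e i - e (Suc i))" by simp
      ultimately show ?case by (metis dvd_diff)
    qed simp
    define h where "h = (\<Prod>i<?N. (rad (?o i) ^ p) powi ((e i - e 0) div int p))"
    have hL: "h \<in> L n" unfolding h_def
      by (intro subfield_prod subfield_power_int subfield_L rad_power_in_L odometer_in_words p_gt_0)
    have xg: "x = (k * h) * gam n powi e 0"
      unfolding ke(2) h_def using powi_const_mod_p[of ?N "\<lambda>i. rad (?o i)" e "e 0"] const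
        prod_rad_odometer[of n 0]
      by (simp add: rad_odometer_nz)
    have "(k * h) ^ p = x ^ p / crit n powi e 0"
    proof -
      have "(gam n powi e 0) ^ p = crit n powi e 0"
        using prod_powi_power[of "\<lambda>_. gam n" "\<lambda>_. e 0" "{0}"] by (simp add: gam_power)
      then show ?thesis unfolding xg using crit_nz[of n] by (simp add: power_mult_distrib power_int_eq_0_iff)
    qed
    also have "\<dots> \<in> K" by (intro subfield_divide subfield_power_int subfield_rat_adjoin x(2) crit_in_K)
    finally have "(k * h) ^ p \<in> K" .
    moreover have "k * h \<in> L n" using ke(1) hL by (intro subfield_mult subfield_L)
    ultimately obtain l f where lf: "l \<in> K" "k * h = l * (\<Prod>i<n. gam i powi f i)"
      using R unfolding radicals_generated_def by blast
    have "x = l * (\<Prod>i<Suc n. gam i powi (f(n := e 0)) i)"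
      unfolding xg lf(2) by simp
    then show ?thesis using lf(1) by blast
  qed
qed

lemma realized_and_generated:
  assumes nw: "\<not> [2 ^ (p - 1) = 1] (mod p ^ 2)"
  shows "all_realized n \<and> radicals_generated n"
proof (induction n)
  case 0
  have "acts 0 (\<lambda>x. x) k" for k
    by (simp add: acts_def embeds_id words_0)
  moreover have "radicals_generated 0" by (auto simp: radicals_generated_def L_0)
  ultimately show ?case by (auto simp: all_realized_def)
next
  case (Suc n)
  then show ?case
    using independent_step[OF nw] realized_step generated_step by blast
qed

section \<open>The Galois group\<close>

lemma roots_poly_iterate_phi:
  "{z. poly (poly_iterate n (phi p \<zeta>)) z = 0} = (\<lambda>w. 1 - rho w) ` words p n"
proof -
  have phi: "poly (phi p \<zeta>) x = 1 + psi (x - 1)" for x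
    by (simp add: phi_def psi_def)
  have it: "(poly (phi p \<zeta>) ^^ n) z = 1 + (psi ^^ n) (z - 1)" for z
    by (induction n) (simp_all add: phi)
  have "poly (poly_iterate n (phi p \<zeta>)) z = (\<Prod>w\<in>words p n. z - 1 + rho w)" for z
    by (simp add: poly_poly_iterate it prod_add_rho)
  then have "poly (poly_iterate n (phi p \<zeta>)) z = 0 \<longleftrightarrow> (\<exists>w\<in>words p n. z - 1 + rho w = 0)" for z
    using finite_words[of p n] by simp
  moreover have "z - 1 + rho w = 0 \<longleftrightarrow> z = 1 - rho w" for z w
    by (auto simp: algebra_simps add_eq_0_iff)
  ultimately show ?thesis by auto
qed

lemma splitting_field_eq: "splitting_field K (poly_iterate n (phi p \<zeta>)) = L n"
  unfolding splitting_field_def roots_poly_iterate_phi L_def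
proof (intro antisym gen_least[OF subfield_gen] Un_least subsetI)
  show "x \<in> gen (K \<union> rho ` words p n)" if "x \<in> K" for x using that by (auto intro: gen_incl)
  show "x \<in> gen (K \<union> (\<lambda>w. 1 - rho w) ` words p n)" if "x \<in> K" for x using that by (auto intro: gen_incl)
  show "x \<in> gen (K \<union> rho ` words p n)" if x: "x \<in> (\<lambda>w. 1 - rho w) ` words p n" for x
  proof -
    obtain w where w: "w \<in> words p n" "x = 1 - rho w" using x by auto
    show ?thesis unfolding w(2) using w(1)
      by (intro subfield_diff[OF subfield_gen] subfield_1[OF subfield_gen]) (auto intro: gen_incl)
  qed
  show "x \<in> gen (K \<union> (\<lambda>w. 1 - rho w) ` words p n)" if x: "x \<in> rho ` words p n" for x
  proof -
    obtain w where w: "w \<in> words p n" "x = 1 - (1 - rho w)" using x by auto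
    have "1 - rho w \<in> gen (K \<union> (\<lambda>w. 1 - rho w) ` words p n)"
      using w(1) by (intro gen_incl) blast
    then show ?thesis unfolding w(2)
      by (rule subfield_diff[OF subfield_gen subfield_1[OF subfield_gen]])
  qed
qed

text \<open>Labels at one level can be chosen later without changing the action on words of at most
  that length.\<close>

lemma act_cong:
  "(\<And>v. length v < length w \<Longrightarrow> k v = k' v) \<Longrightarrow> act p k w = act p k' w"
proof (induction w arbitrary: k k')
  case (Cons y x)
  have "k [] = k' []" by (rule Cons.prems) simp
  moreover have "act p (\<lambda>v. k (y # v)) x = act p (\<lambda>v. k' (y # v)) x"
    by (rule Cons.IH, rule Cons.prems) simp
  ultimately show ?case by simp
qed simp

text \<open>This embeds the Galois group in the wreath product. Once the action on the points of
  level \<open>m\<close> is known, \<open>rad w\<close> must go to a \<open>p\<close>-th root of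
  \<open>rad (act p k w) ^ p\<close>, and the exponent of the root of unity is the new label at
  \<open>w\<close>.\<close>

lemma acts_ex:
  assumes E: "embeds (L n) \<sigma>" and fix_K: "\<And>x. x \<in> K \<Longrightarrow> \<sigma> x = x"
  shows "\<exists>k. acts n \<sigma> k"
proof -
  have "\<exists>k. acts m \<sigma> k" if "m \<le> n" for m
    using that
  proof (induction m)
    case 0
    then show ?case using embeds_mono[OF E L_mono[of 0 n]] fix_K subfield_1[OF subfield_rat_adjoin]
      by (auto simp: acts_def words_0 rho_Nil)
  next
    case (Suc m)
    then obtain k where k: "acts m \<sigma> k" by auto
    have E': "embeds (L (Suc m)) \<sigma>" by (rule embeds_mono[OF E L_mono[OF Suc.prems]])
    have "\<exists>c. \<sigma> (rad w) = \<zeta> ^ c * rad (act p k w)" if w: "w \<in> words p m" for w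
    proof -
      have "\<sigma> (rad w) ^ p = rad (act p k w) ^ p"
        using embeds_power[OF subfield_L E' rho_in_L_Suc(2)[OF w], of p] acts_rad_power[OF k w] by simp
      then show ?thesis using eq_zeta_mult by blast
    qed
    then obtain c where c: "\<And>w. w \<in> words p m \<Longrightarrow> \<sigma> (rad w) = \<zeta> ^ c w * rad (act p k w)" by metis
    define k' where "k' w = (if length w = m then c w else k w)" for w
    have "\<sigma> (rho w) = rho (act p k' w)" if w: "w \<in> words p (Suc m)" for w
    proof -
      obtain v j where v: "w = v @ [j]" "v \<in> words p m" using w by (elim words_SucE)
      have len: "length v = m" using v(2) by (simp add: words_def)
      have act: "act p k' v = act p k v" using len by (intro act_cong) (simp add: k'_def)
      have "\<zeta> ^ j \<in> K" by (intro subfield_power subfield_rat_adjoin zeta_in_rat_adjoin)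
      then have "\<sigma> (\<zeta> ^ j) = \<zeta> ^ j" "\<zeta> ^ j \<in> L (Suc m)" using fix_K K_subset_L by auto
      then have "\<sigma> (rho w) = \<zeta> ^ c v * rad (act p k v) * \<zeta> ^ j"
        unfolding v(1) rho_snoc
        using embeds_mult[OF subfield_L E' rho_in_L_Suc(2)[OF v(2)]] c[OF v(2)] by simp
      then show ?thesis using len
        by (simp add: v(1) act_snoc act rho_snoc zeta_power_mod power_add k'_def)
    qed
    then show ?case using E' fix_K unfolding acts_def by blast
  qed
  then show ?thesis by blast
qed

lemma galois_group_carrier:
  "\<sigma> \<in> carrier (galois_group (L n) K) \<longleftrightarrow>
     \<sigma> \<in> Bij (L n) \<and> embeds (L n) \<sigma> \<and> (\<forall>x\<in>K. \<sigma> x = x)"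
proof
  assume "\<sigma> \<in> carrier (galois_group (L n) K)"
  then have "\<sigma> \<in> Bij (L n)" "\<forall>x\<in>K. \<sigma> x = x"
    and h: "\<sigma> \<in> ring_hom (complex_field\<lparr>carrier := L n\<rparr>) (complex_field\<lparr>carrier := L n\<rparr>)"
    by (simp_all add: galois_group_def)
  moreover have "embeds (L n) \<sigma>"
    unfolding embeds_def using ring_hom_add[OF h] ring_hom_mult[OF h] ring_hom_one[OF h] by simp
  ultimately show "\<sigma> \<in> Bij (L n) \<and> embeds (L n) \<sigma> \<and> (\<forall>x\<in>K. \<sigma> x = x)" by simp
next
  assume *: "\<sigma> \<in> Bij (L n) \<and> embeds (L n) \<sigma> \<and> (\<forall>x\<in>K. \<sigma> x = x)"
  then have "\<sigma> \<in> ring_hom (complex_field\<lparr>carrier := L n\<rparr>) (complex_field\<lparr>carrier := L n\<rparr>)"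
    using bij_betw_apply[of \<sigma> "L n" "L n"]
    by (intro ring_hom_memI) (simp_all add: Bij_def embeds_def)
  then show "\<sigma> \<in> carrier (galois_group (L n) K)" using * by (simp add: galois_group_def)
qed

text \<open>As \<open>act p k\<close> permutes the words, the image of \<open>\<sigma>\<close>
  contains the generators of \<open>L n\<close>; this gives surjectivity without counting
  dimensions.\<close>

lemma restrict_acts_in_galois_group:
  assumes "acts n \<sigma> k"
  shows "restrict \<sigma> (L n) \<in> carrier (galois_group (L n) K)"
proof -
  have E: "embeds (L n) \<sigma>" and fix_K: "\<And>x. x \<in> K \<Longrightarrow> \<sigma> x = x" using assms by (auto simp: acts_def)
  have "restrict (act p k) (words p n) \<in> Bij (words p n)"
    using iterated_wreath_subgroup[OF p_gt_0, of n] unfolding subgroup_BijGroup_iff iterated_wreath_eq[OF p_gt_0]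
    by blast
  then have act: "act p k ` words p n = words p n" by (simp add: Bij_def bij_betw_def)
  have "L n \<subseteq> \<sigma> ` L n"
  proof -
    have "x \<in> \<sigma> ` L n" if "x \<in> K \<union> rho ` words p n" for x
    proof (cases "x \<in> K")
      case True then show ?thesis using fix_K[OF True] subsetD[OF K_subset_L True] by (metis imageI)
    next
      case False
      then obtain w where w: "w \<in> words p n" "x = rho w" using \<open>x \<in> _\<close> by auto
      then have "w \<in> act p k ` words p n" using act by simp
      then obtain v where v: "v \<in> words p n" "w = act p k v" by (elim imageE)
      then have "x = \<sigma> (rho v)" using assms w(2) by (simp add: acts_def)
      then show ?thesis using rho_in_L[OF v(1)] by blast
    qed
    then show ?thesis
      using gen_least[OF subfield_image[OF subfield_L E], of "K \<union> rho ` words p n"] unfolding L_def by blast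
  qed
  then have "\<sigma> ` L n = L n" using acts_L[OF assms] by blast
  then have "restrict \<sigma> (L n) \<in> Bij (L n)"
    using embeds_inj[OF subfield_L E] by (auto simp: Bij_def bij_betw_def inj_on_def)
  moreover have "embeds (L n) (restrict \<sigma> (L n))"
    using E subfield_L by (auto simp: embeds_def subfield_closed)
  ultimately show ?thesis unfolding galois_group_carrier using fix_K K_subset_L by auto
qed

text \<open>Defined from \<open>\<sigma>\<close> alone and not from a choice of labelling, which is
  unique only modulo \<open>p\<close>.\<close>

definition word_perm :: "nat \<Rightarrow> (complex \<Rightarrow> complex) \<Rightarrow> nat list \<Rightarrow> nat list" where
  "word_perm n \<sigma> = (\<lambda>w\<in>words p n. inv_into (words p n) rho (\<sigma> (rho w)))"

lemma word_perm_eq: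
  assumes "\<And>w. w \<in> words p n \<Longrightarrow> \<sigma> (rho w) = rho (act p k w)"
  shows "word_perm n \<sigma> = restrict (act p k) (words p n)"
  unfolding word_perm_def
  by (rule restrict_ext) (simp add: assms inv_into_f_f[OF rho_inj] act_in_words[OF p_gt_0])

lemma galois_group_iso:
  assumes nw: "\<not> [2 ^ (p - 1) = 1] (mod p ^ 2)"
  shows "word_perm n \<in> iso (galois_group (L n) K) (iterated_wreath_group p n)"
proof -
  let ?G = "galois_group (L n) K" and ?H = "iterated_wreath_group p n"
  have ex: "\<exists>k. acts n \<sigma> k" if "\<sigma> \<in> carrier ?G" for \<sigma>
    using acts_ex that by (auto simp: galois_group_carrier)
  have wp: "word_perm n \<sigma> = restrict (act p k) (words p n)" if "acts n \<sigma> k" for \<sigma> k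
    using that by (intro word_perm_eq) (simp add: acts_def)
  have carH: "carrier ?H = range (\<lambda>k. restrict (act p k) (words p n))"
    by (simp add: iterated_wreath_group_def iterated_wreath_eq[OF p_gt_0])
  have closed: "word_perm n \<sigma> \<in> carrier ?H" if "\<sigma> \<in> carrier ?G" for \<sigma>
    using ex[OF that] wp unfolding carH by auto
  have BijH: "f \<in> Bij (words p n)" if "f \<in> carrier ?H" for f
    using that iterated_wreath_subgroup[OF p_gt_0, of n]
    by (auto simp: iterated_wreath_group_def subgroup_BijGroup_iff)
  have mult: "word_perm n (\<sigma> \<otimes>\<^bsub>?G\<^esub> \<tau>) = word_perm n \<sigma> \<otimes>\<^bsub>?H\<^esub> word_perm n \<tau>"
    if st: "\<sigma> \<in> carrier ?G" "\<tau> \<in> carrier ?G" for \<sigma> \<tau>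
  proof -
    obtain k l where k: "acts n \<sigma> k" and l: "acts n \<tau> l" using ex st by meson
    have Bij: "\<sigma> \<in> Bij (L n)" "\<tau> \<in> Bij (L n)" using st by (auto simp: galois_group_carrier)
    have 1: "\<sigma> \<otimes>\<^bsub>?G\<^esub> \<tau> = compose (L n) \<sigma> \<tau>"
      using Bij by (simp add: galois_group_def BijGroup_def)
    have 2: "word_perm n \<sigma> \<otimes>\<^bsub>?H\<^esub> word_perm n \<tau>
        = compose (words p n) (word_perm n \<sigma>) (word_perm n \<tau>)"
      using BijH[OF closed[OF st(1)]] BijH[OF closed[OF st(2)]]
      by (simp add: iterated_wreath_group_def BijGroup_def)
    show ?thesis
    proof (rule ext)
      fix w
      show "word_perm n (\<sigma> \<otimes>\<^bsub>?G\<^esub> \<tau>) w = (word_perm n \<sigma> \<otimes>\<^bsub>?H\<^esub> word_perm n \<tau>) w"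
      proof (cases "w \<in> words p n")
        case True
        have lw: "act p l w \<in> words p n" by (rule act_in_words[OF p_gt_0 True])
        have "(\<sigma> \<otimes>\<^bsub>?G\<^esub> \<tau>) (rho w) = rho (act p k (act p l w))"
          using k l True lw rho_in_L[OF True] by (simp add: 1 compose_def acts_def)
        then show ?thesis unfolding 2 unfolding wp[OF k] wp[OF l]
          using True lw by (simp add: word_perm_def compose_def inv_into_f_f[OF rho_inj] act_in_words[OF p_gt_0])
      next
        case False then show ?thesis unfolding 2 by (simp add: word_perm_def compose_def)
      qed
    qed
  qed
  have "inj_on (word_perm n) (carrier ?G)"
  proof (rule inj_onI)
    fix \<sigma> \<tau> assume st: "\<sigma> \<in> carrier ?G" "\<tau> \<in> carrier ?G" and eq: "word_perm n \<sigma> = word_perm n \<tau>"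
    obtain k l where k: "acts n \<sigma> k" and l: "acts n \<tau> l" using ex st by meson
    have "act p k w = act p l w" if "w \<in> words p n" for w
      using fun_cong[OF eq, of w] that by (simp add: wp[OF k] wp[OF l])
    then have gens: "\<sigma> x = \<tau> x" if "x \<in> K \<union> rho ` words p n" for x
      using that k l by (auto simp: acts_def)
    have E: "embeds (gen (K \<union> rho ` words p n)) \<sigma>" "embeds (gen (K \<union> rho ` words p n)) \<tau>"
      using k l by (auto simp: acts_def L_def)
    show "\<sigma> = \<tau>"
    proof (rule extensionalityI[of _ "L n"])
      show "\<sigma> \<in> extensional (L n)" "\<tau> \<in> extensional (L n)"
        using st by (auto simp: galois_group_carrier Bij_def)
      show "\<sigma> x = \<tau> x" if "x \<in> L n" for x
        using embeds_gen_eqI[OF E gens] that by (simp add: L_def)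
    qed
  qed
  \<comment> \<open>Here the arithmetic enters: \<open>nw\<close> guarantees that every labelling
    comes from an automorphism.\<close>
  moreover have "carrier ?H \<subseteq> word_perm n ` carrier ?G"
  proof
    fix f assume "f \<in> carrier ?H"
    then obtain k where f: "f = restrict (act p k) (words p n)" unfolding carH by auto
    obtain \<sigma> where \<sigma>: "acts n \<sigma> k"
      using realized_and_generated[OF nw, of n] by (auto simp: all_realized_def)
    have "word_perm n (restrict \<sigma> (L n)) = f"
      unfolding f using \<sigma> rho_in_L by (intro word_perm_eq) (simp add: acts_def)
    then show "f \<in> word_perm n ` carrier ?G" using restrict_acts_in_galois_group[OF \<sigma>] by blast
  qed
  ultimately show ?thesis
    unfolding iso_def hom_def bij_betw_def using closed mult by blast
qed

end

theorem theorem1: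
  fixes p n :: nat and \<zeta> :: complex
  assumes "Factorial_Ring.prime p" and "odd p"
    and "primitive_root_of_unity p \<zeta>"
    and "\<not> [2 ^ (p - 1) = 1] (mod p ^ 2)"
    and "n \<ge> 1"
  shows "galois_group
           (splitting_field (rat_adjoin \<zeta>) (poly_iterate n (phi p \<zeta>))) (rat_adjoin \<zeta>)
         \<cong> iterated_wreath_group p n"
proof -
  interpret cyclotomic p \<zeta> by (rule cyclotomic.intro) (rule assms)+
  show ?thesis unfolding splitting_field_eq by (rule is_isoI[OF galois_group_iso[OF assms(4)]])
qed

end
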